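(* Let $\{X_{ij}: i,j\in\mathbb{N}\}$ be an array of exchangeable real random variables with directing random probability measure $p^*$, $(a_n)_{n\ge1}$ a sequence of real numbers and $(b_n)_{n\ge1}$ a sequence with $b_n>0$ for every $n$ and $b_n\to+\infty$. Put $c_n:=a_n/b_n$, $S_{in}:=\frac{1}{b_n}\sum_{j=1}^n X_{ij}$ and $\mathbf{S}_n:=(S_{1n}-c_n,S_{2n}-c_n,\dots)$. Let $\gamma\in\mathbb{R}$ and let $\pi$ be a probability measure. In order that $(\mathbf{S}_n)_{n\ge1}$ converge in distribution to a nondegenerate $(S_1,S_2,\dots)$ with law characterized by $$E\Big(\exp\Big\{i\sum_{k=1}^m t_kS_k\Big\}\Big)=\int_{\mathbb{R}_+}\Big(\prod_{k=1}^m\exp\Big\{it_k\gamma-\tfrac12t_k^2\sigma^2\Big\}\Big)\pi(d\sigma^2)\qquad((t_1,\dots,t_m)\in\mathbb{R}^m,\ m\in\mathbb{N})$$ it is necessary and sufficient that, for some $\tau>0$, $m_n^*(\tau)-c_n\to\gamma$ in probability and $\pi_n^{(\tau)}\Rightarrow\pi\neq\delta_0$ with $\pi(\mathbb{R}_+)=1$, and that $q_n^{(\epsilon)}\Rightarrow\delta_0$ for every $\epsilon>0$. If this is so, then $b_n=n^{1/2}h(n)$ with $h$ a slowly varying function on $\mathbb{N}$.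
   Context: All random variables are defined on a probability space $(\Omega,\mathcal{F},P)$. The array $\{X_{ij}\}$ is exchangeable if, for every $m\geq 1$, the joint distribution of every finite subset of $m$ of these random variables depends only on $m$ and not on the particular subset. By de Finetti's theorem there is a random probability measure $p^*$ on the Borel sets of $\mathbb{R}$ (the directing random measure) conditionally on which the $X_{ij}$ are i.i.d. with common distribution $p^*$; $F^*$ is its distribution function. Convergence in law of $\mathbf{S}_n$ is weak convergence of laws on $\mathbb{R}^\infty$ with the product topology; $(S_1,S_2,\dots)$ is nondegenerate when $S_1$ is a nondegenerate random variable. $\Rightarrow$ denotes weak convergence of probability measures, $\mathbb{R}_+:=[0,+\infty)$, and $\delta_x$ is the unit mass at $x$. Define, for $\tau>0$, $$m_n^*(\tau):=\frac{n}{b_n}\int_{|x|<\tau b_n}x\,p^*(dx),\qquad \sigma_n^*(\tau)^2:=\frac{n}{b_n^2}\Big[\int_{|x|<\tau b_n}x^2p^*(dx)-\Big(\int_{|x|<\tau b_n}x\,p^*(dx)\Big)^2\Big],$$ and $L_n^*(x):=nF^*(xb_n)\mathbb{I}_{(-\infty,0)}(x)-n\{1-F^*(xb_n)\}\mathbb{I}_{(0,+\infty)}(x)$ for $x\in\mathbb{R}$. $\pi_n^{(\tau)}$ is the probability distribution of $\sigma_n^*(\tau)^2$ (viewed as a random element of $[0,+\infty]$), and $q_n^{(\epsilon)}$ is the probability distribution of $L_n^*(-\epsilon)-L_n^*(\epsilon)$. A positive function $h$ on $\mathbb{N}$ is slowly varying if $h(mn)/h(n)\to1$ as $n\to\infty$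 for every $m\in\mathbb{N}$. *)

theory Defs
  imports "HOL-Probability.Probability"
begin

(* Arrays are indexed by pairs of naturals starting at 0: "X i j" is the entry X_{i+1,j+1}
   of an array whose indices start at 1.  Likewise coordinate k of a point of
   "nat \<Rightarrow> real" is the (k+1)-st coordinate of a point of R^\<infinity>. *)

(* A subset of m variables is listed by an injective map from {..<m} into the index pairs;
   all listings of all m-subsets must give the same joint law. *)
definition exchangeable_array :: "'a measure \<Rightarrow> (nat \<Rightarrow> nat \<Rightarrow> 'a \<Rightarrow> real) \<Rightarrow> bool" where
  "exchangeable_array M X \<longleftrightarrow>
     (\<forall>i j. X i j \<in> borel_measurable M) \<and>
     (\<forall>m\<ge>1. \<forall>f g :: nat \<Rightarrow> nat \<times> nat. inj_on f {..<m} \<longrightarrow> inj_on g {..<m} \<longrightarrow>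
        distr M (\<Pi>\<^sub>M k\<in>{..<m}. borel) (\<lambda>\<omega>. \<lambda>k\<in>{..<m}. X (fst (f k)) (snd (f k)) \<omega>) =
        distr M (\<Pi>\<^sub>M k\<in>{..<m}. borel) (\<lambda>\<omega>. \<lambda>k\<in>{..<m}. X (fst (g k)) (snd (g k)) \<omega>))"

(* p is a random probability measure on the Borel sets of the line and, conditionally on the
   sigma-algebra generated by p, the entries of the array are i.i.d. with distribution p. *)
definition directing_random_measure ::
    "'a measure \<Rightarrow> (nat \<Rightarrow> nat \<Rightarrow> 'a \<Rightarrow> real) \<Rightarrow> ('a \<Rightarrow> real measure) \<Rightarrow> bool" where
  "directing_random_measure M X p \<longleftrightarrow>
     p \<in> M \<rightarrow>\<^sub>M prob_algebra borel \<and>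
     (\<forall>J :: (nat \<times> nat) set. \<forall>A :: nat \<times> nat \<Rightarrow> real set.
        finite J \<longrightarrow> (\<forall>k\<in>J. A k \<in> sets borel) \<longrightarrow>
        (AE \<omega> in M.
           real_cond_exp M (vimage_algebra (space M) p (prob_algebra borel))
             (indicator {\<omega> \<in> space M. \<forall>k\<in>J. X (fst k) (snd k) \<omega> \<in> A k}) \<omega>
           = (\<Prod>k\<in>J. measure (p \<omega>) (A k))))"

(* The library's "weak_conv_m" covers only measures on the real line. *)
definition weakly_converges ::
    "(nat \<Rightarrow> 'b::topological_space measure) \<Rightarrow> 'b measure \<Rightarrow> bool" where
  "weakly_converges \<mu> \<nu> \<longleftrightarrow>
     (\<forall>f :: 'b \<Rightarrow> real. continuous_on UNIV f \<longrightarrow> bounded (range f) \<longrightarrow>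
        (\<lambda>n. \<integral>x. f x \<partial>\<mu> n) \<longlonglongrightarrow> (\<integral>x. f x \<partial>\<nu>))"

definition converges_in_prob :: "'a measure \<Rightarrow> (nat \<Rightarrow> 'a \<Rightarrow> real) \<Rightarrow> real \<Rightarrow> bool" where
  "converges_in_prob M Y c \<longleftrightarrow>
     (\<forall>\<epsilon>>0. (\<lambda>n. measure M {\<omega> \<in> space M. \<bar>Y n \<omega> - c\<bar> > \<epsilon>}) \<longlonglongrightarrow> 0)"

definition row_average :: "(nat \<Rightarrow> nat \<Rightarrow> 'a \<Rightarrow> real) \<Rightarrow> (nat \<Rightarrow> real) \<Rightarrow> nat \<Rightarrow> nat \<Rightarrow> 'a \<Rightarrow> real" where
  "row_average X b i n \<omega> = (1 / b n) * (\<Sum>j<n. X i j \<omega>)"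

(* The type "nat \<Rightarrow> real" carries the product topology, and "borel" is its Borel sigma-algebra. *)
definition row_law ::
    "'a measure \<Rightarrow> (nat \<Rightarrow> nat \<Rightarrow> 'a \<Rightarrow> real) \<Rightarrow> (nat \<Rightarrow> real) \<Rightarrow> (nat \<Rightarrow> real) \<Rightarrow> nat
      \<Rightarrow> (nat \<Rightarrow> real) measure" where
  "row_law M X a b n = distr M borel (\<lambda>\<omega> i. row_average X b i n \<omega> - a n / b n)"

definition trunc_mean :: "real measure \<Rightarrow> (nat \<Rightarrow> real) \<Rightarrow> real \<Rightarrow> nat \<Rightarrow> real" where
  "trunc_mean P b \<tau> n = real n / b n * (LINT x:{x. \<bar>x\<bar> < \<tau> * b n}|P. x)"

definition trunc_var :: "real measure \<Rightarrow> (nat \<Rightarrow> real) \<Rightarrow> real \<Rightarrow> nat \<Rightarrow> real" where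
  "trunc_var P b \<tau> n = real n / (b n)\<^sup>2 *
     ((LINT x:{x. \<bar>x\<bar> < \<tau> * b n}|P. x\<^sup>2) - (LINT x:{x. \<bar>x\<bar> < \<tau> * b n}|P. x)\<^sup>2)"

definition levy_fun :: "real measure \<Rightarrow> (nat \<Rightarrow> real) \<Rightarrow> nat \<Rightarrow> real \<Rightarrow> real" where
  "levy_fun P b n x = real n * cdf P (x * b n) * indicator {..<0} x
                      - real n * (1 - cdf P (x * b n)) * indicator {0<..} x"

(* "trunc_var" is nonnegative for a probability measure P, so "ennreal" truncates nothing here;
   the type ennreal is the compact half-line [0,\<infinity>] with its usual topology. *)
definition var_law ::
    "'a measure \<Rightarrow> ('a \<Rightarrow> real measure) \<Rightarrow> (nat \<Rightarrow> real) \<Rightarrow> real \<Rightarrow> nat \<Rightarrow> ennreal measure" where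
  "var_law M p b \<tau> n = distr M borel (\<lambda>\<omega>. ennreal (trunc_var (p \<omega>) b \<tau> n))"

definition tail_law ::
    "'a measure \<Rightarrow> ('a \<Rightarrow> real measure) \<Rightarrow> (nat \<Rightarrow> real) \<Rightarrow> real \<Rightarrow> nat \<Rightarrow> real measure" where
  "tail_law M p b \<epsilon> n = distr M borel (\<lambda>\<omega>. levy_fun (p \<omega>) b n (-\<epsilon>) - levy_fun (p \<omega>) b n \<epsilon>)"

(* \<nu> is the law of a sequence (S_1, S_2, ...) whose characteristic functions are those of the
   mixture, over a random variance with law \<pi>, of i.i.d. normal variables with mean \<gamma>. *)
definition normal_variance_mixture ::
    "real \<Rightarrow> ennreal measure \<Rightarrow> (nat \<Rightarrow> real) measure \<Rightarrow> bool" where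
  "normal_variance_mixture \<gamma> \<pi> \<nu> \<longleftrightarrow>
     (\<forall>m\<ge>1. \<forall>t :: nat \<Rightarrow> real.
        (\<integral>s. exp (\<i> * complex_of_real (\<Sum>k<m. t k * s k)) \<partial>\<nu>) =
        (LINT v:{v. v < \<infinity>}|\<pi>.
           (\<Prod>k<m. exp (\<i> * complex_of_real (t k * \<gamma>)
                        - complex_of_real ((t k)\<^sup>2 * enn2real v / 2)))))"

definition slowly_varying_nat :: "(nat \<Rightarrow> real) \<Rightarrow> bool" where
  "slowly_varying_nat h \<longleftrightarrow>
     (\<forall>n\<ge>1. h n > 0) \<and> (\<forall>m\<ge>1. (\<lambda>n. h (m * n) / h n) \<longlonglongrightarrow> 1)"

end

theory Submission
  imports Defs
begin

text \<open>
  Given the directing measure \<open>p\<close>, the rows are independent and each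
  row sum is a sum of \<open>n\<close> independent variables with law \<open>p\<close>, so the characteristic function
  of \<open>(S\<^sub>1\<^sub>n - c\<^sub>n, \<dots>, S\<^sub>m\<^sub>n - c\<^sub>n)\<close> is the expectation of a product of random variables
  \<open>\<phi>\<^sub>n(t) = exp(- i t c\<^sub>n) \<cdot> char p (t / b\<^sub>n) ^ n\<close> (lemma \<open>integral_row_law\<close>).  Every mixed moment of the
  \<open>\<phi>\<^sub>n(t)\<close> is therefore a value of a characteristic function of finitely many rows.  The mixture
  has the characteristic function \<open>exp(i \<gamma> \<Sum> t\<^sub>k) \<cdot> L(\<Sum> t\<^sub>k\<^sup>2 / 2)\<close> with \<open>L\<close> the Laplace
  transform of \<open>\<pi>\<close>, and all limits are expressed through \<open>L\<close>.

  Sufficiency.  For one fixed measure, \<open>char_power_normal_approx\<close> bounds the distance of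
  \<open>char p (t / b\<^sub>n) ^ n\<close> from \<open>exp(i t m\<^sub>n - t\<^sup>2 \<sigma>\<^sub>n\<^sup>2 / 2)\<close> explicitly by the rescaled tails and the
  truncated variance.  If the tails vanish in probability and \<open>\<sigma>\<^sub>n\<^sup>2\<close> is bounded in probability,
  the distance vanishes in probability, and the joint characteristic functions converge
  (\<open>joint_char_limit\<close>).  A continuity theorem on sequence space then gives convergence in law.

  Necessity.  Suppose that the joint characteristic functions converge.  In the limit
  \<open>|\<phi>(2t)|\<^sup>2 = |\<phi>(t)|\<^sup>8\<close>, as for every normal law; comparing second moments shows that
  \<open>|\<phi>\<^sub>n(2t)|\<^sup>2 - |\<phi>\<^sub>n(t)|\<^sup>8\<close> tends to 0 in \<open>L\<^sup>2\<close>.  Put \<open>X(t) = n (1 - |char p (t / b\<^sub>n)|\<^sup>2)\<close>, which is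
  nearly \<open>- ln |\<phi>\<^sub>n(t)|\<^sup>2\<close>.  Then \<open>4 X(t) - X(2t)\<close> vanishes in probability.  By the identity
  \<open>4 (1 - cos y) - (1 - cos 2y) = 2 (1 - cos y)\<^sup>2\<close> it equals
  \<open>2 n \<integral> (1 - cos (t x / b\<^sub>n))\<^sup>2\<close> under the symmetrised law, a nonnegative quantity which, averaged
  over \<open>t\<close> in \<open>[0,1]\<close>, dominates the tails (\<open>tails_vanish\<close>).  The same \<open>X\<close> bounds the truncated
  variance, so the normal approximation is available again: the moduli \<open>|\<phi>\<^sub>n(t)|\<^sup>2\<close> give the
  Laplace transforms of the law of \<open>\<sigma>\<^sub>n\<^sup>2\<close>, and the imaginary parts give the mean.

  Normalising constants.  The moduli \<open>|char p (1 / b\<^sub>n)| ^ (2 m n)\<close> can be read as those of \<open>m\<close>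
  blocks of length \<open>n\<close> at scale \<open>b\<^sub>n\<close>, or of one block of length \<open>m n\<close> at scale \<open>b\<^sub>m\<^sub>n\<close>.  The two
  readings agree only if \<open>b\<^sub>m\<^sub>n / b\<^sub>n\<close> tends to \<open>sqrt m\<close>, because \<open>L\<close> is strictly decreasing
  (\<open>scale_ratio_limit\<close>).
\<close>

section \<open>Truncated moments and the normal approximation\<close>

definition trunc_scaled :: "(nat \<Rightarrow> real) \<Rightarrow> real \<Rightarrow> nat \<Rightarrow> real \<Rightarrow> real" where
  "trunc_scaled b \<tau> n x = indicator {x. \<bar>x\<bar> < \<tau> * b n} x * (x / b n)"

text \<open>
  The inequality is not strict, so that at \<open>\<epsilon> = \<tau>\<close> the event is the complement of the set
  over which the truncated moments are taken.
\<close>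

definition exceedance :: "real measure \<Rightarrow> (nat \<Rightarrow> real) \<Rightarrow> real \<Rightarrow> nat \<Rightarrow> real" where
  "exceedance P b \<epsilon> n = real n * measure P {x. \<epsilon> * b n \<le> \<bar>x\<bar>}"

lemma exceedance_nonneg: "0 \<le> exceedance P b \<epsilon> n"
  by (simp add: exceedance_def)

lemma borel_measurable_trunc_scaled [measurable]: "trunc_scaled b \<tau> n \<in> borel_measurable borel"
  unfolding trunc_scaled_def[abs_def] by measurable

lemma abs_trunc_scaled_le:
  assumes "b n > 0" "\<tau> > 0"
  shows "\<bar>trunc_scaled b \<tau> n x\<bar> \<le> \<tau>"
  using assms by (auto simp: trunc_scaled_def indicator_def abs_mult field_simps)

lemma exp_minus_taylor: "\<bar>exp (- x) - (1 - x)\<bar> \<le> x\<^sup>2 / 2" if "0 \<le> x" for x :: real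
proof -
  have a: "1 - x \<le> exp (- x)" using exp_ge_add_one_self[of "- x"] by simp
  have "exp (- x) \<le> 1 - x + x\<^sup>2 / 2"
  proof -
    let ?f = "\<lambda>x. 1 - x + x\<^sup>2 / 2 - exp (- x) :: real"
    have "?f 0 \<le> ?f x"
    proof (rule DERIV_nonneg_imp_nondecreasing[OF that])
      fix y :: real assume "0 \<le> y"
      have "(?f has_real_derivative (- 1 + y + exp (- y))) (at y)"
        by (auto intro!: derivative_eq_intros)
      moreover have "0 \<le> - 1 + y + exp (- y)" using exp_ge_add_one_self[of "- y"] by simp
      ultimately show "\<exists>z. DERIV ?f y :> z \<and> 0 \<le> z" by blast
    qed
    then show ?thesis by simp
  qed
  then show ?thesis using a by simp
qed

context real_distribution
begin

lemma levy_jump_eq: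
  assumes "\<epsilon> > 0"
  shows "levy_fun M b n (- \<epsilon>) - levy_fun M b n \<epsilon>
    = real n * (measure M {.. - (\<epsilon> * b n)} + measure M {\<epsilon> * b n <..})"
proof -
  have "1 - cdf M (\<epsilon> * b n) = measure M {\<epsilon> * b n <..}"
  proof -
    have "measure M (space M - {..\<epsilon> * b n}) = 1 - measure M {..\<epsilon> * b n}"
      by (intro prob_compl) auto
    moreover have "space M - {..\<epsilon> * b n} = {\<epsilon> * b n <..}" by auto
    ultimately show ?thesis by (simp add: cdf_def)
  qed
  then show ?thesis
    using assms by (simp add: levy_fun_def cdf_def distrib_left)
qed

lemma levy_jump_nonneg:
  assumes "\<epsilon> > 0"
  shows "0 \<le> levy_fun M b n (- \<epsilon>) - levy_fun M b n \<epsilon>"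
  by (simp add: levy_jump_eq[OF assms])

lemma levy_jump_le_exceedance:
  assumes "\<epsilon> > 0" "b n > 0"
  shows "levy_fun M b n (- \<epsilon>) - levy_fun M b n \<epsilon> \<le> exceedance M b \<epsilon> n"
proof -
  have p: "0 < \<epsilon> * b n" using assms by simp
  have "measure M {.. - (\<epsilon> * b n)} + measure M {\<epsilon> * b n <..}
      = measure M ({.. - (\<epsilon> * b n)} \<union> {\<epsilon> * b n <..})"
    using p by (intro finite_measure_Union[symmetric]) auto
  also have "\<dots> \<le> measure M {x. \<epsilon> * b n \<le> \<bar>x\<bar>}"
    using p by (intro finite_measure_mono) auto
  finally show ?thesis
    unfolding levy_jump_eq[OF assms(1)] exceedance_def by (intro mult_left_mono) auto
qed

text \<open>
  The distribution function is right continuous, so the jump of the Levy function between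
  \<open>- \<epsilon>\<close> and \<open>\<epsilon>\<close> misses the point \<open>\<epsilon> b\<^sub>n\<close> itself.  A smaller \<open>\<epsilon>'\<close> recovers that point.
\<close>

lemma exceedance_le_levy_jump:
  assumes "0 < \<epsilon>'" "\<epsilon>' < \<epsilon>" "b n > 0"
  shows "exceedance M b \<epsilon> n \<le> levy_fun M b n (- \<epsilon>') - levy_fun M b n \<epsilon>'"
proof -
  have p: "0 < \<epsilon>' * b n" "\<epsilon>' * b n < \<epsilon> * b n" using assms by simp_all
  have "measure M {x. \<epsilon> * b n \<le> \<bar>x\<bar>} \<le> measure M ({.. - (\<epsilon>' * b n)} \<union> {\<epsilon>' * b n <..})"
    using p by (intro finite_measure_mono) auto
  also have "\<dots> = measure M {.. - (\<epsilon>' * b n)} + measure M {\<epsilon>' * b n <..}"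
    using p by (intro finite_measure_Union) auto
  finally show ?thesis
    unfolding levy_jump_eq[OF assms(1)] exceedance_def by (intro mult_left_mono) auto
qed

lemma integrable_trunc_scaled:
  assumes "b n > 0" "\<tau> > 0"
  shows "integrable M (\<lambda>x. trunc_scaled b \<tau> n x ^ k)"
  using abs_trunc_scaled_le[where b=b and n=n, OF assms]
  by (intro integrable_const_bound[where B="\<tau> ^ k"]) (auto simp: power_abs intro!: power_mono)

lemma trunc_mean_eq:
  "trunc_mean M b \<tau> n = real n * expectation (trunc_scaled b \<tau> n)"
proof -
  have "expectation (trunc_scaled b \<tau> n)
      = expectation (\<lambda>x. indicator {x. \<bar>x\<bar> < \<tau> * b n} x *\<^sub>R x / b n)"
    by (intro Bochner_Integration.integral_cong) (auto simp: trunc_scaled_def)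
  then show ?thesis
    by (simp add: trunc_mean_def set_lebesgue_integral_def)
qed

lemma trunc_var_eq:
  assumes "b n > 0" "\<tau> > 0"
  shows "trunc_var M b \<tau> n = real n * variance (trunc_scaled b \<tau> n)"
proof -
  have 1: "expectation (\<lambda>x. (trunc_scaled b \<tau> n x)\<^sup>2)
      = expectation (\<lambda>x. indicator {x. \<bar>x\<bar> < \<tau> * b n} x *\<^sub>R x\<^sup>2 / (b n)\<^sup>2)"
    by (intro Bochner_Integration.integral_cong)
      (auto simp: trunc_scaled_def indicator_def power_divide)
  have 2: "expectation (trunc_scaled b \<tau> n)
      = expectation (\<lambda>x. indicator {x. \<bar>x\<bar> < \<tau> * b n} x *\<^sub>R x / b n)"
    by (intro Bochner_Integration.integral_cong) (auto simp: trunc_scaled_def)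
  have "variance (trunc_scaled b \<tau> n)
      = expectation (\<lambda>x. (trunc_scaled b \<tau> n x)\<^sup>2) - (expectation (trunc_scaled b \<tau> n))\<^sup>2"
    using integrable_trunc_scaled[where b=b and n=n, OF assms, of 1] integrable_trunc_scaled[where b=b and n=n, OF assms, of 2]
    by (intro variance_eq) auto
  moreover have "trunc_var M b \<tau> n = real n *
      (expectation (\<lambda>x. (trunc_scaled b \<tau> n x)\<^sup>2) - (expectation (trunc_scaled b \<tau> n))\<^sup>2)"
    unfolding 1 2
    by (simp add: trunc_var_def set_lebesgue_integral_def power_divide diff_divide_distrib algebra_simps)
  ultimately show ?thesis by simp
qed

lemma trunc_var_nonneg:
  assumes "b n > 0" "\<tau> > 0"
  shows "0 \<le> trunc_var M b \<tau> n"
  by (simp add: trunc_var_eq[where b=b and n=n, OF assms])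

lemma abs_mean_trunc_scaled_le:
  assumes "b n > 0" "0 < \<epsilon>" "\<epsilon> \<le> \<tau>"
  shows "\<bar>expectation (trunc_scaled b \<tau> n)\<bar> \<le> \<epsilon> + \<tau> * measure M {x. \<epsilon> * b n \<le> \<bar>x\<bar>}"
proof -
  have \<tau>: "\<tau> > 0" using assms by simp
  have "\<bar>expectation (trunc_scaled b \<tau> n)\<bar> \<le> expectation (\<lambda>x. \<bar>trunc_scaled b \<tau> n x\<bar>)"
    by (rule integral_abs_bound)
  also have "\<dots> \<le> expectation (\<lambda>x. \<epsilon> + \<tau> * indicator {x. \<epsilon> * b n \<le> \<bar>x\<bar>} x)"
  proof (intro integral_mono)
    show "integrable M (\<lambda>x. \<bar>trunc_scaled b \<tau> n x\<bar>)"
      using integrable_trunc_scaled[where b=b and n=n, OF assms(1) \<tau>, of 1] by auto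
    show "integrable M (\<lambda>x. \<epsilon> + \<tau> * indicator {x. \<epsilon> * b n \<le> \<bar>x\<bar>} x)"
      by (intro Bochner_Integration.integrable_add integrable_mult_right) (auto simp: integrable_indicator_iff less_top[symmetric])
    fix x
    show "\<bar>trunc_scaled b \<tau> n x\<bar> \<le> \<epsilon> + \<tau> * indicator {x. \<epsilon> * b n \<le> \<bar>x\<bar>} x"
    proof (cases "\<epsilon> * b n \<le> \<bar>x\<bar>")
      case True
      then show ?thesis
        using abs_trunc_scaled_le[where b=b and n=n, OF assms(1) \<tau>, of x] assms by simp
    next
      case False
      then show ?thesis
        using assms by (auto simp: trunc_scaled_def indicator_def abs_mult field_simps)
    qed
  qed
  also have "\<dots> = \<epsilon> + \<tau> * measure M {x. \<epsilon> * b n \<le> \<bar>x\<bar>}"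
    by (subst Bochner_Integration.integral_add)
      (auto simp: integrable_indicator_iff less_top[symmetric] prob_space[simplified])
  finally show ?thesis .
qed

text \<open>
  No third moment is assumed: where \<open>|x| < \<epsilon> b\<^sub>n\<close> the centred variable is at most
  \<open>2 \<epsilon> + \<tau> q\<close>, so one factor can be pulled out of the cube and the variance remains; elsewhere
  the variable is at most \<open>2 \<tau>\<close>, on an event whose probability times \<open>n\<close> is \<open>q\<close>.
\<close>

lemma third_moment_trunc_scaled_le:
  assumes "b n > 0" "0 < \<epsilon>" "\<epsilon> \<le> \<tau>" "n \<ge> 1"
  defines "q \<equiv> exceedance M b \<epsilon> n" and "m \<equiv> expectation (trunc_scaled b \<tau> n)"
  shows "real n * expectation (\<lambda>x. \<bar>trunc_scaled b \<tau> n x - m\<bar> ^ 3)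
    \<le> (2 * \<epsilon> + \<tau> * q) * trunc_var M b \<tau> n + 8 * \<tau> ^ 3 * q"
proof -
  have \<tau>: "\<tau> > 0" using assms by simp
  let ?A = "{x. \<epsilon> * b n \<le> \<bar>x\<bar>}"
  let ?Y = "trunc_scaled b \<tau> n"
  note Yb = abs_trunc_scaled_le[where b=b and n=n, OF assms(1) \<tau>]
  have int: "integrable M (\<lambda>x. \<bar>?Y x - m\<bar> ^ k)" for k
    using Yb
    by (intro integrable_const_bound[where B="(\<tau> + \<bar>m\<bar>) ^ k"])
      (auto simp: power_abs intro!: power_mono order_trans[OF abs_triangle_ineq4] add_mono)
  have pr: "measure M ?A \<le> q"
  proof -
    have "1 * measure M ?A \<le> real n * measure M ?A" using assms by (intro mult_right_mono) auto
    then show ?thesis by (simp add: q_def exceedance_def)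
  qed
  have m1: "\<bar>m\<bar> \<le> \<epsilon> + \<tau> * q"
    using abs_mean_trunc_scaled_le[where b=b and n=n, OF assms(1-3)] pr \<tau> mult_left_mono[OF pr, of \<tau>]
    unfolding m_def by linarith
  have m2: "\<bar>m\<bar> \<le> \<tau>"
  proof -
    have "\<bar>m\<bar> \<le> expectation (\<lambda>x. \<bar>?Y x\<bar>)" unfolding m_def by (rule integral_abs_bound)
    also have "\<dots> \<le> expectation (\<lambda>x. \<tau>)"
      using integrable_trunc_scaled[where b=b and n=n, OF assms(1) \<tau>, of 1] Yb by (intro integral_mono) auto
    finally show ?thesis by (simp add: prob_space[simplified])
  qed
  have pt: "\<bar>?Y x - m\<bar> ^ 3 \<le> (2 * \<epsilon> + \<tau> * q) * \<bar>?Y x - m\<bar> ^ 2 + 8 * \<tau> ^ 3 * indicator ?A x" for x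
  proof (cases "x \<in> ?A")
    case True
    have "\<bar>?Y x - m\<bar> \<le> 2 * \<tau>" using Yb[of x] m2 by linarith
    then have "\<bar>?Y x - m\<bar> ^ 3 \<le> (2 * \<tau>) ^ 3" by (intro power_mono) auto
    moreover have "0 \<le> (2 * \<epsilon> + \<tau> * q) * \<bar>?Y x - m\<bar> ^ 2"
      using assms \<tau> by (auto simp: exceedance_nonneg q_def intro!: mult_nonneg_nonneg add_nonneg_nonneg)
    ultimately show ?thesis using True by (simp add: power_mult_distrib)
  next
    case False
    then have "\<bar>?Y x\<bar> \<le> \<epsilon>"
      using assms by (auto simp: trunc_scaled_def indicator_def abs_mult field_simps)
    then have "\<bar>?Y x - m\<bar> \<le> 2 * \<epsilon> + \<tau> * q" using m1 by linarith
    then have "\<bar>?Y x - m\<bar> * \<bar>?Y x - m\<bar> ^ 2 \<le> (2 * \<epsilon> + \<tau> * q) * \<bar>?Y x - m\<bar> ^ 2"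
      by (intro mult_right_mono) auto
    then show ?thesis using False by (simp add: power3_eq_cube power2_eq_square mult.assoc)
  qed
  have "expectation (\<lambda>x. \<bar>?Y x - m\<bar> ^ 3)
      \<le> expectation (\<lambda>x. (2 * \<epsilon> + \<tau> * q) * \<bar>?Y x - m\<bar> ^ 2 + 8 * \<tau> ^ 3 * indicator ?A x)"
    using int[of 3] int[of 2] pt
    by (intro integral_mono Bochner_Integration.integrable_add integrable_mult_right)
      (auto simp: integrable_indicator_iff less_top[symmetric])
  also have "\<dots> = (2 * \<epsilon> + \<tau> * q) * variance ?Y + 8 * \<tau> ^ 3 * measure M ?A"
    using int[of 2]
    by (subst Bochner_Integration.integral_add)
      (auto simp: integrable_indicator_iff less_top[symmetric] m_def)
  finally have "real n * expectation (\<lambda>x. \<bar>?Y x - m\<bar> ^ 3)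
      \<le> real n * ((2 * \<epsilon> + \<tau> * q) * variance ?Y + 8 * \<tau> ^ 3 * measure M ?A)"
    by (intro mult_left_mono) auto
  also have "\<dots> = (2 * \<epsilon> + \<tau> * q) * trunc_var M b \<tau> n + 8 * \<tau> ^ 3 * q"
    by (simp add: trunc_var_eq[where b=b and n=n, OF assms(1) \<tau>] q_def exceedance_def algebra_simps)
  finally show ?thesis .
qed

text \<open>
  The \<open>n\<close>-th powers of two numbers in the unit disk differ by at most \<open>n\<close> times their distance,
  so it suffices to compare one factor.  Truncation costs the probability of the exceedance event,
  the second-order expansion costs the third absolute moment, and passing from
  \<open>1 - t\<^sup>2 v / 2\<close> to the exponential costs the square of the linear term.  The bound increases with
  \<open>|t|\<close> and so is uniform over bounded frequencies.
\<close>

lemma char_power_normal_approx: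
  assumes "b n > 0" "0 < \<epsilon>" "\<epsilon> \<le> \<tau>" "n \<ge> 1"
  defines "q \<equiv> exceedance M b \<epsilon> n" and "s \<equiv> trunc_var M b \<tau> n"
  shows "cmod (char M (t / b n) ^ n - iexp (t * trunc_mean M b \<tau> n) * exp (- (t\<^sup>2 * s / 2)))
    \<le> 2 * q + \<bar>t\<bar> ^ 3 / 6 * ((2 * \<epsilon> + \<tau> * q) * s + 8 * \<tau> ^ 3 * q) + t ^ 4 * s\<^sup>2 / (8 * real n)"
proof -
  have \<tau>: "\<tau> > 0" using assms by simp
  have n0: "real n > 0" using assms by simp
  let ?A = "{x. \<epsilon> * b n \<le> \<bar>x\<bar>}"
  let ?Y = "trunc_scaled b \<tau> n"
  define m where "m = expectation ?Y"
  define v where "v = variance ?Y"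
  have sv: "s = real n * v" by (simp add: s_def v_def trunc_var_eq[where b=b and n=n, OF assms(1) \<tau>])
  have v0: "0 \<le> v" unfolding v_def by simp
  note Yb = abs_trunc_scaled_le[where b=b and n=n, OF assms(1) \<tau>]
  have int: "integrable M (\<lambda>x. (?Y x - m) ^ k)" for k
    using Yb
    by (intro integrable_const_bound[where B="(\<tau> + \<bar>m\<bar>) ^ k"])
      (auto simp: power_abs intro!: power_mono order_trans[OF abs_triangle_ineq4] add_mono)
  have inta: "integrable M (\<lambda>x. \<bar>?Y x - m\<bar> ^ k)" for k
    using int[of k] by (simp flip: power_abs)
  have int1: "integrable M ?Y" using integrable_trunc_scaled[where b=b and n=n, OF assms(1) \<tau>, of 1] by simp
  define \<mu> where "\<mu> = distr M borel (\<lambda>x. ?Y x - m)"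
  interpret \<mu>: real_distribution \<mu> unfolding \<mu>_def by (intro real_distribution_distr) auto
  have e0: "expectation (\<lambda>x. ?Y x - m) = 0"
    using int1 by (simp add: m_def prob_space[simplified])
  have a1: "cmod (char \<mu> t - (1 - t\<^sup>2 * v / 2)) \<le> \<bar>t\<bar> ^ 3 / 6 * expectation (\<lambda>x. \<bar>?Y x - m\<bar> ^ 3)"
  proof -
    have "cmod (char \<mu> t - (1 - t\<^sup>2 * v / 2))
      \<le> (t\<^sup>2 / 6) * expectation (\<lambda>x. min (6 * (?Y x - m)\<^sup>2) (\<bar>t\<bar> * \<bar>?Y x - m\<bar> ^ 3))"
      by (rule char_approx3') (use int[of 1] int[of 2] e0 in \<open>auto simp: \<mu>_def v_def m_def[symmetric]\<close>)
    also have "\<dots> \<le> (t\<^sup>2 / 6) * expectation (\<lambda>x. \<bar>t\<bar> * \<bar>?Y x - m\<bar> ^ 3)"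
      using int[of 2] inta[of 3]
      by (intro mult_left_mono integral_mono integrable_min integrable_mult_right) auto
    also have "\<dots> = \<bar>t\<bar> ^ 3 / 6 * expectation (\<lambda>x. \<bar>?Y x - m\<bar> ^ 3)"
      by (simp add: power3_eq_cube power2_eq_square)
    finally show ?thesis .
  qed
  have a2: "cmod (char M (t / b n) - iexp (t * m) * char \<mu> t) \<le> 2 * measure M ?A"
  proof -
    have i1: "integrable M (\<lambda>x. iexp (t / b n * x))" by (intro integrable_iexp) auto
    have i2: "integrable M (\<lambda>x. iexp (t * ?Y x))" by (intro integrable_iexp) auto
    have "iexp (t * m) * char \<mu> t = (CLINT x|M. iexp (t * m) * iexp (t * (?Y x - m)))"
      by (simp add: char_def \<mu>_def integral_distr)
    also have "\<dots> = (CLINT x|M. iexp (t * ?Y x))"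
      by (intro Bochner_Integration.integral_cong) (auto simp: exp_add[symmetric] algebra_simps)
    finally have "char M (t / b n) - iexp (t * m) * char \<mu> t
        = (CLINT x|M. iexp (t / b n * x) - iexp (t * ?Y x))"
      using i1 i2 by (simp add: char_def Bochner_Integration.integral_diff)
    also have "cmod \<dots> \<le> (LINT x|M. cmod (iexp (t / b n * x) - iexp (t * ?Y x)))"
      by (rule integral_norm_bound)
    also have "\<dots> \<le> (LINT x|M. 2 * indicator ?A x)"
    proof (intro integral_mono)
      show "integrable M (\<lambda>x. cmod (iexp (t / b n * x) - iexp (t * ?Y x)))"
        using i1 i2 by auto
      show "integrable M (\<lambda>x. 2 * indicator ?A x :: real)"
        by (auto simp: integrable_indicator_iff less_top[symmetric])
      fix x
      have "cmod (iexp (t / b n * x) - iexp (t * ?Y x)) \<le> 1 + 1"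
        by (intro order_trans[OF norm_triangle_ineq4]) simp
      moreover have "?Y x = x / b n" if "x \<notin> ?A"
      proof -
        have "\<epsilon> * b n \<le> \<tau> * b n" using assms by (intro mult_right_mono) auto
        then show ?thesis using that by (auto simp: trunc_scaled_def)
      qed
      ultimately show "cmod (iexp (t / b n * x) - iexp (t * ?Y x)) \<le> 2 * indicator ?A x"
        by (cases "x \<in> ?A") auto
    qed
    finally show ?thesis by simp
  qed
  let ?e = "exp (- (t\<^sup>2 * v / 2))"
  have a3: "\<bar>?e - (1 - t\<^sup>2 * v / 2)\<bar> \<le> (t\<^sup>2 * v / 2)\<^sup>2 / 2"
    using v0 by (intro exp_minus_taylor) auto
  have "cmod (char \<mu> t - ?e) \<le> cmod (char \<mu> t - (1 - t\<^sup>2 * v / 2)) + cmod (complex_of_real ((1 - t\<^sup>2 * v / 2) - ?e))"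
    by (rule order_trans[OF _ norm_triangle_ineq]) (simp add: algebra_simps)
  also have "\<dots> \<le> \<bar>t\<bar> ^ 3 / 6 * expectation (\<lambda>x. \<bar>?Y x - m\<bar> ^ 3) + (t\<^sup>2 * v / 2)\<^sup>2 / 2"
    unfolding norm_of_real using a1 a3 abs_minus_commute[of ?e] by (intro add_mono) simp_all
  finally have a4: "cmod (char \<mu> t - ?e) \<le> \<bar>t\<bar> ^ 3 / 6 * expectation (\<lambda>x. \<bar>?Y x - m\<bar> ^ 3) + (t\<^sup>2 * v / 2)\<^sup>2 / 2" .
  have "cmod (char M (t / b n) - iexp (t * m) * ?e)
      \<le> cmod (char M (t / b n) - iexp (t * m) * char \<mu> t) + cmod (iexp (t * m) * (char \<mu> t - ?e))"
    by (rule order_trans[OF _ norm_triangle_ineq]) (simp add: algebra_simps)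
  also have "\<dots> \<le> 2 * measure M ?A + (\<bar>t\<bar> ^ 3 / 6 * expectation (\<lambda>x. \<bar>?Y x - m\<bar> ^ 3) + (t\<^sup>2 * v / 2)\<^sup>2 / 2)"
    using a2 a4 by (intro add_mono) (auto simp: norm_mult)
  finally have a5: "cmod (char M (t / b n) - iexp (t * m) * ?e)
    \<le> 2 * measure M ?A + (\<bar>t\<bar> ^ 3 / 6 * expectation (\<lambda>x. \<bar>?Y x - m\<bar> ^ 3) + (t\<^sup>2 * v / 2)\<^sup>2 / 2)" .
  have pw: "(iexp (t * m) * ?e) ^ n = iexp (t * trunc_mean M b \<tau> n) * exp (- (t\<^sup>2 * s / 2))"
    by (simp add: power_mult_distrib exp_of_nat_mult[symmetric] trunc_mean_eq m_def sv
      exp_of_real[symmetric] mult_ac del: exp_of_real)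
  have "cmod (char M (t / b n) ^ n - (iexp (t * m) * ?e) ^ n) \<le> n * cmod (char M (t / b n) - iexp (t * m) * ?e)"
    using v0 by (intro norm_power_diff) (auto simp: cmod_char_le_1 norm_mult)
  also have "\<dots> \<le> n * (2 * measure M ?A + (\<bar>t\<bar> ^ 3 / 6 * expectation (\<lambda>x. \<bar>?Y x - m\<bar> ^ 3) + (t\<^sup>2 * v / 2)\<^sup>2 / 2))"
    using a5 by (intro mult_left_mono) auto
  also have "\<dots> = 2 * q + \<bar>t\<bar> ^ 3 / 6 * (real n * expectation (\<lambda>x. \<bar>?Y x - m\<bar> ^ 3)) + t ^ 4 * s\<^sup>2 / (8 * real n)"
    using n0 by (simp add: q_def exceedance_def sv field_simps power2_eq_square power4_eq_xxxx)
  also have "\<dots> \<le> 2 * q + \<bar>t\<bar> ^ 3 / 6 * ((2 * \<epsilon> + \<tau> * q) * s + 8 * \<tau> ^ 3 * q) + t ^ 4 * s\<^sup>2 / (8 * real n)"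
    using third_moment_trunc_scaled_le[where b=b and n=n, OF assms(1-4)]
    by (intro add_mono mult_left_mono order_refl) (auto simp: q_def s_def m_def)
  finally show ?thesis unfolding pw .
qed

end

section \<open>Symmetrisation\<close>

definition symmetrized :: "real measure \<Rightarrow> real measure" where
  "symmetrized P = distr (P \<Otimes>\<^sub>M P) borel (\<lambda>z. fst z - snd z)"

text \<open>
  The exponent of the symmetrised row sum: \<open>(1 - X / n) ^ n\<close> is the squared modulus of the
  characteristic function of a row sum, so \<open>X\<close> is close to minus its logarithm.
\<close>

definition char_deficit :: "real measure \<Rightarrow> (nat \<Rightarrow> real) \<Rightarrow> nat \<Rightarrow> real \<Rightarrow> real" where
  "char_deficit P b n t = real n * (1 - (cmod (char P (t / b n)))\<^sup>2)"

text \<open>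
  For a normal law the exponent is \<open>c t\<^sup>2\<close>, and four times its value at \<open>t\<close> is its value at
  \<open>2 t\<close>.  This quantity is half of the deviation from that rule (\<open>nongaussian_defect_eq\<close>), written as an integral of
  a nonnegative function.
\<close>

definition nongaussian_defect :: "real measure \<Rightarrow> (nat \<Rightarrow> real) \<Rightarrow> nat \<Rightarrow> real \<Rightarrow> real" where
  "nongaussian_defect P b n t = real n * (LINT x|symmetrized P. (1 - cos (t * (x / b n)))\<^sup>2)"

text \<open>
  Independence of the two coordinates, for bounded functions with values in a field.
\<close>

lemma (in pair_prob_space) integral_pair_mult:
  fixes f :: "'a \<Rightarrow> 'c::{real_normed_field, banach, second_countable_topology}"
  assumes [measurable]: "f \<in> borel_measurable M1" "g \<in> borel_measurable M2"
    and "\<And>x. norm (f x) \<le> A" "\<And>x. norm (g x) \<le> B"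
  shows "(\<integral>z. f (fst z) * g (snd z) \<partial>(M1 \<Otimes>\<^sub>M M2)) = (\<integral>x. f x \<partial>M1) * (\<integral>x. g x \<partial>M2)"
proof -
  have A: "0 \<le> A" using assms(3) norm_ge_zero order_trans by blast
  have "integrable (M1 \<Otimes>\<^sub>M M2) (\<lambda>z. f (fst z) * g (snd z))"
    using assms(3,4) A
    by (intro P.integrable_const_bound[where B="A * B"]) (auto simp: norm_mult intro!: mult_mono)
  from integral_fst'[OF this] show ?thesis by simp
qed

text \<open>
  Convexity of the \<open>n\<close>-th power.  The factor is weakened from \<open>z ^ (n - 1)\<close> to \<open>z ^ n\<close>, so that
  only the \<open>n\<close>-th powers of \<open>y\<close> and \<open>z\<close>, which are the observable quantities, occur.
\<close>

lemma power_diff_le_of_le: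
  fixes y z :: real
  assumes "0 \<le> z" "z \<le> 1" "0 \<le> y"
  shows "real n * (y - z) * z ^ n \<le> \<bar>y ^ n - z ^ n\<bar>"
proof (cases "y \<le> z")
  case True
  have "real n * (y - z) * z ^ n \<le> 0"
    using True assms by (intro mult_nonpos_nonneg mult_nonneg_nonpos) auto
  then show ?thesis by linarith
next
  case False
  show ?thesis
  proof (cases n)
    case (Suc k)
    have "real n * z ^ k = (\<Sum>i<n. z ^ k)" by simp
    also have "\<dots> \<le> (\<Sum>i<n. z ^ (n - Suc i) * y ^ i)"
    proof (intro sum_mono)
      fix i assume "i \<in> {..<n}"
      then have "k = (n - Suc i) + i" using Suc by auto
      then have "z ^ k = z ^ (n - Suc i) * z ^ i" by (metis power_add)
      also have "\<dots> \<le> z ^ (n - Suc i) * y ^ i"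
        using False assms by (intro mult_left_mono power_mono) auto
      finally show "z ^ k \<le> z ^ (n - Suc i) * y ^ i" .
    qed
    finally have "(y - z) * (real n * z ^ k) \<le> (y - z) * (\<Sum>i<n. z ^ (n - Suc i) * y ^ i)"
      using False by (intro mult_left_mono) auto
    also have "\<dots> = y ^ n - z ^ n" by (simp add: power_diff_sumr2[of y n z] mult.commute)
    finally have "(y - z) * (real n * z ^ k) \<le> y ^ n - z ^ n" .
    moreover have "real n * (y - z) * z ^ n \<le> (y - z) * (real n * z ^ k)"
    proof -
      have "z ^ n \<le> z ^ k" using assms Suc by (intro power_decreasing) auto
      then have "real n * (y - z) * z ^ n \<le> real n * (y - z) * z ^ k"
        using False by (intro mult_left_mono) auto
      then show ?thesis by (simp add: mult_ac)
    qed
    ultimately show ?thesis by linarith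
  qed simp
qed

lemma one_minus_cos_ge: "y\<^sup>2 / 4 \<le> 1 - cos y" if "\<bar>y\<bar> \<le> 1" for y :: real
proof -
  have "\<bar>y / 2\<bar> * (3 / 4) \<le> \<bar>sin (y / 2)\<bar>"
  proof -
    define z where "z = \<bar>y / 2\<bar>"
    have z: "0 \<le> z" "z \<le> 1 / 2" using that by (auto simp: z_def)
    have "z - z ^ 3 / 6 \<le> sin z" 
    proof -
      have "\<bar>sin z - (\<Sum>k<3. sin_coeff k * z ^ k)\<bar> \<le> inverse (fact 3) * \<bar>z\<bar> ^ 3"
        by (rule Maclaurin_sin_bound)
      then have "\<bar>sin z - z\<bar> \<le> z ^ 3 / 6" using z by (simp add: numeral_eq_Suc sin_coeff_def)
      then show ?thesis by linarith
    qed
    moreover have "z ^ 3 \<le> z * (1 / 4)"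
    proof -
      have "z\<^sup>2 \<le> (1 / 2)\<^sup>2" using z by (intro power_mono) auto
      then have "z * z\<^sup>2 \<le> z * (1 / 4)" using z by (intro mult_left_mono) (auto simp: power2_eq_square)
      then show ?thesis by (simp add: power3_eq_cube power2_eq_square mult.assoc)
    qed
    ultimately have "z * (3 / 4) \<le> sin z" using z by linarith
    moreover have "\<bar>sin (y / 2)\<bar> = \<bar>sin z\<bar>" unfolding z_def by (cases "y \<ge> 0") auto
    ultimately show ?thesis unfolding z_def by linarith
  qed
  then have "(\<bar>y / 2\<bar> * (3 / 4))\<^sup>2 \<le> \<bar>sin (y / 2)\<bar>\<^sup>2" by (intro power_mono) auto
  then have "y\<^sup>2 * (9 / 64) \<le> (sin (y / 2))\<^sup>2" by (simp add: power_mult_distrib power_divide)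
  moreover have "1 - cos y = 2 * (sin (y / 2))\<^sup>2"
    using cos_double_sin[of "y / 2"] by simp
  moreover have "y\<^sup>2 \<ge> 0" by simp
  ultimately show ?thesis by linarith
qed

context real_distribution
begin

lemma pair_prob: "pair_prob_space M M" ..

lemma prob_space_pair: "prob_space (M \<Otimes>\<^sub>M M)"
proof -
  interpret pair_prob_space M M by (rule pair_prob)
  show ?thesis by (rule P.prob_space_axioms)
qed

lemma real_distribution_symmetrized: "real_distribution (symmetrized M)"
  unfolding symmetrized_def
  by (rule prob_space.real_distribution_distr[OF prob_space_pair]) simp

lemma char_symmetrized: "char (symmetrized M) t = complex_of_real ((cmod (char M t))\<^sup>2)"
proof -
  interpret P: pair_prob_space M M by (rule pair_prob)
  have c: "(CLINT x|M. iexp (- (t * x))) = cnj (char M t)"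
  proof -
    have "cnj (char M t) = (CLINT x|M. cnj (iexp (t * x)))"
      unfolding char_def by (rule Bochner_Integration.integral_cnj[symmetric])
    also have "\<dots> = (CLINT x|M. iexp (- (t * x)))"
      by (simp add: exp_cnj)
    finally show ?thesis ..
  qed
  have "char (symmetrized M) t = (CLINT z|(M \<Otimes>\<^sub>M M). iexp (t * fst z) * iexp (- (t * snd z)))"
    unfolding char_def symmetrized_def
    by (subst integral_distr) (auto simp: algebra_simps exp_add[symmetric] intro!: Bochner_Integration.integral_cong)
  also have "\<dots> = char M t * (CLINT x|M. iexp (- (t * x)))"
    unfolding char_def by (rule P.integral_pair_mult[where A=1 and B=1]) (auto simp del: of_real_mult of_real_minus)
  also have "\<dots> = complex_of_real ((cmod (char M t))\<^sup>2)"
    unfolding c by (rule complex_norm_square[symmetric])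
  finally show ?thesis .
qed

lemma integral_cos_symmetrized: "(LINT x|symmetrized M. cos (t * x)) = (cmod (char M t))\<^sup>2"
proof -
  interpret R: real_distribution "symmetrized M" by (rule real_distribution_symmetrized)
  have "(LINT x|symmetrized M. cos (t * x)) = (LINT x|symmetrized M. Re (iexp (t * x)))"
    by (simp add: Re_exp)
  also have "\<dots> = Re (char (symmetrized M) t)"
    unfolding char_def by (intro integral_Re R.integrable_iexp) auto
  finally show ?thesis by (simp add: char_symmetrized)
qed

lemma integrable_cos_symmetrized:
  "integrable (symmetrized M) (\<lambda>x. cos (t * x))"
proof -
  interpret R: real_distribution "symmetrized M" by (rule real_distribution_symmetrized)
  show ?thesis by (intro R.integrable_const_bound[where B=1]) auto
qed

lemma char_deficit_eq:
  "char_deficit M b n t = real n * (LINT x|symmetrized M. 1 - cos (t * (x / b n)))"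
proof -
  interpret R: real_distribution "symmetrized M" by (rule real_distribution_symmetrized)
  have "(LINT x|symmetrized M. 1 - cos (t / b n * x)) = 1 - (cmod (char M (t / b n)))\<^sup>2"
    using integrable_cos_symmetrized[of "t / b n"]
    by (subst Bochner_Integration.integral_diff)
      (auto simp del: times_divide_eq_left simp: integral_cos_symmetrized R.prob_space[simplified])
  then show ?thesis by (simp add: char_deficit_def)
qed

lemma char_deficit_nonneg: "0 \<le> char_deficit M b n t"
  unfolding char_deficit_def
  using cmod_char_le_1[of "t / b n"] by (intro mult_nonneg_nonneg) (auto simp: power_le_one)

lemma nongaussian_defect_nonneg: "0 \<le> nongaussian_defect M b n t"
  unfolding nongaussian_defect_def by (intro mult_nonneg_nonneg integral_nonneg) auto

text \<open>
  The identity \<open>4 (1 - cos y) - (1 - cos 2y) = 2 (1 - cos y)\<^sup>2\<close>, integrated.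
\<close>

lemma nongaussian_defect_eq:
  "2 * nongaussian_defect M b n t = 4 * char_deficit M b n t - char_deficit M b n (2 * t)"
proof -
  interpret R: real_distribution "symmetrized M" by (rule real_distribution_symmetrized)
  have i: "integrable (symmetrized M) (\<lambda>x. 1 - cos (s * (x / b n)))" for s
    using integrable_cos_symmetrized[of "s / b n"] by auto
  have "2 * (1 - cos y)\<^sup>2 = 4 * (1 - cos y) - (1 - cos (2 * y))" for y :: real
    unfolding cos_double_cos by (simp add: power2_eq_square algebra_simps)
  from this[of "t * (_ / b n)"]
  have "2 * (LINT x|symmetrized M. (1 - cos (t * (x / b n)))\<^sup>2)
      = (LINT x|symmetrized M. 4 * (1 - cos (t * (x / b n))) - (1 - cos (2 * t * (x / b n))))"
    by (subst integral_mult_right_zero[symmetric]) (simp add: mult.assoc)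
  also have "\<dots> = 4 * (LINT x|symmetrized M. 1 - cos (t * (x / b n)))
      - (LINT x|symmetrized M. 1 - cos (2 * t * (x / b n)))"
    using i[of t] i[of "2 * t"]
    by (simp only: Bochner_Integration.integral_diff integrable_mult_right integral_mult_right_zero)
  finally have "real n * (2 * (LINT x|symmetrized M. (1 - cos (t * (x / b n)))\<^sup>2))
    = real n * (4 * (LINT x|symmetrized M. 1 - cos (t * (x / b n)))
      - (LINT x|symmetrized M. 1 - cos (2 * t * (x / b n))))" by (rule arg_cong)
  then show ?thesis
    unfolding nongaussian_defect_def char_deficit_eq by (simp only: right_diff_distrib mult_ac)
qed

text \<open>
  Since \<open>x ^ n \<le> exp (- n (1 - x))\<close> and \<open>X exp (- X) \<le> 1\<close>: a modulus bounded away from 0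
  forces a bounded exponent.
\<close>

lemma char_deficit_le_inverse:
  assumes "n \<ge> 1"
  shows "char_deficit M b n t * cmod (char M (t / b n)) ^ (2 * n) \<le> 1"
proof -
  define x where "x = (cmod (char M (t / b n)))\<^sup>2"
  define X where "X = char_deficit M b n t"
  have X: "X = real n * (1 - x)" by (simp add: X_def x_def char_deficit_def)
  have x: "0 \<le> x" "x \<le> 1" using cmod_char_le_1[of "t / b n"] by (auto simp: x_def power_le_one)
  have "x \<le> exp (- (1 - x))" using exp_ge_add_one_self[of "- (1 - x)"] by simp
  then have "x ^ n \<le> exp (- (1 - x)) ^ n" using x by (intro power_mono) auto
  also have "\<dots> = exp (- X)" by (simp add: X exp_of_nat_mult[symmetric] algebra_simps)
  finally have "X * x ^ n \<le> X * exp (- X)"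
    unfolding X_def by (intro mult_left_mono char_deficit_nonneg)
  also have "\<dots> \<le> exp X * exp (- X)"
    using exp_ge_add_one_self[of X] by (intro mult_right_mono) (linarith, simp)
  also have "\<dots> = 1" by (simp add: exp_add[symmetric])
  finally show ?thesis by (simp add: X_def x_def power_mult)
qed

text \<open>
  Near-equality of \<open>v\<close> and \<open>u ^ 4\<close>, which are \<open>n\<close>-th powers, is transferred to their \<open>n\<close>-th roots by
  convexity; this needs \<open>u\<close> bounded below.  The term of order \<open>1 / n\<close> is the second-order error in
  \<open>x ^ 4 \<approx> 1 - 4 (1 - x)\<close>.
\<close>

lemma nongaussian_defect_le:
  fixes b :: "nat \<Rightarrow> real" and t :: real
  assumes "n \<ge> 1" "\<delta> > 0"
  defines "u \<equiv> cmod (char M (t / b n)) ^ (2 * n)" and "v \<equiv> cmod (char M (2 * t / b n)) ^ (2 * n)"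
  assumes "\<delta> \<le> u"
  shows "2 * nongaussian_defect M b n t \<le> \<bar>v - u ^ 4\<bar> / \<delta> ^ 4 + 6 / (\<delta>\<^sup>2 * real n)"
proof -
  define x where "x = (cmod (char M (t / b n)))\<^sup>2"
  define y where "y = (cmod (char M (2 * t / b n)))\<^sup>2"
  define X where "X = char_deficit M b n t"
  have n0: "real n > 0" using assms by simp
  have X: "X = real n * (1 - x)" by (simp add: X_def x_def char_deficit_def)
  have x: "0 \<le> x" "x \<le> 1" and y: "0 \<le> y" "y \<le> 1"
    using cmod_char_le_1[of "t / b n"] cmod_char_le_1[of "2 * t / b n"]
    by (auto simp: x_def y_def power_le_one)
  have u: "u = x ^ n" and v: "v = y ^ n" by (simp_all add: u_def v_def x_def y_def power_mult)
  have X0: "0 \<le> X" by (simp add: X_def char_deficit_nonneg)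
  have "X * u \<le> 1" using char_deficit_le_inverse[OF assms(1), of b t] by (simp add: X_def u_def)
  moreover have "X * \<delta> \<le> X * u" using X0 assms by (intro mult_left_mono) auto
  ultimately have "X * \<delta> \<le> 1" by linarith
  then have "X \<le> 1 / \<delta>" using assms by (simp add: field_simps)
  then have X2: "X\<^sup>2 \<le> 1 / \<delta>\<^sup>2"
    using X0 power_mono[of X "1 / \<delta>" 2] by (simp add: power_divide)
  have "2 * nongaussian_defect M b n t = real n * (y - x ^ 4) + real n * (x ^ 4 - 1 + 4 * (1 - x))"
    unfolding nongaussian_defect_eq by (simp add: char_deficit_def x_def y_def algebra_simps)
  moreover have "real n * (y - x ^ 4) \<le> \<bar>v - u ^ 4\<bar> / \<delta> ^ 4"
  proof (cases "y \<le> x ^ 4")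
    case True
    then have "real n * (y - x ^ 4) \<le> 0" by (intro mult_nonneg_nonpos) auto
    then show ?thesis using assms by (meson abs_ge_zero divide_nonneg_pos order_trans zero_less_power)
  next
    case False
    have "real n * (y - x ^ 4) * \<delta> ^ 4 \<le> real n * (y - x ^ 4) * u ^ 4"
      using False assms by (intro mult_left_mono power_mono) auto
    also have "\<dots> = real n * (y - x ^ 4) * (x ^ 4) ^ n"
      by (simp add: u power_mult[symmetric] mult.commute)
    also have "\<dots> \<le> \<bar>y ^ n - (x ^ 4) ^ n\<bar>"
      using x y by (intro power_diff_le_of_le) (auto simp: power_le_one)
    also have "\<dots> = \<bar>v - u ^ 4\<bar>"
      by (simp add: u v power_mult[symmetric] mult.commute)
    finally show ?thesis using assms by (simp add: field_simps)
  qed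
  moreover have "real n * (x ^ 4 - 1 + 4 * (1 - x)) \<le> 6 / (\<delta>\<^sup>2 * real n)"
  proof -
    have "x ^ 4 - 1 + 4 * (1 - x) = (1 - x)\<^sup>2 * (x\<^sup>2 + 2 * x + 3)"
      by (simp add: power2_eq_square power4_eq_xxxx algebra_simps)
    also have "\<dots> \<le> (1 - x)\<^sup>2 * 6"
    proof (intro mult_left_mono)
      have "x\<^sup>2 \<le> 1" using x by (simp add: power_le_one)
      then show "x\<^sup>2 + 2 * x + 3 \<le> 6" using x by linarith
    qed auto
    finally have "real n * (x ^ 4 - 1 + 4 * (1 - x)) \<le> real n * ((1 - x)\<^sup>2 * 6)"
      using n0 by (intro mult_left_mono) auto
    also have "\<dots> = 6 * X\<^sup>2 / real n"
      using n0 by (simp add: X power2_eq_square field_simps)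
    also have "\<dots> \<le> 6 * (1 / \<delta>\<^sup>2) / real n"
      using X2 n0 by (intro divide_right_mono mult_left_mono) auto
    finally show ?thesis by simp
  qed
  ultimately show ?thesis by linarith
qed

text \<open>
  Symmetrisation removes the unknown centring: twice the variance is the mean square of the
  difference of two independent copies.  If neither copy is truncated, the square is controlled by
  \<open>1 - cos\<close> because the argument is at most 1; otherwise it is at most \<open>\<tau>\<^sup>2\<close>.
\<close>

lemma trunc_var_le_char_deficit:
  assumes "b n > 0" "\<tau> > 0" "t > 0" "2 * \<tau> * t \<le> 1"
  shows "trunc_var M b \<tau> n \<le> 2 * char_deficit M b n t / t\<^sup>2 + \<tau>\<^sup>2 * exceedance M b \<tau> n"
proof -
  interpret P: pair_prob_space M M by (rule pair_prob)
  interpret R: real_distribution "symmetrized M" by (rule real_distribution_symmetrized)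
  let ?Y = "trunc_scaled b \<tau> n"
  let ?A = "{x. \<tau> * b n \<le> \<bar>x\<bar>}"
  note Yb = abs_trunc_scaled_le[where b=b and n=n, OF assms(1,2)]
  have pm: "(LINT z|(M \<Otimes>\<^sub>M M). f (fst z) * g (snd z)) = expectation f * expectation g"
    if [measurable]: "f \<in> borel_measurable borel" "g \<in> borel_measurable borel"
      and "\<And>x. \<bar>f x\<bar> \<le> A" "\<And>x. \<bar>g x\<bar> \<le> B" for f g :: "real \<Rightarrow> real" and A B
    using that by (intro P.integral_pair_mult[of f g A B]) auto
  have int: "integrable (M \<Otimes>\<^sub>M M) f" if "f \<in> borel_measurable (borel \<Otimes>\<^sub>M borel)" "\<And>z. \<bar>f z\<bar> \<le> B" for f :: "real \<times> real \<Rightarrow> real" and B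
  proof -
    have "sets (M \<Otimes>\<^sub>M M) = sets (borel \<Otimes>\<^sub>M borel)" by (intro sets_pair_measure_cong) auto
    then show ?thesis using that
      by (intro P.P.integrable_const_bound[where B=B]) (auto cong: measurable_cong_sets)
  qed
  have Y2: "\<bar>(?Y x)\<^sup>2\<bar> \<le> \<tau>\<^sup>2" for x using power_mono[OF Yb[of x], of 2] by simp
  have i1: "integrable (M \<Otimes>\<^sub>M M) (\<lambda>z. (?Y (fst z))\<^sup>2)" and i2: "integrable (M \<Otimes>\<^sub>M M) (\<lambda>z. (?Y (snd z))\<^sup>2)"
    using Y2 by (auto intro!: int[of _ "\<tau>\<^sup>2"])
  have i3: "integrable (M \<Otimes>\<^sub>M M) (\<lambda>z. ?Y (fst z) * ?Y (snd z))"
    using Yb assms by (intro int[of _ "\<tau> * \<tau>"]) (auto simp: abs_mult intro!: mult_mono)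
  have e1: "(LINT z|(M \<Otimes>\<^sub>M M). (?Y (fst z))\<^sup>2) = expectation (\<lambda>x. (?Y x)\<^sup>2)"
    using pm[of "\<lambda>x. (?Y x)\<^sup>2" "\<lambda>_. 1" "\<tau>\<^sup>2" 1] Y2 by (simp add: prob_space[simplified])
  have e2: "(LINT z|(M \<Otimes>\<^sub>M M). (?Y (snd z))\<^sup>2) = expectation (\<lambda>x. (?Y x)\<^sup>2)"
    using pm[of "\<lambda>_. 1" "\<lambda>x. (?Y x)\<^sup>2" 1 "\<tau>\<^sup>2"] Y2 by (simp add: prob_space[simplified])
  have e3: "(LINT z|(M \<Otimes>\<^sub>M M). ?Y (fst z) * ?Y (snd z)) = (expectation ?Y)\<^sup>2"
    using pm[of ?Y ?Y \<tau> \<tau>] Yb by (simp add: power2_eq_square)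
  have "(LINT z|(M \<Otimes>\<^sub>M M). (?Y (fst z) - ?Y (snd z))\<^sup>2)
      = (LINT z|(M \<Otimes>\<^sub>M M). ((?Y (fst z))\<^sup>2 + (?Y (snd z))\<^sup>2) - 2 * (?Y (fst z) * ?Y (snd z)))"
    by (intro Bochner_Integration.integral_cong) (auto simp: power2_eq_square algebra_simps)
  also have "\<dots> = 2 * (expectation (\<lambda>x. (?Y x)\<^sup>2) - (expectation ?Y)\<^sup>2)"
    using i1 i2 i3 by (simp add: e1 e2 e3)
  also have "\<dots> = 2 * variance ?Y"
    using integrable_trunc_scaled[where b=b and n=n, OF assms(1,2), of 1]
      integrable_trunc_scaled[where b=b and n=n, OF assms(1,2), of 2]
    by (subst variance_eq) auto
  finally have var: "2 * variance ?Y = (LINT z|(M \<Otimes>\<^sub>M M). (?Y (fst z) - ?Y (snd z))\<^sup>2)" ..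
  have dd: "d\<^sup>2 \<le> 4 / t\<^sup>2 * (1 - cos (t * d))" if "\<bar>t * d\<bar> \<le> 1" for d
    using one_minus_cos_ge[OF that] assms by (simp add: power_mult_distrib field_simps)
  have pt: "(?Y x - ?Y y)\<^sup>2 \<le> 4 / t\<^sup>2 * (1 - cos (t * ((x - y) / b n))) + (\<tau>\<^sup>2 * indicator ?A x + \<tau>\<^sup>2 * indicator ?A y)"
    for x y
  proof -
    have c: "0 \<le> 4 / t\<^sup>2 * (1 - cos (t * ((x - y) / b n)))" by simp
    consider "x \<in> ?A" "y \<in> ?A" | "x \<in> ?A" "y \<notin> ?A" | "x \<notin> ?A" "y \<in> ?A" | "x \<notin> ?A" "y \<notin> ?A" by blast
    then show ?thesis
    proof cases
      case 1
      then have "?Y x = 0" "?Y y = 0" by (auto simp: trunc_scaled_def)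
      then show ?thesis using c by simp
    next
      case 2
      then have "?Y x = 0" by (auto simp: trunc_scaled_def)
      then show ?thesis using add_mono[OF c Y2[of y]] 2 by simp
    next
      case 3
      then have "?Y y = 0" by (auto simp: trunc_scaled_def)
      then show ?thesis using add_mono[OF c Y2[of x]] 3 by simp
    next
      case 4
      then have Yx: "?Y x = x / b n" "?Y y = y / b n" by (auto simp: trunc_scaled_def)
      have "\<bar>?Y x - ?Y y\<bar> \<le> 2 * \<tau>" using Yb[of x] Yb[of y] by linarith
      then have "t * \<bar>?Y x - ?Y y\<bar> \<le> t * (2 * \<tau>)" using assms by (intro mult_left_mono) auto
      also have "\<dots> \<le> 1" using assms by (simp add: mult_ac)
      finally have "\<bar>t * (?Y x - ?Y y)\<bar> \<le> 1" using assms by (simp add: abs_mult)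
      from dd[OF this] have "(?Y x - ?Y y)\<^sup>2 \<le> 4 / t\<^sup>2 * (1 - cos (t * (?Y x - ?Y y)))" .
      then show ?thesis using 4 Yx by (simp add: diff_divide_distrib)
    qed
  qed
  have cosint: "integrable (M \<Otimes>\<^sub>M M) (\<lambda>z. 4 / t\<^sup>2 * (1 - cos (t * ((fst z - snd z) / b n))))"
  proof (intro integrable_mult_right int[of _ 2])
    fix z :: "real \<times> real"
    show "\<bar>1 - cos (t * ((fst z - snd z) / b n))\<bar> \<le> 2"
      using abs_cos_le_one[of "t * ((fst z - snd z) / b n)"] by linarith
  qed simp
  have A1: "integrable (M \<Otimes>\<^sub>M M) (\<lambda>z. \<tau>\<^sup>2 * indicator ?A (fst z))" 
    and A2: "integrable (M \<Otimes>\<^sub>M M) (\<lambda>z. \<tau>\<^sup>2 * indicator ?A (snd z))"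
    by (intro int[of _ "\<tau>\<^sup>2"]; simp add: indicator_def)+
  have iA1: "(LINT z|(M \<Otimes>\<^sub>M M). \<tau>\<^sup>2 * indicator ?A (fst z)) = \<tau>\<^sup>2 * measure M ?A"
    using pm[of "indicator ?A" "\<lambda>_. 1" 1 1] by (simp add: prob_space[simplified] indicator_def)
  have iA2: "(LINT z|(M \<Otimes>\<^sub>M M). \<tau>\<^sup>2 * indicator ?A (snd z)) = \<tau>\<^sup>2 * measure M ?A"
    using pm[of "\<lambda>_. 1" "indicator ?A" 1 1] by (simp add: prob_space[simplified] indicator_def)
  have "2 * variance ?Y \<le> (LINT z|(M \<Otimes>\<^sub>M M). 4 / t\<^sup>2 * (1 - cos (t * ((fst z - snd z) / b n)))
      + (\<tau>\<^sup>2 * indicator ?A (fst z) + \<tau>\<^sup>2 * indicator ?A (snd z)))"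
    unfolding var
  proof (intro integral_mono)
    show "integrable (M \<Otimes>\<^sub>M M) (\<lambda>z. (?Y (fst z) - ?Y (snd z))\<^sup>2)"
    proof (intro int[of _ "(\<tau> + \<tau>)\<^sup>2"])
      fix z :: "real \<times> real"
      have "\<bar>?Y (fst z) - ?Y (snd z)\<bar> \<le> \<tau> + \<tau>" using Yb[of "fst z"] Yb[of "snd z"] by linarith
      from power_mono[OF this, of 2] show "\<bar>(?Y (fst z) - ?Y (snd z))\<^sup>2\<bar> \<le> (\<tau> + \<tau>)\<^sup>2" by simp
    qed simp
  qed (use pt cosint A1 A2 in auto)
  also have "\<dots> = (LINT z|(M \<Otimes>\<^sub>M M). 4 / t\<^sup>2 * (1 - cos (t * ((fst z - snd z) / b n)))) + 2 * (\<tau>\<^sup>2 * measure M ?A)"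
    by (simp only: Bochner_Integration.integral_add[OF cosint Bochner_Integration.integrable_add[OF A1 A2]]
      Bochner_Integration.integral_add[OF A1 A2] iA1 iA2 mult_2)
  also have "(LINT z|(M \<Otimes>\<^sub>M M). 4 / t\<^sup>2 * (1 - cos (t * ((fst z - snd z) / b n))))
      = 4 / t\<^sup>2 * (LINT x|symmetrized M. 1 - cos (t * (x / b n)))"
    unfolding symmetrized_def by (simp only: integral_mult_right_zero) (subst integral_distr; simp)
  finally have "real n * (2 * variance ?Y)
      \<le> real n * (4 / t\<^sup>2 * (LINT x|symmetrized M. 1 - cos (t * (x / b n))) + 2 * (\<tau>\<^sup>2 * measure M ?A))"
    by (intro mult_left_mono) auto
  moreover have "N * V \<le> 2 * (N * I) / t\<^sup>2 + \<tau>\<^sup>2 * (N * K)"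
    if "N * (2 * V) \<le> N * (4 / t\<^sup>2 * I + 2 * (\<tau>\<^sup>2 * K))" for N V I K :: real
  proof -
    have "2 * (N * V) \<le> 2 * (2 * (N * I) / t\<^sup>2 + \<tau>\<^sup>2 * (N * K))"
      using that by (simp add: algebra_simps)
    then show ?thesis by (simp only: mult_le_cancel_left_pos zero_less_numeral)
  qed
  ultimately show ?thesis
    unfolding trunc_var_eq[where b=b and n=n, OF assms(1,2)] char_deficit_eq exceedance_def by blast
qed

text \<open>
  The second copy lies within \<open>\<epsilon> b\<^sub>n / 2\<close> of the origin with probability at least one half,
  independently of the first copy.
\<close>

lemma exceedance_le_symmetrized:
  assumes "measure M {x. \<epsilon> / 2 * b n \<le> \<bar>x\<bar>} \<le> 1 / 2"
  shows "exceedance M b \<epsilon> n \<le> 2 * exceedance (symmetrized M) b (\<epsilon> / 2) n"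
proof -
  interpret P: pair_prob_space M M by (rule pair_prob)
  let ?A = "{x. \<epsilon> * b n \<le> \<bar>x\<bar>}" and ?B = "{x. \<epsilon> / 2 * b n \<le> \<bar>x\<bar>}"
  have pm: "measure (M \<Otimes>\<^sub>M M) (?A \<times> - ?B) = measure M ?A * measure M (- ?B)"
    by (simp add: measure_def emeasure_pair_measure_Times enn2real_mult)
  have "measure M (space M - ?B) = 1 - measure M ?B" by (intro prob_compl) auto
  then have "1 / 2 \<le> measure M (- ?B)" using assms by (simp add: Compl_eq_Diff_UNIV)
  then have "measure M ?A * (1 / 2) \<le> measure M ?A * measure M (- ?B)"
    by (intro mult_left_mono) auto
  also have "\<dots> = measure (M \<Otimes>\<^sub>M M) (?A \<times> - ?B)"
    using pm by simp
  also have "\<dots> \<le> measure (M \<Otimes>\<^sub>M M) {z \<in> space (M \<Otimes>\<^sub>M M). fst z - snd z \<in> ?B}"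
  proof (intro P.P.finite_measure_mono)
    show "?A \<times> - ?B \<subseteq> {z \<in> space (M \<Otimes>\<^sub>M M). fst z - snd z \<in> ?B}"
    proof
      fix z assume "z \<in> ?A \<times> - ?B"
      then have "\<epsilon> * b n \<le> \<bar>fst z\<bar>" "\<bar>snd z\<bar> < \<epsilon> / 2 * b n" by auto
      then have "\<epsilon> / 2 * b n \<le> \<bar>fst z - snd z\<bar>" by linarith
      then show "z \<in> {z \<in> space (M \<Otimes>\<^sub>M M). fst z - snd z \<in> ?B}"
        by (simp add: space_pair_measure)
    qed
    show "{z \<in> space (M \<Otimes>\<^sub>M M). fst z - snd z \<in> ?B} \<in> sets (M \<Otimes>\<^sub>M M)" by measurable
  qed
  also have "\<dots> = measure (symmetrized M) ?B"
    unfolding symmetrized_def by (subst measure_distr) (auto simp: vimage_def Int_def conj_commute)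
  finally have "real n * (measure M ?A * (1 / 2)) \<le> real n * measure (symmetrized M) ?B"
    by (intro mult_left_mono) auto
  then show ?thesis by (simp add: exceedance_def)
qed

end

section \<open>Averaging over frequencies\<close>

definition unit_uniform :: "real measure" where
  "unit_uniform = density lborel (\<lambda>t. ennreal (indicator {0..1} t))"

lemma sets_unit_uniform [simp, measurable_cong]: "sets unit_uniform = sets borel"
  by (simp add: unit_uniform_def)

lemma prob_space_unit_uniform: "prob_space unit_uniform"
proof
  have "(\<integral>\<^sup>+ t. ennreal (indicator {0..1::real} t) * indicator (space lborel) t \<partial>lborel)
      = (\<integral>\<^sup>+ t. indicator {0..1::real} t \<partial>lborel)"
    by (intro nn_integral_cong) (auto simp: indicator_def)
  then show "emeasure unit_uniform (space unit_uniform) = 1"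
    unfolding unit_uniform_def by (subst emeasure_density) auto
qed

lemma integral_unit_uniform:
  fixes f :: "real \<Rightarrow> real"
  assumes "f \<in> borel_measurable borel"
  shows "(LINT t|unit_uniform. f t) = (LINT t|lborel. f t * indicator {0..1} t)"
  unfolding unit_uniform_def using assms
  by (subst integral_density) (auto simp: mult.commute)

text \<open>
  A single frequency \<open>t\<close> cannot see values \<open>y\<close> near a multiple of \<open>2 \<pi> / t\<close>; the average over
  \<open>[0,1]\<close> sees all values away from 0.  For \<open>|y| \<le> 4\<close> the frequencies up to \<open>1/4\<close> suffice, as
  \<open>|t y| \<le> 1\<close> there and \<open>1 - cos\<close> is bounded below by a parabola; for larger \<open>y\<close> the integral is
  computed and stays near \<open>3/2\<close>.
\<close>

lemma integral_one_minus_cos_ge: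
  assumes "\<epsilon> > 0"
  obtains c where "c > 0" "\<And>y. \<epsilon> \<le> \<bar>y\<bar> \<Longrightarrow> c \<le> (LINT t|unit_uniform. (1 - cos (t * y))\<^sup>2)"
proof -
  have g: "min (\<epsilon> ^ 4 / 81920) (1/2) \<le> (LINT t|unit_uniform. (1 - cos (t * y))\<^sup>2)" if y: "\<epsilon> \<le> \<bar>y\<bar>" for y
  proof -
    have y0: "y \<noteq> 0" using y assms by auto
    have int: "integrable lborel (\<lambda>t. (1 - cos (t * y))\<^sup>2 * indicator {0..1} t)"
    proof -
      have "continuous_on {0..1} (\<lambda>t. (1 - cos (t * y))\<^sup>2)" by (intro continuous_intros)
      from borel_integrable_compact[OF compact_Icc this] show ?thesis by (simp add: mult.commute)
    qed
    show ?thesis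
    proof (cases "\<bar>y\<bar> \<le> 4")
      case True
      have "(LINT t|lborel. (t\<^sup>2 * y\<^sup>2 / 4)\<^sup>2 * indicator {0..1/4} t)
         = y ^ 4 / 80 * (1/4) ^ 5 - y ^ 4 / 80 * 0 ^ 5"
        by (rule integral_FTC_Icc_real[where F="\<lambda>t. y ^ 4 / 80 * t ^ 5"])
          (auto intro!: derivative_eq_intros continuous_intros simp: power2_eq_square power4_eq_xxxx)
      then have "y ^ 4 / 81920 = (LINT t|lborel. (t\<^sup>2 * y\<^sup>2 / 4)\<^sup>2 * indicator {0..1/4} t)" by (simp add: power_divide)
      also have "\<dots> \<le> (LINT t|lborel. (1 - cos (t * y))\<^sup>2 * indicator {0..1} t)"
      proof (intro integral_mono int)
        show "integrable lborel (\<lambda>t. (t\<^sup>2 * y\<^sup>2 / 4)\<^sup>2 * indicator {0..1/4} t)"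
        proof -
          have "continuous_on {0..1/4} (\<lambda>t. (t\<^sup>2 * y\<^sup>2 / 4)\<^sup>2)" by (intro continuous_intros) auto
          from borel_integrable_compact[OF compact_Icc this] show ?thesis by (simp add: mult.commute)
        qed
        fix t :: real
        show "(t\<^sup>2 * y\<^sup>2 / 4)\<^sup>2 * indicator {0..1/4} t \<le> (1 - cos (t * y))\<^sup>2 * indicator {0..1} t"
        proof (cases "t \<in> {0..1/4}")
          case t: True
          then have "t * \<bar>y\<bar> \<le> 1/4 * 4" using True by (intro mult_mono) auto
          then have "\<bar>t * y\<bar> \<le> 1" using t by (simp add: abs_mult)
          from one_minus_cos_ge[OF this] have "t\<^sup>2 * y\<^sup>2 / 4 \<le> 1 - cos (t * y)" by (simp add: power_mult_distrib)
          then have "(t\<^sup>2 * y\<^sup>2 / 4)\<^sup>2 \<le> (1 - cos (t * y))\<^sup>2" by (intro power_mono) auto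
          then show ?thesis using t by auto
        qed auto
      qed
      finally have "y ^ 4 / 81920 \<le> (LINT t|unit_uniform. (1 - cos (t * y))\<^sup>2)"
        by (simp add: integral_unit_uniform)
      moreover have "\<epsilon> ^ 4 \<le> \<bar>y\<bar> ^ 4" using y assms by (intro power_mono) auto
      ultimately show ?thesis by (auto simp: min_def)
    next
      case False
      let ?F = "\<lambda>t. 3/2 * t - 2 * sin (t * y) / y + sin (2 * (t * y)) / (4 * y)"
      have "(LINT t|lborel. (1 - cos (t * y))\<^sup>2 * indicator {0..1} t) = ?F 1 - ?F 0"
      proof (rule integral_FTC_Icc_real)
        fix t :: real
        have "(?F has_real_derivative (3/2 - 2 * cos (t * y) + cos (2 * (t * y)) / 2)) (at t)"
          using y0 by (auto intro!: derivative_eq_intros simp: field_simps)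
        moreover have "3/2 - 2 * cos (t * y) + cos (2 * (t * y)) / 2 = (1 - cos (t * y))\<^sup>2"
          unfolding cos_double_cos by (simp add: power2_eq_square field_simps)
        ultimately show "(?F has_real_derivative (1 - cos (t * y))\<^sup>2) (at t)" by simp
      qed (auto intro!: continuous_intros)
      also have "\<dots> = 3/2 - 2 * sin y / y + sin (2 * y) / (4 * y)" by simp
      also have "\<dots> \<ge> 3/2 - 2 / 4 - 1 / 16"
      proof -
        have "\<bar>2 * sin y / y\<bar> \<le> 2 / 4"
          using False abs_sin_le_one[of y] unfolding abs_divide abs_mult by (intro frac_le) auto
        moreover have "\<bar>sin (2 * y) / (4 * y)\<bar> \<le> 1 / 16"
          using False abs_sin_le_one[of "2 * y"] unfolding abs_divide by (intro frac_le) auto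
        ultimately show ?thesis by linarith
      qed
      finally show ?thesis by (simp add: integral_unit_uniform min_def)
    qed
  qed
  show ?thesis
    by (rule that[of "min (\<epsilon> ^ 4 / 81920) (1/2)"]) (use assms g in auto)
qed

text \<open>
  Markov's inequality under the average over frequencies.  Capping the integrand at 1 makes
  dominated convergence applicable to it later; the price is the cap \<open>1/4\<close> on the left, which comes from
  \<open>(1 - cos)\<^sup>2 \<le> 4\<close>.
\<close>

lemma (in real_distribution) exceedance_le_integral:
  fixes b :: "nat \<Rightarrow> real"
  assumes "b n > 0" "\<epsilon> > 0"
    and c: "\<And>y. \<epsilon> \<le> \<bar>y\<bar> \<Longrightarrow> c \<le> (LINT t|unit_uniform. (1 - cos (t * y))\<^sup>2)"
  shows "min (exceedance M b \<epsilon> n) (1/4) * c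
    \<le> (LINT t|unit_uniform. min (real n * (LINT x|M. (1 - cos (t * (x / b n)))\<^sup>2)) 1)"
proof -
  interpret U: prob_space unit_uniform by (rule prob_space_unit_uniform)
  interpret UM: pair_prob_space unit_uniform M ..
  let ?A = "{x. \<epsilon> * b n \<le> \<bar>x\<bar>}"
  define q where "q = exceedance M b \<epsilon> n"
  define f where "f t x = (1 - cos (t * (x / b n)))\<^sup>2" for t x :: real
  define h where "h t = (LINT x|M. indicator ?A x * f t x)" for t
  have fm: "(\<lambda>z. f (fst z) (snd z)) \<in> borel_measurable (borel \<Otimes>\<^sub>M borel)"
    unfolding f_def by measurable
  have [measurable]: "(\<lambda>z. f (fst z) (snd z)) \<in> borel_measurable (unit_uniform \<Otimes>\<^sub>M M)"
    using fm by (subst measurable_cong_sets[OF sets_pair_measure_cong refl]) auto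
  have f0: "0 \<le> f t x" for t x by (simp add: f_def)
  have f4: "f t x \<le> 4" for t x
  proof -
    have "\<bar>1 - cos (t * (x / b n))\<bar> \<le> 2" using abs_cos_le_one[of "t * (x / b n)"] by linarith
    from power_mono[OF this, of 2] show ?thesis by (simp add: f_def)
  qed
  have fmx [measurable]: "f t \<in> borel_measurable M" for t unfolding f_def by measurable
  have fi: "integrable M (f t)" for t
    using f0 f4 by (intro integrable_const_bound[where B=4]) auto
  have fiA: "integrable M (\<lambda>x. indicator ?A x * f t x)" for t
    using f0 f4 by (intro integrable_const_bound[where B=4]) (auto simp: indicator_def)
  have hq: "min q (1/4) * h t \<le> measure M ?A * min (real n * (LINT x|M. f t x)) 1" for t
  proof -
    have h1: "h t \<le> (LINT x|M. f t x)"
      unfolding h_def using fi fiA f0 by (intro integral_mono) (auto simp: indicator_def)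
    have h0: "0 \<le> h t" unfolding h_def using f0 by (intro Bochner_Integration.integral_nonneg) auto
    have "h t \<le> (LINT x|M. indicator ?A x * 4)"
      unfolding h_def using fiA f4 by (intro integral_mono) (auto simp: indicator_def intro!: integrable_const_bound[where B=4])
    then have h4: "h t \<le> 4 * measure M ?A" by simp
    have "min q (1/4) * h t \<le> q * h t" using h0 by (intro mult_right_mono) auto
    also have "\<dots> = measure M ?A * (real n * h t)" by (simp add: q_def exceedance_def)
    also have "\<dots> \<le> measure M ?A * (real n * (LINT x|M. f t x))"
      using h1 by (intro mult_left_mono) auto
    finally have 1: "min q (1/4) * h t \<le> measure M ?A * (real n * (LINT x|M. f t x))" .
    have "min q (1/4) * h t \<le> 1/4 * h t" using h0 by (intro mult_right_mono) auto
    also have "\<dots> \<le> measure M ?A * 1" using h4 by simp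
    finally show ?thesis using 1 by (simp add: min_def)
  qed
  have mh: "h \<in> borel_measurable unit_uniform"
    unfolding h_def by measurable
  have mF: "(\<lambda>t. LINT x|M. f t x) \<in> borel_measurable unit_uniform"
    by measurable
  have h04: "0 \<le> h t" "h t \<le> 4" for t
  proof -
    show "0 \<le> h t" unfolding h_def using f0 by (intro Bochner_Integration.integral_nonneg) auto
    have "h t \<le> (LINT x|M. 4)"
      unfolding h_def using fiA f4 by (intro integral_mono) (auto simp: indicator_def)
    then show "h t \<le> 4" by (simp add: prob_space[simplified])
  qed
  have F0: "0 \<le> (LINT x|M. f t x)" for t using f0 by (intro Bochner_Integration.integral_nonneg) auto
  have "measure M ?A * c = (LINT x|M. indicator ?A x * c)" by simp
  also have "\<dots> \<le> (LINT x|M. (LINT t|unit_uniform. indicator ?A x * f t x))"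
  proof (intro integral_mono)
    have "integrable (unit_uniform \<Otimes>\<^sub>M M) (\<lambda>(t, x). indicator ?A x * f t x)"
      using f0 f4 by (intro UM.P.integrable_const_bound[where B=4]) (auto simp: indicator_def split_beta')
    from UM.integrable_snd[OF this]
    show "integrable M (\<lambda>x. LINT t|unit_uniform. indicator ?A x * f t x)" .
    show "integrable M (\<lambda>x. indicator ?A x * c)"
      by (intro integrable_const_bound[where B="\<bar>c\<bar>"]) (auto simp: indicator_def)
    fix x
    show "indicator ?A x * c \<le> (LINT t|unit_uniform. indicator ?A x * f t x)"
    proof (cases "x \<in> ?A")
      case True
      then have "\<epsilon> \<le> \<bar>x / b n\<bar>" using assms by (simp add: field_simps)
      from c[OF this] show ?thesis using True by (simp add: f_def)
    qed simp
  qed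
  also have "\<dots> = (LINT t|unit_uniform. h t)"
    unfolding h_def
    using f0 f4
    by (intro UM.Fubini_integral UM.P.integrable_const_bound[where B=4])
      (auto simp: indicator_def split_beta')
  finally have "min q (1/4) * (measure M ?A * c) \<le> min q (1/4) * (LINT t|unit_uniform. h t)"
    by (intro mult_left_mono) (auto simp: q_def exceedance_nonneg)
  also have "\<dots> = (LINT t|unit_uniform. min q (1/4) * h t)" by simp
  also have "\<dots> \<le> (LINT t|unit_uniform. measure M ?A * min (real n * (LINT x|M. f t x)) 1)"
  proof (intro integral_mono)
    show "integrable unit_uniform (\<lambda>t. min q (1/4) * h t)"
      using mh h04 by (intro integrable_mult_right U.integrable_const_bound[where B=4]) auto
    show "integrable unit_uniform (\<lambda>t. measure M ?A * min (real n * (LINT x|M. f t x)) 1)"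
      using mF F0 by (intro integrable_mult_right U.integrable_const_bound[where B=1]) auto
  qed (use hq in auto)
  also have "\<dots> = measure M ?A * (LINT t|unit_uniform. min (real n * (LINT x|M. f t x)) 1)" by simp
  finally have *: "measure M ?A * (min q (1/4) * c)
      \<le> measure M ?A * (LINT t|unit_uniform. min (real n * (LINT x|M. f t x)) 1)"
    by (simp add: mult_ac)
  show ?thesis
  proof (cases "measure M ?A = 0")
    case True
    then have "q = 0" by (simp add: q_def exceedance_def)
    moreover have "0 \<le> (LINT t|unit_uniform. min (real n * (LINT x|M. f t x)) 1)"
      using F0 by (intro Bochner_Integration.integral_nonneg) auto
    ultimately show ?thesis by (simp add: q_def f_def)
  next
    case False
    then have "0 < measure M ?A" using measure_nonneg[of M ?A] by linarith
    then show ?thesis using * by (simp add: q_def f_def)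
  qed
qed

section \<open>Weak convergence on sequence space\<close>

text \<open>
  Restricted to the torus, these are its continuous characters.
\<close>

inductive torus_monomial :: "((nat \<Rightarrow> complex) \<Rightarrow> complex) \<Rightarrow> bool" where
  one: "torus_monomial (\<lambda>z. 1)"
| coord: "torus_monomial \<phi> \<Longrightarrow> torus_monomial (\<lambda>z. \<phi> z * z k)"
| cnj_coord: "torus_monomial \<phi> \<Longrightarrow> torus_monomial (\<lambda>z. \<phi> z * cnj (z k))"

lemma torus_monomial_mult:
  assumes "torus_monomial \<phi>" "torus_monomial \<phi>'"
  shows "torus_monomial (\<lambda>z. \<phi> z * \<phi>' z)"
  using assms(2)
proof induction
  case (coord \<phi>' k)
  then show ?case using torus_monomial.coord[of "\<lambda>z. \<phi> z * \<phi>' z" k] by (simp add: mult.assoc)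
next
  case (cnj_coord \<phi>' k)
  then show ?case using torus_monomial.cnj_coord[of "\<lambda>z. \<phi> z * \<phi>' z" k] by (simp add: mult.assoc)
qed (simp add: assms)

lemma torus_monomial_cnj:
  assumes "torus_monomial \<phi>"
  shows "torus_monomial (\<lambda>z. cnj (\<phi> z))"
  using assms by induction (auto intro: torus_monomial.intros)

lemma continuous_torus_monomial:
  assumes "torus_monomial \<phi>"
  shows "continuous_on S \<phi>"
proof -
  have c: "continuous_on S (\<lambda>z :: nat \<Rightarrow> complex. z k)" for k
    by (rule continuous_on_subset[OF continuous_on_product_coordinates]) simp
  show ?thesis
    using assms by induction (auto intro!: continuous_intros c)
qed

inductive trig_poly :: "((nat \<Rightarrow> complex) \<Rightarrow> real) \<Rightarrow> bool" where
  mono: "torus_monomial \<phi> \<Longrightarrow> trig_poly (\<lambda>z. Re (c * \<phi> z))"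
| add: "trig_poly f \<Longrightarrow> trig_poly g \<Longrightarrow> trig_poly (\<lambda>z. f z + g z)"

text \<open>
  \<open>Re u \<cdot> Re v = Re (u v) / 2 + Re (u \<cdot> cnj v) / 2\<close>, so real parts of characters are closed under
  products up to sums.
\<close>

lemma trig_poly_mult_mono:
  assumes "trig_poly f" "torus_monomial \<phi>"
  shows "trig_poly (\<lambda>z. Re (c * \<phi> z) * f z)"
  using assms(1)
proof induction
  case (mono \<phi>' d)
  have *: "Re u * Re v = Re (u * v / 2) + Re (u * cnj v / 2)" for u v
    by (simp add: field_simps)
  have "trig_poly (\<lambda>z. Re ((c * d / 2) * (\<phi> z * \<phi>' z)) + Re ((c * cnj d / 2) * (\<phi> z * cnj (\<phi>' z))))"
    by (intro trig_poly.intros torus_monomial_mult torus_monomial_cnj mono assms)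
  then show ?case unfolding * by (simp add: mult_ac)
next
  case (add f g)
  then show ?case
    using trig_poly.add[of "\<lambda>z. Re (c * \<phi> z) * f z" "\<lambda>z. Re (c * \<phi> z) * g z"]
    by (simp add: distrib_left)
qed

lemma trig_poly_mult:
  assumes "trig_poly f" "trig_poly g"
  shows "trig_poly (\<lambda>z. f z * g z)"
  using assms(1)
proof induction
  case (mono \<phi> c)
  then show ?case using trig_poly_mult_mono[OF assms(2)] by simp
next
  case (add f1 f2)
  then show ?case using trig_poly.add by (simp add: distrib_right)
qed

lemma continuous_trig_poly:
  assumes "trig_poly f"
  shows "continuous_on S f"
  using assms by induction (auto intro!: continuous_intros continuous_torus_monomial)

definition torus :: "(nat \<Rightarrow> complex) set" where
  "torus = PiE UNIV (\<lambda>_. sphere 0 1)"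

lemma compact_PiE_UNIV:
  fixes B :: "'i \<Rightarrow> 'b::topological_space set"
  assumes "\<And>i. compact (B i)"
  shows "compact (PiE UNIV B)"
proof -
  have "compactin (product_topology (\<lambda>i. euclidean :: 'b topology) (UNIV :: 'i set)) (PiE UNIV B)"
    using assms by (subst compactin_PiE) (auto simp: compactin_euclidean_iff)
  then show ?thesis
    unfolding euclidean_product_topology compactin_euclidean_iff .
qed

lemma function_ring_torus: "function_ring_on (Collect trig_poly) torus"
proof
  show "compact torus" unfolding torus_def by (intro compact_PiE_UNIV) auto
  show "(\<lambda>_. c) \<in> Collect trig_poly" for c
    using trig_poly.mono[OF torus_monomial.one, of "complex_of_real c"] by simp
  fix x y :: "nat \<Rightarrow> complex"
  assume "x \<noteq> y"
  then obtain k where k: "x k \<noteq> y k" by auto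
  have m: "torus_monomial (\<lambda>z. z k)" using torus_monomial.coord[OF torus_monomial.one, of k] by simp
  have "trig_poly (\<lambda>z. Re (1 * z k))" "trig_poly (\<lambda>z. Re (- \<i> * z k))"
    by (intro trig_poly.mono m)+
  moreover have "Re (1 * x k) \<noteq> Re (1 * y k) \<or> Re (- \<i> * x k) \<noteq> Re (- \<i> * y k)"
    using k by (auto simp: complex_eq_iff)
  ultimately show "\<exists>f\<in>Collect trig_poly. f x \<noteq> f y"
    by (elim disjE) (rule bexI, assumption, simp)+
qed (simp_all add: continuous_trig_poly trig_poly.add trig_poly_mult)

text \<open>
  For positive \<open>R\<^sub>k\<close>, injective on the product of the intervals \<open>[- R\<^sub>k, R\<^sub>k]\<close>: the angles there are at
  most 1 in absolute value.
\<close>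

definition wrap :: "(nat \<Rightarrow> real) \<Rightarrow> (nat \<Rightarrow> real) \<Rightarrow> nat \<Rightarrow> complex" where
  "wrap R s k = cis (s k / R k)"

lemma wrap_in_torus: "wrap R s \<in> torus"
  by (auto simp: wrap_def torus_def)

lemma continuous_wrap: "continuous_on S (wrap R)"
  unfolding wrap_def[abs_def] divide_inverse
  by (intro continuous_on_coordinatewise_then_product continuous_intros)
    (auto intro: continuous_on_subset[OF continuous_on_product_coordinates])

text \<open>
  Along \<open>wrap\<close>, characters of the torus become the exponentials that occur in characteristic
  functions.
\<close>

lemma torus_monomial_wrap:
  assumes "torus_monomial \<phi>"
  shows "\<exists>m\<ge>1. \<exists>t. \<forall>s. \<phi> (wrap R s) = exp (\<i> * complex_of_real (\<Sum>k<m. t k * s k))"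
proof -
  \<comment> \<open>multiplying by one more exponential changes one frequency; \<open>m\<close> grows if the new coordinate is beyond it\<close>
  have step: "\<exists>m\<ge>1. \<exists>t. \<forall>s. \<phi> (wrap R s) * exp (\<i> * complex_of_real (c * s k)) = exp (\<i> * complex_of_real (\<Sum>k<m. t k * s k))"
    if IH: "\<exists>m\<ge>1. \<exists>t. \<forall>s. \<phi> (wrap R s) = exp (\<i> * complex_of_real (\<Sum>k<m. t k * s k))" for \<phi> c k
  proof -
    from IH obtain m t where mt: "\<And>s. \<phi> (wrap R s) = exp (\<i> * complex_of_real (\<Sum>k<m. t k * s k))" by auto
    define M where "M = max m (Suc k)"
    define t' where "t' j = (if j < m then t j else 0) + (if j = k then c else 0)" for j
    have "(\<Sum>j<M. t' j * s j) = (\<Sum>j<m. t j * s j) + c * s k" for s :: "nat \<Rightarrow> real"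
    proof -
      have "(\<Sum>j<M. t' j * s j) = (\<Sum>j<M. if j < m then t j * s j else 0) + (\<Sum>j<M. if j = k then c * s j else 0)"
        unfolding sum.distrib[symmetric] by (intro sum.cong) (auto simp: t'_def distrib_right)
      also have "(\<Sum>j<M. if j < m then t j * s j else 0) = (\<Sum>j\<in>{j \<in> {..<M}. j < m}. t j * s j)"
        by (rule sum.inter_filter[symmetric]) simp
      also have "{j \<in> {..<M}. j < m} = {..<m}" by (auto simp: M_def)
      also have "(\<Sum>j<M. if j = k then c * s j else 0) = c * s k"
        by (simp add: M_def sum.delta)
      finally show ?thesis .
    qed
    then have "\<forall>s. \<phi> (wrap R s) * exp (\<i> * complex_of_real (c * s k)) = exp (\<i> * complex_of_real (\<Sum>k<M. t' k * s k))"
      by (simp add: mt exp_add[symmetric] distrib_left)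
    moreover have "M \<ge> 1" by (simp add: M_def)
    ultimately show ?thesis by blast
  qed
  show ?thesis
    using assms
  proof induction
    case one
    then show ?case by (intro exI[of _ 1] conjI exI[of _ "\<lambda>_. 0"]) auto
  next
    case (coord \<phi> k)
    have "wrap R s k = exp (\<i> * complex_of_real (1 / R k * s k))" for s
      by (simp add: wrap_def cis_conv_exp)
    then show ?case using step[OF coord.IH, of "1 / R k" k] by simp
  next
    case (cnj_coord \<phi> k)
    have "cnj (wrap R s k) = exp (\<i> * complex_of_real (- 1 / R k * s k))" for s
      by (simp add: wrap_def cis_conv_exp exp_cnj)
    then show ?case using step[OF cnj_coord.IH, of "- 1 / R k" k] by simp
  qed
qed

lemma measurable_coord_borel [measurable]:
  "(\<lambda>s :: nat \<Rightarrow> real. s k) \<in> borel_measurable borel"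
  by (intro borel_measurable_continuous_onI continuous_on_product_coordinates)

lemma (in real_distribution) exists_tail_bound:
  assumes "\<delta> > 0"
  shows "\<exists>R>0. measure M {x. R < \<bar>x\<bar>} < \<delta>"
proof -
  have "(\<lambda>k. measure M {x. real k < \<bar>x\<bar>}) \<longlonglongrightarrow> measure M (\<Inter>k. {x. real k < \<bar>x\<bar>})"
    by (intro finite_Lim_measure_decseq) (auto simp: decseq_def)
  moreover have "(\<Inter>k. {x. real k < \<bar>x\<bar>}) = {}"
  proof -
    have "\<exists>k. \<bar>x\<bar> \<le> real k" for x :: real by (rule real_arch_simple)
    then show ?thesis by (simp add: set_eq_iff not_less)
  qed
  ultimately have "(\<lambda>k. measure M {x. real k < \<bar>x\<bar>}) \<longlonglongrightarrow> 0" by simp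
  from order_tendstoD(2)[OF this assms] obtain k where k: "measure M {x. real k < \<bar>x\<bar>} < \<delta>"
    by (auto simp: eventually_sequentially)
  have "measure M {x. real k + 1 < \<bar>x\<bar>} \<le> measure M {x. real k < \<bar>x\<bar>}"
    by (intro finite_measure_mono) auto
  then show ?thesis using k by (intro exI[of _ "real k + 1"]) auto
qed

text \<open>
  A weakly convergent sequence is tight.  The bound covers every \<open>n\<close> and not only large ones,
  because the coordinates of sequence space have to be controlled simultaneously for the same \<open>n\<close>.
\<close>

lemma convergent_laws_tail_bound:
  fixes \<mu> :: "nat \<Rightarrow> real measure"
  assumes rd: "\<And>n. real_distribution (\<mu> n)" "real_distribution \<mu>'"
    and wc: "weak_conv_m \<mu> \<mu>'" and "\<delta> > 0"
  obtains R where "R > 0" "\<And>n. measure (\<mu> n) {x. R < \<bar>x\<bar>} < \<delta>" "measure \<mu>' {x. R < \<bar>x\<bar>} < \<delta>"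
proof -
  interpret L: real_distribution \<mu>' by fact
  obtain a where a: "a > 0" "measure \<mu>' {x. a < \<bar>x\<bar>} < \<delta>"
    using L.exists_tail_bound[OF \<open>\<delta> > 0\<close>] by auto
  define g :: "real \<Rightarrow> real" where "g x = min 1 (max 0 (\<bar>x\<bar> - a))" for x
  have gi: "integrable \<kappa> g" if "real_distribution \<kappa>" for \<kappa>
  proof -
    interpret real_distribution \<kappa> by fact
    show ?thesis unfolding g_def[abs_def] by (intro integrable_const_bound[where B=1]) auto
  qed
  have gI: "integrable \<kappa> (indicator {x. c < \<bar>x\<bar>} :: real \<Rightarrow> real)" if "real_distribution \<kappa>" for \<kappa> c
  proof -
    interpret real_distribution \<kappa> by fact
    show ?thesis by (simp add: integrable_indicator_iff less_top[symmetric])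
  qed
  have "(\<integral>x. g x \<partial>\<mu>') \<le> (\<integral>x. indicator {x. a < \<bar>x\<bar>} x \<partial>\<mu>')"
    by (intro integral_mono gi gI rd) (auto simp: g_def indicator_def)
  then have "(\<integral>x. g x \<partial>\<mu>') < \<delta>" using a by simp
  moreover have "(\<lambda>n. \<integral>x. g x \<partial>\<mu> n) \<longlonglongrightarrow> (\<integral>x. g x \<partial>\<mu>')"
    using rd wc
    by (rule weak_conv_imp_integral_bdd_continuous_conv[where B=1])
      (auto simp: g_def[abs_def] intro!: continuous_intros)
  ultimately have "\<forall>\<^sub>F n in sequentially. (\<integral>x. g x \<partial>\<mu> n) < \<delta>"
    by (rule order_tendstoD(2)[rotated])
  then obtain N where N: "\<And>n. n \<ge> N \<Longrightarrow> (\<integral>x. g x \<partial>\<mu> n) < \<delta>"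
    unfolding eventually_sequentially by blast
  have "\<forall>n. \<exists>R>0. measure (\<mu> n) {x. R < \<bar>x\<bar>} < \<delta>"
    by (intro allI real_distribution.exists_tail_bound[OF rd(1) \<open>\<delta> > 0\<close>])
  then obtain r where r: "\<And>n. r n > 0" "\<And>n. measure (\<mu> n) {x. r n < \<bar>x\<bar>} < \<delta>" by metis
  define R where "R = Max (insert (a + 1) (r ` {..<N}))"
  have Ra: "a + 1 \<le> R" unfolding R_def by (intro Max_ge) auto
  have Rr: "r n \<le> R" if "n < N" for n unfolding R_def using that by (intro Max_ge) auto
  have mono: "measure \<kappa> {x. R < \<bar>x\<bar>} \<le> measure \<kappa> {x. c < \<bar>x\<bar>}" if "real_distribution \<kappa>" "c \<le> R" for \<kappa> c
  proof -
    interpret real_distribution \<kappa> by fact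
    show ?thesis using that(2) by (intro finite_measure_mono) auto
  qed
  show ?thesis
  proof (rule that)
    show "R > 0" using Ra a by linarith
    show "measure \<mu>' {x. R < \<bar>x\<bar>} < \<delta>" using mono[OF rd(2), of a] Ra a by linarith
    fix n
    show "measure (\<mu> n) {x. R < \<bar>x\<bar>} < \<delta>"
    proof (cases "n < N")
      case True
      then show ?thesis using mono[OF rd(1)[of n] Rr] r(2)[of n] by (meson le_less_trans)
    next
      case False
      interpret n: real_distribution "\<mu> n" by (rule rd)
      have "measure (\<mu> n) {x. a + 1 < \<bar>x\<bar>} = (\<integral>x. indicator {x. a + 1 < \<bar>x\<bar>} x \<partial>\<mu> n)" by simp
      also have "\<dots> \<le> (\<integral>x. g x \<partial>\<mu> n)"
        by (intro integral_mono gi gI rd) (auto simp: g_def indicator_def)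
      finally show ?thesis using N[of n] False mono[OF rd(1)[of n] Ra] by linarith
    qed
  qed
qed

text \<open>
  The continuity theorem for laws on sequence space.  The coordinates are tight, so all laws
  give mass at least \<open>1 - e\<close> to one compact product \<open>K\<close> of intervals.  The map \<open>wrap\<close> embeds \<open>K\<close> into
  the torus; by Tietze's theorem a bounded continuous function on \<open>K\<close> extends to the torus with the same bound,
  and by the Stone-Weierstrass theorem the extension is uniformly close to a trigonometric
  polynomial.  Pulled back along \<open>wrap\<close>, that polynomial is bounded everywhere, also off \<open>K\<close>, and its
  integrals converge by assumption.
\<close>

theorem weak_convergence_of_characteristic_functions:
  fixes \<mu> :: "nat \<Rightarrow> (nat \<Rightarrow> real) measure"
  assumes \<mu>: "\<And>n. prob_space (\<mu> n)" "\<And>n. sets (\<mu> n) = sets borel"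
    and \<nu>: "prob_space \<nu>" "sets \<nu> = sets borel"
    and conv: "\<And>m t. m \<ge> 1 \<Longrightarrow> (\<lambda>n. \<integral>s. exp (\<i> * complex_of_real (\<Sum>k<m. t k * s k)) \<partial>\<mu> n)
      \<longlonglongrightarrow> (\<integral>s. exp (\<i> * complex_of_real (\<Sum>k<m. t k * s k)) \<partial>\<nu>)"
  shows "weakly_converges \<mu> \<nu>"
  unfolding weakly_converges_def
proof (intro allI impI)
  fix f :: "(nat \<Rightarrow> real) \<Rightarrow> real"
  assume f: "continuous_on UNIV f" "bounded (range f)"
  note [measurable_cong] = \<mu>(2) \<nu>(2)
  have [measurable]: "f \<in> borel_measurable borel" using f(1) by (rule borel_measurable_continuous_onI)
  from f(2) obtain B0 where B0: "\<And>s. \<bar>f s\<bar> \<le> B0" unfolding bounded_iff by auto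
  define B where "B = max B0 1"
  have B: "\<bar>f s\<bar> \<le> B" "B > 0" for s using B0[of s] by (auto simp: B_def)
  have trig: "(\<lambda>n. \<integral>s. g (wrap R s) \<partial>\<mu> n) \<longlonglongrightarrow> (\<integral>s. g (wrap R s) \<partial>\<nu>)"
    if "trig_poly g" for g R
  proof -
    have [measurable]: "(\<lambda>s. g (wrap R s)) \<in> borel_measurable borel" if "trig_poly g" for g
      by (intro borel_measurable_continuous_onI)
        (rule continuous_on_compose2[OF continuous_trig_poly[OF that, of UNIV] continuous_wrap], simp)
    have "(\<forall>n. integrable (\<mu> n) (\<lambda>s. g (wrap R s))) \<and> integrable \<nu> (\<lambda>s. g (wrap R s)) \<and>
      (\<lambda>n. \<integral>s. g (wrap R s) \<partial>\<mu> n) \<longlonglongrightarrow> (\<integral>s. g (wrap R s) \<partial>\<nu>)"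
      using that
    proof induction
      case (mono \<phi> c)
      from torus_monomial_wrap[OF mono, of R] obtain m t where m: "m \<ge> 1"
        and mt: "\<And>s. \<phi> (wrap R s) = exp (\<i> * complex_of_real (\<Sum>k<m. t k * s k))" by auto
      have meas: "(\<lambda>s. c * \<phi> (wrap R s)) \<in> borel_measurable borel" unfolding mt by measurable
      have bd: "cmod (c * \<phi> (wrap R s)) \<le> cmod c" for s unfolding mt by (simp add: norm_mult)
      have i: "integrable (\<mu> n) (\<lambda>s. c * \<phi> (wrap R s))" for n
        using bd meas by (intro finite_measure.integrable_const_bound[OF prob_space.finite_measure[OF \<mu>(1)], where B="cmod c"]) auto
      have i': "integrable \<nu> (\<lambda>s. c * \<phi> (wrap R s))"
        using bd meas by (intro finite_measure.integrable_const_bound[OF prob_space.finite_measure[OF \<nu>(1)], where B="cmod c"]) auto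
      have "(\<lambda>n. \<integral>s. c * \<phi> (wrap R s) \<partial>\<mu> n) \<longlonglongrightarrow> (\<integral>s. c * \<phi> (wrap R s) \<partial>\<nu>)"
        unfolding mt integral_mult_right_zero by (intro tendsto_mult tendsto_const conv[OF m])
      from tendsto_Re[OF this] show ?case
        using i i' by (simp add: integral_Re integrable_Re del: times_complex.sel)
    next
      case (add f g)
      then show ?case by (auto intro!: tendsto_add)
    qed
    then show ?thesis by blast
  qed
  have marg: "\<exists>R>0. (\<forall>n. measure (\<mu> n) {s. R < \<bar>s k\<bar>} < \<delta>) \<and> measure \<nu> {s. R < \<bar>s k\<bar>} < \<delta>"
    if "\<delta> > 0" for k and \<delta> :: real
  proof -
    define d where "d \<kappa> = distr \<kappa> borel (\<lambda>s :: nat \<Rightarrow> real. s k)" for \<kappa>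
    have rd: "real_distribution (d (\<mu> n))" "real_distribution (d \<nu>)" for n
      unfolding d_def using \<mu>(1) \<nu>(1) by (auto intro!: prob_space.real_distribution_distr)
    have ch: "char (d \<kappa>) t = (\<integral>s. exp (\<i> * complex_of_real (\<Sum>j<Suc k. (if j = k then t else 0) * s j)) \<partial>\<kappa>)"
      if "sets \<kappa> = sets borel" for \<kappa> t
    proof -
      note [measurable_cong] = that
      have "(\<Sum>j<Suc k. (if j = k then t else 0) * s j) = t * s k" for s :: "nat \<Rightarrow> real"
        by (simp add: if_distrib[of "\<lambda>x. x * _"] sum.delta cong: if_cong)
      then show ?thesis unfolding char_def d_def by (subst integral_distr) auto
    qed
    have "weak_conv_m (\<lambda>n. d (\<mu> n)) (d \<nu>)"
      using rd
    proof (rule levy_continuity)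
      show "(\<lambda>n. char (d (\<mu> n)) t) \<longlonglongrightarrow> char (d \<nu>) t" for t
        unfolding ch[OF \<mu>(2)] ch[OF \<nu>(2)] by (rule conv) simp
    qed
    from convergent_laws_tail_bound[OF rd this \<open>\<delta> > 0\<close>] obtain R where
      R: "R > 0" "\<And>n. measure (d (\<mu> n)) {x. R < \<bar>x\<bar>} < \<delta>" "measure (d \<nu>) {x. R < \<bar>x\<bar>} < \<delta>" by blast
    have "measure (d \<kappa>) {x. R < \<bar>x\<bar>} = measure \<kappa> {s. R < \<bar>s k\<bar>}" if "sets \<kappa> = sets borel" for \<kappa>
    proof -
      note [measurable_cong] = that
      have "space \<kappa> = UNIV" using sets_eq_imp_space_eq[OF that] by simp
      then show ?thesis unfolding d_def by (subst measure_distr) (auto simp: vimage_def)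
    qed
    then show ?thesis using R \<mu>(2) \<nu>(2) by auto
  qed
  show "(\<lambda>n. \<integral>s. f s \<partial>\<mu> n) \<longlonglongrightarrow> (\<integral>s. f s \<partial>\<nu>)"
  proof (rule LIMSEQ_I)
    fix \<epsilon> :: real assume "\<epsilon> > 0"
    \<comment> \<open>two approximation errors \<open>e (2 B + 1)\<close> and the error \<open>e\<close> of the polynomial add up to less than \<open>\<epsilon>\<close>\<close>
    define e where "e = \<epsilon> / (12 * B + 6)"
    have e: "e > 0" using \<open>\<epsilon> > 0\<close> B by (simp add: e_def)
    \<comment> \<open>coordinate \<open>k\<close> may lose mass \<open>e / 2 ^ (k + 1)\<close>, which sums to \<open>e\<close>\<close>
    have "\<forall>k. \<exists>R>0. (\<forall>n. measure (\<mu> n) {s. R < \<bar>s k\<bar>} < e * (1/2) ^ Suc k) \<and> measure \<nu> {s. R < \<bar>s k\<bar>} < e * (1/2) ^ Suc k"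
      by (intro allI marg) (simp add: e)
    then obtain R where R: "\<And>k. R k > 0" "\<And>n k. measure (\<mu> n) {s. R k < \<bar>s k\<bar>} < e * (1/2) ^ Suc k"
      "\<And>k. measure \<nu> {s. R k < \<bar>s k\<bar>} < e * (1/2) ^ Suc k" by metis
    define K where "K = PiE UNIV (\<lambda>k. {- R k .. R k})"
    have K_iff: "s \<in> K \<longleftrightarrow> (\<forall>k. \<bar>s k\<bar> \<le> R k)" for s
      by (simp add: K_def PiE_iff abs_le_iff) (metis minus_le_iff)
    then have Km: "- K = (\<Union>k. {s. R k < \<bar>s k\<bar>})"
      by (simp add: set_eq_iff not_le)
    have Kset[measurable]: "- K \<in> sets borel" unfolding Km by measurable
    have small: "measure \<kappa> (- K) \<le> e"
      if "prob_space \<kappa>" "sets \<kappa> = sets borel" "\<And>k. measure \<kappa> {s. R k < \<bar>s k\<bar>} < e * (1/2) ^ Suc k" for \<kappa>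
    proof -
      interpret L: prob_space \<kappa> by fact
      note [measurable_cong] = that(2)
      have geo: "(\<lambda>k. e * (1/2) ^ Suc k) sums e" using sums_mult[OF power_half_series, of e] by simp
      have sm: "summable (\<lambda>k. measure \<kappa> {s. R k < \<bar>s k\<bar>})"
      proof (rule summable_comparison_test'[OF sums_summable[OF geo]])
        show "norm (measure \<kappa> {s. R k < \<bar>s k\<bar>}) \<le> e * (1/2) ^ Suc k" for k
          using that(3)[of k] by simp
      qed
      have "measure \<kappa> (- K) \<le> (\<Sum>k. measure \<kappa> {s. R k < \<bar>s k\<bar>})"
        unfolding Km
      proof (rule L.finite_measure_subadditive_countably[OF _ sm])
        show "range (\<lambda>k. {s. R k < \<bar>s k\<bar>}) \<subseteq> L.events"
          unfolding that(2) by auto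
      qed
      also have "\<dots> \<le> (\<Sum>k. e * (1/2) ^ Suc k)"
        by (intro suminf_le sm sums_summable[OF geo] less_imp_le that(3))
      finally show ?thesis using sums_unique[OF geo] by simp
    qed
    have compK: "compact K" unfolding K_def by (intro compact_PiE_UNIV) auto
    have injK: "inj_on (wrap R) K"
    proof (rule inj_onI, rule ext)
      fix s s' k assume s: "s \<in> K" "s' \<in> K" and w: "wrap R s = wrap R s'"
      have b: "\<bar>s k / R k\<bar> \<le> 1" "\<bar>s' k / R k\<bar> \<le> 1"
        using s R(1)[of k] by (simp_all add: K_iff abs_divide)
      have "cis (s k / R k) = cis (s' k / R k)" using fun_cong[OF w, of k] by (simp add: wrap_def)
      then have "sin (s k / R k) = sin (s' k / R k)" "cos (s k / R k) = cos (s' k / R k)"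
        by (auto simp: complex_eq_iff)
      moreover have "x = y" if "\<bar>x\<bar> \<le> 1" "\<bar>y\<bar> \<le> 1" "sin x = sin y" for x y :: real
        using that pi_gt3 by (rule_tac sin_inj_pi) linarith+
      ultimately have "s k / R k = s' k / R k" using b by blast
      then show "s k = s' k" using R(1)[of k] by simp
    qed
    define g where "g = the_inv_into K (wrap R)"
    have gw: "g (wrap R s) = s" if "s \<in> K" for s
      unfolding g_def by (rule the_inv_into_f_f[OF injK that])
    have cg: "continuous_on (wrap R ` K) g"
      by (rule continuous_on_inv[OF continuous_wrap compK]) (simp add: gw)
    have clK: "closed (wrap R ` K)"
      by (intro compact_imp_closed compact_continuous_image continuous_wrap compK)
    have cfg: "continuous_on (wrap R ` K) (\<lambda>z. f (g z))"
      by (rule continuous_on_compose2[OF f(1) cg]) simp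
    obtain F where F0: "continuous_on UNIV F" "\<And>z. z \<in> wrap R ` K \<Longrightarrow> F z = f (g z)"
      "\<And>z. z \<in> UNIV \<Longrightarrow> norm (F z) \<le> B"
    proof (rule Tietze[OF cfg])
      show "closedin (top_of_set UNIV) (wrap R ` K)" using clK by simp
      show "norm (f (g z)) \<le> B" for z using B(1) by simp
    qed (use B(2) in auto)
    have F: "continuous_on UNIV F" "z \<in> wrap R ` K \<Longrightarrow> F z = f (g z)" "\<bar>F z\<bar> \<le> B" for z
      using F0 by auto
    interpret FR: function_ring_on "Collect trig_poly" torus by (rule function_ring_torus)
    have "continuous_on torus F" by (rule continuous_on_subset[OF F(1)]) simp
    from FR.Stone_Weierstrass_basic[OF this e] obtain p where p: "trig_poly p" "\<And>z. z \<in> torus \<Longrightarrow> \<bar>F z - p z\<bar> < e"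
      by auto
    have pm[measurable]: "(\<lambda>s. p (wrap R s)) \<in> borel_measurable borel"
      by (intro borel_measurable_continuous_onI)
        (rule continuous_on_compose2[OF continuous_trig_poly[OF p(1), of UNIV] continuous_wrap], simp)
    have Fm[measurable]: "(\<lambda>s. F (wrap R s)) \<in> borel_measurable borel"
      by (intro borel_measurable_continuous_onI)
        (rule continuous_on_compose2[OF F(1) continuous_wrap], simp)
    have close: "\<bar>(\<integral>s. f s \<partial>\<kappa>) - (\<integral>s. p (wrap R s) \<partial>\<kappa>)\<bar> \<le> e * (2 * B + 1)"
      if "prob_space \<kappa>" "sets \<kappa> = sets borel" "\<And>k. measure \<kappa> {s. R k < \<bar>s k\<bar>} < e * (1/2) ^ Suc k" for \<kappa>
    proof -
      interpret L: prob_space \<kappa> by fact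
      note [measurable_cong] = that(2)
      have if': "integrable \<kappa> f" using B by (intro L.integrable_const_bound[where B=B]) auto
      have iF: "integrable \<kappa> (\<lambda>s. F (wrap R s))" using F by (intro L.integrable_const_bound[where B=B]) auto
      have iK: "integrable \<kappa> (indicator (- K) :: _ \<Rightarrow> real)"
        using Kset by (simp add: integrable_indicator_iff less_top[symmetric] that(2))
      have pF: "\<bar>F (wrap R s) - p (wrap R s)\<bar> < e" for s using p(2)[OF wrap_in_torus] .
      have pb: "\<bar>p (wrap R s)\<bar> \<le> B + e" for s using pF[of s] F(3)[of "wrap R s"] by linarith
      have ip: "integrable \<kappa> (\<lambda>s. p (wrap R s))"
        using pb by (intro L.integrable_const_bound[where B="B + e"]) auto
      have "\<bar>(\<integral>s. f s \<partial>\<kappa>) - (\<integral>s. p (wrap R s) \<partial>\<kappa>)\<bar> = \<bar>\<integral>s. f s - p (wrap R s) \<partial>\<kappa>\<bar>"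
        using if' ip by simp
      also have "\<dots> \<le> (\<integral>s. \<bar>f s - p (wrap R s)\<bar> \<partial>\<kappa>)" by (rule integral_abs_bound)
      also have "\<dots> \<le> (\<integral>s. e + 2 * B * indicator (- K) s \<partial>\<kappa>)"
      proof (intro integral_mono)
        show "integrable \<kappa> (\<lambda>s. \<bar>f s - p (wrap R s)\<bar>)" using if' ip by auto
        show "integrable \<kappa> (\<lambda>s. e + 2 * B * indicator (- K) s)"
          by (intro Bochner_Integration.integrable_add integrable_mult_right iK) simp
        fix s
        show "\<bar>f s - p (wrap R s)\<bar> \<le> e + 2 * B * indicator (- K) s"
        proof (cases "s \<in> K")
          case True
          then have "F (wrap R s) = f s" using F(2) gw by auto
          then show ?thesis using pF[of s] True by simp
        next
          case False
          then show ?thesis using pF[of s] F(3)[of "wrap R s"] B(1)[of s] by simp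
        qed
      qed
      also have "\<dots> = e + 2 * B * measure \<kappa> (- K)"
        using iK Kset sets_eq_imp_space_eq[OF that(2)] L.prob_space
        by (subst Bochner_Integration.integral_add) (auto simp: that(2))
      also have "\<dots> \<le> e + 2 * B * e" using small[OF that] B by (intro add_mono mult_left_mono) auto
      finally show ?thesis by (simp add: algebra_simps)
    qed
    from LIMSEQ_D[OF trig[OF p(1), of R] e] obtain N where
      N: "\<And>n. n \<ge> N \<Longrightarrow> \<bar>(\<integral>s. p (wrap R s) \<partial>\<mu> n) - (\<integral>s. p (wrap R s) \<partial>\<nu>)\<bar> < e" by auto
    have tot: "e * (2 * B + 1) + e * (2 * B + 1) + e < \<epsilon>"
    proof -
      have "e * (12 * B + 6) = \<epsilon>" using B by (simp add: e_def)
      moreover have "0 < e * B" using e B by simp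
      ultimately show ?thesis using e by (simp add: algebra_simps)
    qed
    show "\<exists>N. \<forall>n\<ge>N. norm ((\<integral>s. f s \<partial>\<mu> n) - (\<integral>s. f s \<partial>\<nu>)) < \<epsilon>"
    proof (intro exI allI impI)
      fix n assume "n \<ge> N"
      from N[OF this] close[OF \<mu>(1)[of n] \<mu>(2)[of n] R(2)] close[OF \<nu> R(3)] tot
      show "norm ((\<integral>s. f s \<partial>\<mu> n) - (\<integral>s. f s \<partial>\<nu>)) < \<epsilon>" unfolding real_norm_def by linarith
    qed
  qed
qed

section \<open>Convergence in probability\<close>

text \<open>
  The property holds, for all large \<open>n\<close>, outside an event of probability at most \<open>\<eta>\<close>.  The good event
  is existentially quantified, so the property may be non-measurable, for instance a
  statement about all frequencies in an interval.
\<close>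

definition holds_up_to :: "'a measure \<Rightarrow> real \<Rightarrow> (nat \<Rightarrow> 'a \<Rightarrow> bool) \<Rightarrow> bool" where
  "holds_up_to M \<eta> Q \<longleftrightarrow>
    (\<forall>\<^sub>F n in sequentially. \<exists>G\<in>sets M. measure M (space M - G) \<le> \<eta> \<and> (\<forall>\<omega>\<in>G. Q n \<omega>))"

definition vanishes_in_prob :: "'a measure \<Rightarrow> (nat \<Rightarrow> 'a \<Rightarrow> real) \<Rightarrow> bool" where
  "vanishes_in_prob M Y \<longleftrightarrow> (\<forall>\<kappa>>0. \<forall>\<eta>>0. holds_up_to M \<eta> (\<lambda>n \<omega>. \<bar>Y n \<omega>\<bar> \<le> \<kappa>))"

definition bounded_in_prob :: "'a measure \<Rightarrow> (nat \<Rightarrow> 'a \<Rightarrow> real) \<Rightarrow> bool" where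
  "bounded_in_prob M Y \<longleftrightarrow> (\<forall>\<eta>>0. \<exists>K>0. holds_up_to M \<eta> (\<lambda>n \<omega>. \<bar>Y n \<omega>\<bar> \<le> K))"

lemma holds_up_to_mono:
  assumes "holds_up_to M \<eta> Q" "\<forall>\<^sub>F n in sequentially. \<forall>\<omega>\<in>space M. Q n \<omega> \<longrightarrow> Q' n \<omega>"
  shows "holds_up_to M \<eta> Q'"
  using assms unfolding holds_up_to_def
  by (rule eventually_elim2) (meson sets.sets_into_space subsetD)

lemma vanishes_in_probD:
  "vanishes_in_prob M Y \<Longrightarrow> \<kappa> > 0 \<Longrightarrow> \<eta> > 0 \<Longrightarrow> holds_up_to M \<eta> (\<lambda>n \<omega>. \<bar>Y n \<omega>\<bar> \<le> \<kappa>)"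
  by (simp add: vanishes_in_prob_def)

context prob_space
begin

lemma holds_up_to_conj:
  assumes "holds_up_to M \<eta> Q" "holds_up_to M \<eta>' Q'"
  shows "holds_up_to M (\<eta> + \<eta>') (\<lambda>n \<omega>. Q n \<omega> \<and> Q' n \<omega>)"
  using assms unfolding holds_up_to_def
proof (rule eventually_elim2)
  fix n
  assume "\<exists>G\<in>events. prob (space M - G) \<le> \<eta> \<and> (\<forall>\<omega>\<in>G. Q n \<omega>)"
    and "\<exists>G\<in>events. prob (space M - G) \<le> \<eta>' \<and> (\<forall>\<omega>\<in>G. Q' n \<omega>)"
  then obtain G G' where G: "G \<in> events" "prob (space M - G) \<le> \<eta>" "\<forall>\<omega>\<in>G. Q n \<omega>"
    and G': "G' \<in> events" "prob (space M - G') \<le> \<eta>'" "\<forall>\<omega>\<in>G'. Q' n \<omega>" by blast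
  have "prob (space M - G \<inter> G') \<le> prob (space M - G) + prob (space M - G')"
    using G(1) G'(1) by (simp add: Diff_Int measure_Un_le)
  then show "\<exists>G\<in>events. prob (space M - G) \<le> \<eta> + \<eta>' \<and> (\<forall>\<omega>\<in>G. Q n \<omega> \<and> Q' n \<omega>)"
    using G G' by (intro bexI[of _ "G \<inter> G'"]) auto
qed

lemma holds_up_to_measurable:
  assumes "\<And>n. {\<omega> \<in> space M. \<not> Q n \<omega>} \<in> events" "holds_up_to M \<eta> Q"
  shows "\<forall>\<^sub>F n in sequentially. prob {\<omega> \<in> space M. \<not> Q n \<omega>} \<le> \<eta>"
  using assms(2) unfolding holds_up_to_def
proof (rule eventually_mono)
  fix n
  assume "\<exists>G\<in>events. prob (space M - G) \<le> \<eta> \<and> (\<forall>\<omega>\<in>G. Q n \<omega>)"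
  then obtain G where G: "G \<in> events" "prob (space M - G) \<le> \<eta>" "\<forall>\<omega>\<in>G. Q n \<omega>" by blast
  have "prob {\<omega> \<in> space M. \<not> Q n \<omega>} \<le> prob (space M - G)"
    using G by (intro finite_measure_mono) auto
  then show "prob {\<omega> \<in> space M. \<not> Q n \<omega>} \<le> \<eta>" using G(2) by linarith
qed

lemma holds_up_to_of_prob:
  assumes "\<And>n. {\<omega> \<in> space M. \<not> Q n \<omega>} \<in> events"
    "\<forall>\<^sub>F n in sequentially. prob {\<omega> \<in> space M. \<not> Q n \<omega>} \<le> \<eta>"
  shows "holds_up_to M \<eta> Q"
  using assms(2) unfolding holds_up_to_def
proof (rule eventually_mono)
  fix n assume n: "prob {\<omega> \<in> space M. \<not> Q n \<omega>} \<le> \<eta>"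
  have e: "{\<omega> \<in> space M. Q n \<omega>} = space M - {\<omega> \<in> space M. \<not> Q n \<omega>}" by auto
  show "\<exists>G\<in>events. prob (space M - G) \<le> \<eta> \<and> (\<forall>\<omega>\<in>G. Q n \<omega>)"
  proof (intro bexI[of _ "{\<omega> \<in> space M. Q n \<omega>}"] conjI)
    show "{\<omega> \<in> space M. Q n \<omega>} \<in> events" unfolding e using assms(1) by auto
    have "space M - {\<omega> \<in> space M. Q n \<omega>} = {\<omega> \<in> space M. \<not> Q n \<omega>}" by auto
    then show "prob (space M - {\<omega> \<in> space M. Q n \<omega>}) \<le> \<eta>" using n by simp
  qed auto
qed

lemma vanishes_in_prob_iff:
  assumes [measurable]: "\<And>n. Y n \<in> borel_measurable M"
  shows "vanishes_in_prob M Y \<longleftrightarrow> converges_in_prob M Y 0"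
proof
  assume v: "vanishes_in_prob M Y"
  show "converges_in_prob M Y 0"
    unfolding converges_in_prob_def
  proof (intro allI impI)
    fix \<epsilon> :: real assume "\<epsilon> > 0"
    show "(\<lambda>n. prob {\<omega> \<in> space M. \<epsilon> < \<bar>Y n \<omega> - 0\<bar>}) \<longlonglongrightarrow> 0"
    proof (rule tendstoI)
      fix e :: real assume "e > 0"
      then have "holds_up_to M (e / 2) (\<lambda>n \<omega>. \<bar>Y n \<omega>\<bar> \<le> \<epsilon>)"
        using v \<open>\<epsilon> > 0\<close> unfolding vanishes_in_prob_def by simp
      from holds_up_to_measurable[OF _ this]
      have "\<forall>\<^sub>F n in sequentially. prob {\<omega> \<in> space M. \<not> \<bar>Y n \<omega>\<bar> \<le> \<epsilon>} \<le> e / 2" by simp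
      then show "\<forall>\<^sub>F n in sequentially. dist (prob {\<omega> \<in> space M. \<epsilon> < \<bar>Y n \<omega> - 0\<bar>}) 0 < e"
        using \<open>e > 0\<close> by (auto elim!: eventually_mono simp: not_le)
    qed
  qed
next
  assume c: "converges_in_prob M Y 0"
  show "vanishes_in_prob M Y"
    unfolding vanishes_in_prob_def
  proof (intro allI impI)
    fix \<kappa> \<eta> :: real assume "\<kappa> > 0" "\<eta> > 0"
    then have "\<forall>\<^sub>F n in sequentially. prob {\<omega> \<in> space M. \<kappa> < \<bar>Y n \<omega> - 0\<bar>} < \<eta>"
      using c unfolding converges_in_prob_def by (intro order_tendstoD(2)[where y=0]) auto
    then show "holds_up_to M \<eta> (\<lambda>n \<omega>. \<bar>Y n \<omega>\<bar> \<le> \<kappa>)"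
      by (intro holds_up_to_of_prob) (auto elim!: eventually_mono simp: not_le)
  qed
qed

lemma vanishes_in_prob_of_expectation:
  assumes "\<And>n. integrable M (Y n)" "\<And>n \<omega>. \<omega> \<in> space M \<Longrightarrow> 0 \<le> Y n \<omega>" "(\<lambda>n. expectation (Y n)) \<longlonglongrightarrow> 0"
  shows "vanishes_in_prob M Y"
  unfolding vanishes_in_prob_def
proof (intro allI impI)
  fix \<kappa> \<eta> :: real assume k: "\<kappa> > 0" "\<eta> > 0"
  note [measurable] = borel_measurable_integrable[OF assms(1)]
  have "\<forall>\<^sub>F n in sequentially. expectation (Y n) < \<kappa> * \<eta>"
    using k assms(3) by (intro order_tendstoD(2)[where y=0]) auto
  then have "\<forall>\<^sub>F n in sequentially. prob {\<omega> \<in> space M. \<not> \<bar>Y n \<omega>\<bar> \<le> \<kappa>} \<le> \<eta>"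
  proof (rule eventually_mono)
    fix n assume n: "expectation (Y n) < \<kappa> * \<eta>"
    have "prob {\<omega> \<in> space M. \<not> \<bar>Y n \<omega>\<bar> \<le> \<kappa>} \<le> prob {\<omega> \<in> space M. \<kappa> \<le> Y n \<omega>}"
      using assms(2) by (intro finite_measure_mono) auto
    also have "\<dots> \<le> expectation (Y n) / \<kappa>"
      using assms(1,2) k by (intro integral_Markov_inequality_measure[where A="space M"]) auto
    also have "\<dots> \<le> \<eta>" using n k by (simp add: field_simps)
    finally show "prob {\<omega> \<in> space M. \<not> \<bar>Y n \<omega>\<bar> \<le> \<kappa>} \<le> \<eta>" .
  qed
  then show "holds_up_to M \<eta> (\<lambda>n \<omega>. \<bar>Y n \<omega>\<bar> \<le> \<kappa>)"
    by (intro holds_up_to_of_prob) auto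
qed

lemma expectation_tendsto_zero:
  fixes Y :: "nat \<Rightarrow> 'a \<Rightarrow> 'b::{banach, second_countable_topology}"
  assumes [measurable]: "\<And>n. Y n \<in> borel_measurable M"
    and bd: "\<And>n \<omega>. \<omega> \<in> space M \<Longrightarrow> norm (Y n \<omega>) \<le> B"
    and v: "vanishes_in_prob M (\<lambda>n \<omega>. norm (Y n \<omega>))"
  shows "(\<lambda>n. expectation (Y n)) \<longlonglongrightarrow> 0"
proof (rule tendstoI)
  fix e :: real assume "e > 0"
  have B: "0 \<le> B" using bd not_empty by (meson ex_in_conv norm_ge_zero order_trans)
  define \<eta> where "\<eta> = e / (4 * (B + 1))"
  have \<eta>: "\<eta> > 0" "B * \<eta> \<le> e / 4" using \<open>e > 0\<close> B by (auto simp: \<eta>_def field_simps)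
  have "holds_up_to M \<eta> (\<lambda>n \<omega>. norm (Y n \<omega>) \<le> e / 4)"
    using vanishes_in_probD[OF v, of "e / 4" \<eta>] \<eta> \<open>e > 0\<close> by simp
  from holds_up_to_measurable[OF _ this]
  have "\<forall>\<^sub>F n in sequentially. prob {\<omega> \<in> space M. \<not> norm (Y n \<omega>) \<le> e / 4} \<le> \<eta>" by simp
  then show "\<forall>\<^sub>F n in sequentially. dist (expectation (Y n)) 0 < e"
  proof (rule eventually_mono)
    fix n assume n: "prob {\<omega> \<in> space M. \<not> norm (Y n \<omega>) \<le> e / 4} \<le> \<eta>"
    let ?A = "{\<omega> \<in> space M. \<not> norm (Y n \<omega>) \<le> e / 4}"
    have i: "integrable M (Y n)" using bd by (intro integrable_const_bound[where B=B]) auto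
    have "norm (expectation (Y n)) \<le> expectation (\<lambda>\<omega>. norm (Y n \<omega>))" by (rule integral_norm_bound)
    also have "\<dots> \<le> expectation (\<lambda>\<omega>. e / 4 + B * indicator ?A \<omega>)"
    proof (intro integral_mono)
      show "integrable M (\<lambda>\<omega>. e / 4 + B * indicator ?A \<omega>)"
        by (intro Bochner_Integration.integrable_add integrable_mult_right)
          (auto simp: integrable_indicator_iff less_top[symmetric])
      fix \<omega> assume "\<omega> \<in> space M"
      then show "norm (Y n \<omega>) \<le> e / 4 + B * indicator ?A \<omega>"
        using bd[of \<omega> n] \<open>e > 0\<close> B by (cases "\<omega> \<in> ?A") auto
    qed (use i in auto)
    also have "\<dots> = e / 4 + B * prob ?A"
      by (subst Bochner_Integration.integral_add)
        (auto simp: integrable_indicator_iff less_top[symmetric] prob_space)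
    also have "\<dots> \<le> e / 4 + B * \<eta>" using n B by (intro add_mono mult_left_mono) auto
    also have "\<dots> < e" using \<eta> \<open>e > 0\<close> by linarith
    finally show "dist (expectation (Y n)) 0 < e" by simp
  qed
qed

lemma vanishes_in_prob_le:
  assumes "vanishes_in_prob M Z" "\<forall>\<^sub>F n in sequentially. \<forall>\<omega>\<in>space M. \<bar>Y n \<omega>\<bar> \<le> \<bar>Z n \<omega>\<bar>"
  shows "vanishes_in_prob M Y"
  unfolding vanishes_in_prob_def
proof (intro allI impI)
  fix \<kappa> \<eta> :: real assume "\<kappa> > 0" "\<eta> > 0"
  then have "holds_up_to M \<eta> (\<lambda>n \<omega>. \<bar>Z n \<omega>\<bar> \<le> \<kappa>)" by (rule vanishes_in_probD[OF assms(1)])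
  then show "holds_up_to M \<eta> (\<lambda>n \<omega>. \<bar>Y n \<omega>\<bar> \<le> \<kappa>)"
    by (rule holds_up_to_mono) (use assms(2) in \<open>auto elim!: eventually_mono\<close>)
qed

lemma vanishes_in_prob_add:
  assumes "vanishes_in_prob M Y" "vanishes_in_prob M Z"
  shows "vanishes_in_prob M (\<lambda>n \<omega>. Y n \<omega> + Z n \<omega>)"
  unfolding vanishes_in_prob_def
proof (intro allI impI)
  fix \<kappa> \<eta> :: real assume "\<kappa> > 0" "\<eta> > 0"
  then have "holds_up_to M (\<eta> / 2) (\<lambda>n \<omega>. \<bar>Y n \<omega>\<bar> \<le> \<kappa> / 2)" "holds_up_to M (\<eta> / 2) (\<lambda>n \<omega>. \<bar>Z n \<omega>\<bar> \<le> \<kappa> / 2)"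
    by (intro vanishes_in_probD assms; simp)+
  from holds_up_to_conj[OF this]
  have "holds_up_to M \<eta> (\<lambda>n \<omega>. \<bar>Y n \<omega>\<bar> \<le> \<kappa> / 2 \<and> \<bar>Z n \<omega>\<bar> \<le> \<kappa> / 2)" by simp
  then show "holds_up_to M \<eta> (\<lambda>n \<omega>. \<bar>Y n \<omega> + Z n \<omega>\<bar> \<le> \<kappa>)"
    by (rule holds_up_to_mono) (intro always_eventually allI ballI impI, elim conjE, linarith)
qed

lemma vanishes_in_prob_sum:
  assumes "finite I" "\<And>i. i \<in> I \<Longrightarrow> vanishes_in_prob M (Y i)"
  shows "vanishes_in_prob M (\<lambda>n \<omega>. \<Sum>i\<in>I. Y i n \<omega>)"
  using assms
proof (induction I rule: finite_induct)
  case empty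
  show ?case unfolding vanishes_in_prob_def holds_up_to_def
    by (auto intro!: always_eventually bexI[of _ "space M"])
next
  case (insert i I)
  then show ?case by (auto intro!: vanishes_in_prob_add)
qed

text \<open>
  Polynomials are uniformly dense in the continuous functions on \<open>[0,1]\<close>.
\<close>

lemma expectation_tendsto_of_moments:
  fixes Y :: "nat \<Rightarrow> 'a \<Rightarrow> real" and N :: "'b measure" and V :: "'b \<Rightarrow> real" and g :: "real \<Rightarrow> real"
  assumes [measurable]: "\<And>n. Y n \<in> borel_measurable M" and Y01: "\<And>n \<omega>. \<omega> \<in> space M \<Longrightarrow> Y n \<omega> \<in> {0..1}"
    and N: "prob_space N" and [measurable]: "V \<in> borel_measurable N" and V01: "\<And>v. v \<in> space N \<Longrightarrow> V v \<in> {0..1}"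
    and mom: "\<And>k. k \<ge> 1 \<Longrightarrow> (\<lambda>n. expectation (\<lambda>\<omega>. Y n \<omega> ^ k)) \<longlonglongrightarrow> (\<integral>v. V v ^ k \<partial>N)"
    and g: "continuous_on {0..1} g"
  shows "(\<lambda>n. expectation (\<lambda>\<omega>. g (Y n \<omega>))) \<longlonglongrightarrow> (\<integral>v. g (V v) \<partial>N)"
proof -
  interpret N: prob_space N by fact
  have iY: "integrable M (\<lambda>\<omega>. Y n \<omega> ^ k)" for n k
    using Y01 by (intro integrable_const_bound[where B=1]) (auto simp: power_le_one power_abs)
  have iV: "integrable N (\<lambda>v. V v ^ k)" for k
    using V01 by (intro N.integrable_const_bound[where B=1]) (auto simp: power_le_one power_abs)
  have mom': "(\<lambda>n. expectation (\<lambda>\<omega>. Y n \<omega> ^ k)) \<longlonglongrightarrow> (\<integral>v. V v ^ k \<partial>N)" for k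
    using mom[of k] by (cases "k = 0") (auto simp: prob_space N.prob_space)
  \<comment> \<open>extend \<open>g\<close> to the line, to have measurability without restricting the measure space\<close>
  define g' where "g' x = g (max 0 (min 1 x))" for x
  have cg': "continuous_on UNIV g'" unfolding g'_def
    by (rule continuous_on_compose2[OF g]) (auto intro!: continuous_intros)
  have [measurable]: "g' \<in> borel_measurable borel" by (rule borel_measurable_continuous_onI[OF cg'])
  have gg: "g' x = g x" if "x \<in> {0..1}" for x using that by (auto simp: g'_def)
  have "compact (g ` {0..1})" by (rule compact_continuous_image[OF g]) simp
  from compact_imp_bounded[OF this] obtain B where "\<And>y. y \<in> g ` {0..1} \<Longrightarrow> norm y \<le> B"
    unfolding bounded_iff by blast
  then have B: "\<bar>g x\<bar> \<le> B" if "x \<in> {0..1}" for x using that by auto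
  have B': "\<bar>g' x\<bar> \<le> B" for x unfolding g'_def by (intro B) auto
  have igY: "integrable M (\<lambda>\<omega>. g' (Y n \<omega>))" for n using B' by (intro integrable_const_bound[where B=B]) auto
  have igV: "integrable N (\<lambda>v. g' (V v))" using B' by (intro N.integrable_const_bound[where B=B]) auto
  have "(\<lambda>n. expectation (\<lambda>\<omega>. g' (Y n \<omega>))) \<longlonglongrightarrow> (\<integral>v. g' (V v) \<partial>N)"
  proof (rule LIMSEQ_I)
    fix e :: real assume "e > 0"
    from Stone_Weierstrass_real_polynomial_function[OF compact_Icc g, of "e / 4"] \<open>e > 0\<close>
    obtain p where p: "real_polynomial_function p" "\<And>x. x \<in> {0..1} \<Longrightarrow> \<bar>g x - p x\<bar> < e / 4" by auto
    obtain a m where pa: "p = (\<lambda>x. \<Sum>i\<le>m. a i * x ^ i)"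
      using p(1) real_polynomial_function_iff_sum by blast
    have ipY: "integrable M (\<lambda>\<omega>. p (Y n \<omega>))" for n
      unfolding pa by (intro Bochner_Integration.integrable_sum integrable_mult_right iY)
    have ipV: "integrable N (\<lambda>v. p (V v))"
      unfolding pa by (intro Bochner_Integration.integrable_sum integrable_mult_right iV)
    have "(\<lambda>n. expectation (\<lambda>\<omega>. p (Y n \<omega>))) \<longlonglongrightarrow> (\<integral>v. p (V v) \<partial>N)"
      unfolding pa
      by (subst (1 2) Bochner_Integration.integral_sum)
        (auto intro!: integrable_mult_right iY iV tendsto_sum tendsto_mult mom')
    from LIMSEQ_D[OF this, of "e / 4"] \<open>e > 0\<close> obtain n0 where
      n0: "\<And>n. n \<ge> n0 \<Longrightarrow> \<bar>expectation (\<lambda>\<omega>. p (Y n \<omega>)) - (\<integral>v. p (V v) \<partial>N)\<bar> < e / 4" by auto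
    have dY: "\<bar>expectation (\<lambda>\<omega>. g' (Y n \<omega>)) - expectation (\<lambda>\<omega>. p (Y n \<omega>))\<bar> \<le> e / 4" for n
    proof -
      have "\<bar>expectation (\<lambda>\<omega>. g' (Y n \<omega>)) - expectation (\<lambda>\<omega>. p (Y n \<omega>))\<bar>
          = \<bar>expectation (\<lambda>\<omega>. g' (Y n \<omega>) - p (Y n \<omega>))\<bar>" using igY ipY by simp
      also have "\<dots> \<le> expectation (\<lambda>\<omega>. \<bar>g' (Y n \<omega>) - p (Y n \<omega>)\<bar>)" by (rule integral_abs_bound)
      also have "\<dots> \<le> expectation (\<lambda>\<omega>. e / 4)"
        using igY ipY p(2)[OF Y01] gg[OF Y01] by (intro integral_mono) (auto intro: less_imp_le)
      finally show ?thesis by (simp add: prob_space)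
    qed
    have dV: "\<bar>(\<integral>v. g' (V v) \<partial>N) - (\<integral>v. p (V v) \<partial>N)\<bar> \<le> e / 4"
    proof -
      have "\<bar>(\<integral>v. g' (V v) \<partial>N) - (\<integral>v. p (V v) \<partial>N)\<bar> = \<bar>(\<integral>v. g' (V v) - p (V v) \<partial>N)\<bar>" using igV ipV by simp
      also have "\<dots> \<le> (\<integral>v. \<bar>g' (V v) - p (V v)\<bar> \<partial>N)" by (rule integral_abs_bound)
      also have "\<dots> \<le> (\<integral>v. e / 4 \<partial>N)"
        using igV ipV p(2)[OF V01] gg[OF V01] by (intro integral_mono) (auto intro: less_imp_le)
      finally show ?thesis by (simp add: N.prob_space)
    qed
    show "\<exists>n0. \<forall>n\<ge>n0. norm (expectation (\<lambda>\<omega>. g' (Y n \<omega>)) - (\<integral>v. g' (V v) \<partial>N)) < e"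
    proof (intro exI allI impI)
      fix n assume "n \<ge> n0"
      from n0[OF this] dY[of n] dV \<open>e > 0\<close>
      show "norm (expectation (\<lambda>\<omega>. g' (Y n \<omega>)) - (\<integral>v. g' (V v) \<partial>N)) < e"
        unfolding real_norm_def by linarith
    qed
  qed
  moreover have "expectation (\<lambda>\<omega>. g' (Y n \<omega>)) = expectation (\<lambda>\<omega>. g (Y n \<omega>))" for n
    using gg Y01 by (intro Bochner_Integration.integral_cong) auto
  moreover have "(\<integral>v. g' (V v) \<partial>N) = (\<integral>v. g (V v) \<partial>N)"
    using gg V01 by (intro Bochner_Integration.integral_cong) auto
  ultimately show ?thesis by simp
qed

end

section \<open>Characteristic functions of the row sums\<close>

text \<open>
  On rectangles the product measure is a finite product of measurable functions.
\<close>

lemma measurable_PiM_const_prob_algebra: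
  assumes p: "p \<in> M \<rightarrow>\<^sub>M prob_algebra borel" and J: "finite J"
  shows "(\<lambda>\<omega>. \<Pi>\<^sub>M k\<in>J. p \<omega>) \<in> M \<rightarrow>\<^sub>M prob_algebra (\<Pi>\<^sub>M k\<in>J. (borel :: real measure))"
proof (rule measurable_prob_algebra_generated[OF sets_PiM Int_stable_prod_algebra prod_algebra_sets_into_space])
  note ps = measurable_space[OF p, unfolded space_prob_algebra]
  fix \<omega> assume \<omega>: "\<omega> \<in> space M"
  then have pp: "prob_space (p \<omega>)" "sets (p \<omega>) = sets borel" using ps by auto
  show "prob_space (\<Pi>\<^sub>M k\<in>J. p \<omega>)" by (intro prob_space_PiM pp)
  show "sets (\<Pi>\<^sub>M k\<in>J. p \<omega>) = sets (\<Pi>\<^sub>M k\<in>J. (borel :: real measure))"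
    by (intro sets_PiM_cong) (auto simp: pp)
next
  note ps = measurable_space[OF p, unfolded space_prob_algebra]
  fix A assume A: "A \<in> prod_algebra J (\<lambda>_. borel :: real measure)"
  obtain E where E: "A = Pi\<^sub>E J E" "E \<in> J \<rightarrow> sets borel"
    by (rule prod_algebraE_all[OF A])
  have "emeasure (\<Pi>\<^sub>M k\<in>J. p \<omega>) A = (\<Prod>k\<in>J. emeasure (p \<omega>) (E k))" if "\<omega> \<in> space M" for \<omega>
  proof -
    have pp: "prob_space (p \<omega>)" "sets (p \<omega>) = sets borel" using ps that by auto
    interpret product_prob_space "\<lambda>_. p \<omega>" J by (rule product_prob_spaceI) (rule pp)
    show ?thesis unfolding E using E(2) J by (intro emeasure_PiM) (auto simp: pp)
  qed
  moreover have "(\<lambda>\<omega>. \<Prod>k\<in>J. emeasure (p \<omega>) (E k)) \<in> borel_measurable M"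
    using E(2)
    by (intro borel_measurable_prod_ennreal
        measurable_compose[OF measurable_prob_algebraD[OF p] measurable_emeasure_subprob_algebra]) auto
  ultimately show "(\<lambda>\<omega>. emeasure (\<Pi>\<^sub>M k\<in>J. p \<omega>) A) \<in> borel_measurable M"
    by (simp cong: measurable_cong)
qed

context prob_space
begin

text \<open>
  The expectation of a conditional probability is the probability.
\<close>

lemma prob_eq_expectation_prod:
  assumes d: "directing_random_measure M X p" and X: "\<And>i j. X i j \<in> borel_measurable M"
    and J: "finite J" and A: "\<And>k. k \<in> J \<Longrightarrow> A k \<in> sets borel"
  shows "prob {\<omega> \<in> space M. \<forall>k\<in>J. X (fst k) (snd k) \<omega> \<in> A k} = expectation (\<lambda>\<omega>. \<Prod>k\<in>J. measure (p \<omega>) (A k))"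
proof -
  let ?F = "vimage_algebra (space M) p (prob_algebra borel)"
  let ?E = "{\<omega> \<in> space M. \<forall>k\<in>J. X (fst k) (snd k) \<omega> \<in> A k}"
  have p: "p \<in> M \<rightarrow>\<^sub>M prob_algebra borel" using d by (simp add: directing_random_measure_def)
  have sub: "subalgebra M ?F"
    unfolding subalgebra_def using p
    by (auto simp: sets_vimage_algebra2[OF measurable_space[OF p, THEN Pi_I]] measurable_sets)
  interpret F: finite_measure_subalgebra M ?F
    by unfold_locales (rule sub)
  have E: "?E \<in> events"
  proof (intro sets.sets_Collect_finite_All J)
    fix k assume "k \<in> J"
    have "{\<omega> \<in> space M. X (fst k) (snd k) \<omega> \<in> A k} = X (fst k) (snd k) -` A k \<inter> space M" by auto
    then show "{\<omega> \<in> space M. X (fst k) (snd k) \<omega> \<in> A k} \<in> events"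
      using measurable_sets[OF X A[OF \<open>k \<in> J\<close>]] by simp
  qed
  have ae: "AE \<omega> in M. real_cond_exp M ?F (indicator ?E) \<omega> = (\<Prod>k\<in>J. measure (p \<omega>) (A k))"
    using d J A unfolding directing_random_measure_def by blast
  have pm: "(\<lambda>\<omega>. measure (p \<omega>) B) \<in> borel_measurable M" if "B \<in> sets borel" for B
    using measurable_compose[OF measurable_prob_algebraD[OF p] measurable_measure_subprob_algebra[OF that]] .
  have "prob ?E = expectation (indicator ?E)" using E by simp
  also have "\<dots> = expectation (real_cond_exp M ?F (indicator ?E))"
    using E by (intro F.real_cond_exp_int(2)[symmetric]) (simp add: integrable_indicator_iff less_top[symmetric])
  also have "\<dots> = expectation (\<lambda>\<omega>. \<Prod>k\<in>J. measure (p \<omega>) (A k))"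
    using ae A p
    by (intro integral_cong_AE) (auto intro!: borel_measurable_prod pm)
  finally show ?thesis .
qed

text \<open>
  The law of finitely many entries is a mixture of product measures: both sides agree on
  rectangles, where the definition of the directing measure applies.
\<close>

lemma joint_law_eq_bind:
  assumes d: "directing_random_measure M X p" and X: "\<And>i j. X i j \<in> borel_measurable M"
    and J: "finite J"
  shows "distr M (\<Pi>\<^sub>M k\<in>J. borel) (\<lambda>\<omega>. \<lambda>k\<in>J. X (fst k) (snd k) \<omega>) = M \<bind> (\<lambda>\<omega>. \<Pi>\<^sub>M k\<in>J. p \<omega>)"
proof -
  let ?N = "\<Pi>\<^sub>M k\<in>J. (borel :: real measure)"
  let ?T = "\<lambda>\<omega>. \<lambda>k\<in>J. X (fst k) (snd k) \<omega>"
  have p: "p \<in> M \<rightarrow>\<^sub>M prob_algebra borel" using d by (simp add: directing_random_measure_def)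
  note ps = measurable_space[OF p, unfolded space_prob_algebra]
  note pi = measurable_PiM_const_prob_algebra[OF p J]
  have pm: "(\<lambda>\<omega>. measure (p \<omega>) B) \<in> borel_measurable M" if "B \<in> sets borel" for B
    using measurable_compose[OF measurable_prob_algebraD[OF p] measurable_measure_subprob_algebra[OF that]] .
  have T: "?T \<in> M \<rightarrow>\<^sub>M ?N" using X by (intro measurable_restrict) auto
  show ?thesis
  proof (rule measure_eqI_PiM_finite[OF J])
    show "sets (distr M ?N ?T) = sets ?N" by simp
    show "sets (M \<bind> (\<lambda>\<omega>. \<Pi>\<^sub>M k\<in>J. p \<omega>)) = sets ?N"
      using not_empty measurable_space[OF pi] by (intro sets_bind) (auto simp: space_prob_algebra)
    show "\<And>A. (\<And>i. i \<in> J \<Longrightarrow> A i \<in> sets borel) \<Longrightarrow>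
        emeasure (distr M ?N ?T) (Pi\<^sub>E J A) = emeasure (M \<bind> (\<lambda>\<omega>. \<Pi>\<^sub>M k\<in>J. p \<omega>)) (Pi\<^sub>E J A)"
    proof -
      fix A :: "nat \<times> nat \<Rightarrow> real set" assume A: "\<And>i. i \<in> J \<Longrightarrow> A i \<in> sets borel"
      have "emeasure (distr M ?N ?T) (Pi\<^sub>E J A) = emeasure M {\<omega> \<in> space M. \<forall>k\<in>J. X (fst k) (snd k) \<omega> \<in> A k}"
      proof (subst emeasure_distr[OF T])
        show "Pi\<^sub>E J A \<in> sets ?N" using A J by (intro sets_PiM_I_finite) auto
        have "?T -` Pi\<^sub>E J A \<inter> space M = {\<omega> \<in> space M. \<forall>k\<in>J. X (fst k) (snd k) \<omega> \<in> A k}"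
          by (rule set_eqI) (simp add: PiE_iff conj_commute)
        then show "emeasure M (?T -` Pi\<^sub>E J A \<inter> space M) = emeasure M {\<omega> \<in> space M. \<forall>k\<in>J. X (fst k) (snd k) \<omega> \<in> A k}"
          by (rule arg_cong)
      qed
      also have "\<dots> = ennreal (expectation (\<lambda>\<omega>. \<Prod>k\<in>J. measure (p \<omega>) (A k)))"
        unfolding emeasure_eq_measure by (subst prob_eq_expectation_prod[OF d X J A]) auto
      also have "\<dots> = (\<integral>\<^sup>+ \<omega>. ennreal (\<Prod>k\<in>J. measure (p \<omega>) (A k)) \<partial>M)"
      proof (intro nn_integral_eq_integral[symmetric] integrable_const_bound[where B=1] AE_I2)
        fix \<omega> assume "\<omega> \<in> space M"
        then have "prob_space (p \<omega>)" using ps by auto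
        then show "norm (\<Prod>k\<in>J. measure (p \<omega>) (A k)) \<le> 1"
          by (auto simp: abs_prod intro!: prod_le_1 prob_space.prob_le_1)
      qed (use A in \<open>auto intro!: borel_measurable_prod pm prod_nonneg\<close>)
      also have "\<dots> = (\<integral>\<^sup>+ \<omega>. emeasure (\<Pi>\<^sub>M k\<in>J. p \<omega>) (Pi\<^sub>E J A) \<partial>M)"
      proof (intro nn_integral_cong)
        fix \<omega> assume "\<omega> \<in> space M"
        then have pp: "prob_space (p \<omega>)" "sets (p \<omega>) = sets borel" using ps by auto
        interpret p: prob_space "p \<omega>" by (rule pp)
        interpret product_prob_space "\<lambda>_. p \<omega>" J by (rule product_prob_spaceI) (rule pp)
        have "emeasure (\<Pi>\<^sub>M k\<in>J. p \<omega>) (Pi\<^sub>E J A) = (\<Prod>k\<in>J. emeasure (p \<omega>) (A k))"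
          using A J by (intro emeasure_PiM) (auto simp: pp)
        then show "ennreal (\<Prod>k\<in>J. measure (p \<omega>) (A k)) = emeasure (\<Pi>\<^sub>M k\<in>J. p \<omega>) (Pi\<^sub>E J A)"
          by (simp add: p.emeasure_eq_measure prod_ennreal)
      qed
      also have "\<dots> = emeasure (M \<bind> (\<lambda>\<omega>. \<Pi>\<^sub>M k\<in>J. p \<omega>)) (Pi\<^sub>E J A)"
        using A J not_empty
        by (intro emeasure_bind[symmetric, where N="?N"] measurable_prob_algebraD[OF pi])
          (auto intro!: sets_PiM_I_finite)
      finally show "emeasure (distr M ?N ?T) (Pi\<^sub>E J A) = emeasure (M \<bind> (\<lambda>\<omega>. \<Pi>\<^sub>M k\<in>J. p \<omega>)) (Pi\<^sub>E J A)" .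
    qed
    show "range (\<lambda>_ :: nat. space ?N) \<subseteq> prod_algebra J (\<lambda>_. borel)"
      using J by (auto simp: space_PiM intro!: prod_algebraI_finite)
    show "(\<Union>i :: nat. space ?N) = space ?N" by simp
    interpret T: prob_space "distr M ?N ?T" by (rule prob_space_distr[OF T])
    show "emeasure (distr M ?N ?T) (space ?N) \<noteq> \<infinity>" by simp
  qed
qed

lemma expectation_prod_of_directing:
  fixes f :: "nat \<times> nat \<Rightarrow> real \<Rightarrow> complex"
  assumes d: "directing_random_measure M X p" and X: "\<And>i j. X i j \<in> borel_measurable M"
    and J: "finite J" and f: "\<And>k. k \<in> J \<Longrightarrow> f k \<in> borel_measurable borel"
    and f1: "\<And>k x. k \<in> J \<Longrightarrow> cmod (f k x) \<le> 1"
  shows "expectation (\<lambda>\<omega>. \<Prod>k\<in>J. f k (X (fst k) (snd k) \<omega>)) = expectation (\<lambda>\<omega>. \<Prod>k\<in>J. (\<integral>x. f k x \<partial>p \<omega>))"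
proof -
  let ?N = "\<Pi>\<^sub>M k\<in>J. (borel :: real measure)"
  let ?T = "\<lambda>\<omega>. \<lambda>k\<in>J. X (fst k) (snd k) \<omega>"
  define g where "g x = (\<Prod>k\<in>J. f k (x k))" for x :: "nat \<times> nat \<Rightarrow> real"
  have p: "p \<in> M \<rightarrow>\<^sub>M prob_algebra borel" using d by (simp add: directing_random_measure_def)
  note ps = measurable_space[OF p, unfolded space_prob_algebra]
  note pi = measurable_PiM_const_prob_algebra[OF p J]
  have T: "?T \<in> M \<rightarrow>\<^sub>M ?N" using X by (intro measurable_restrict) auto
  have g[measurable]: "g \<in> borel_measurable ?N"
    unfolding g_def
  proof (intro borel_measurable_prod)
    fix k assume k: "k \<in> J"
    show "(\<lambda>x. f k (x k)) \<in> borel_measurable ?N"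
      by (rule measurable_compose[OF measurable_component_singleton[OF k] f[OF k]])
  qed
  have g1: "cmod (g x) \<le> 1" for x unfolding g_def prod_norm[symmetric] using f1 by (intro prod_le_1) auto
  have pr: "prob_space (\<Pi>\<^sub>M k\<in>J. p \<omega>)" "sets (\<Pi>\<^sub>M k\<in>J. p \<omega>) = sets ?N" if "\<omega> \<in> space M" for \<omega>
    using measurable_space[OF pi that] by (auto simp: space_prob_algebra)
  have inner: "(\<integral>x. g x \<partial>(\<Pi>\<^sub>M k\<in>J. p \<omega>)) = (\<Prod>k\<in>J. (\<integral>x. f k x \<partial>p \<omega>))" if w: "\<omega> \<in> space M" for \<omega>
  proof -
    have pp: "prob_space (p \<omega>)" "sets (p \<omega>) = sets borel" using ps w by auto
    interpret p: prob_space "p \<omega>" by (rule pp)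
    interpret product_sigma_finite "\<lambda>_. p \<omega>" by unfold_locales
    have "f k \<in> borel_measurable (p \<omega>)" if "k \<in> J" for k
      using f[OF that] pp(2) by (simp cong: measurable_cong_sets)
    then show ?thesis unfolding g_def
      using f1 by (intro product_integral_prod J p.integrable_const_bound[where B=1]) auto
  qed
  have gi: "integrable (\<Pi>\<^sub>M k\<in>J. p \<omega>) g" if w: "\<omega> \<in> space M" for \<omega>
  proof -
    interpret P: prob_space "\<Pi>\<^sub>M k\<in>J. p \<omega>" by (rule pr[OF w])
    have "g \<in> borel_measurable (\<Pi>\<^sub>M k\<in>J. p \<omega>)" using g pr(2)[OF w] by (simp cong: measurable_cong_sets)
    then show ?thesis using g1 by (intro P.integrable_const_bound[where B=1]) auto
  qed
  have real: "expectation (\<lambda>\<omega>. h (g (?T \<omega>))) = expectation (\<lambda>\<omega>. \<integral>x. h (g x) \<partial>(\<Pi>\<^sub>M k\<in>J. p \<omega>))"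
    if h: "\<And>z. \<bar>h z\<bar> \<le> cmod z" "h \<in> borel_measurable borel" for h :: "complex \<Rightarrow> real"
  proof -
    have hg: "(\<lambda>x. h (g x)) \<in> borel_measurable ?N" using g h(2) by (rule measurable_compose)
    have hb: "\<bar>h (g x)\<bar> \<le> 1" for x using h(1)[of "g x"] g1[of x] by linarith
    have "expectation (\<lambda>\<omega>. h (g (?T \<omega>))) = (\<integral>x. h (g x) \<partial>distr M ?N ?T)"
      using hg by (subst integral_distr[OF T]) auto
    also have "\<dots> = (\<integral>x. h (g x) \<partial>(M \<bind> (\<lambda>\<omega>. \<Pi>\<^sub>M k\<in>J. p \<omega>)))"
      by (simp only: joint_law_eq_bind[OF d X J])
    also have "\<dots> = expectation (\<lambda>\<omega>. \<integral>x. h (g x) \<partial>(\<Pi>\<^sub>M k\<in>J. p \<omega>))"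
    proof (rule integral_bind[where K="?N" and B=1 and B'=1])
      show "(\<lambda>\<omega>. \<Pi>\<^sub>M k\<in>J. p \<omega>) \<in> M \<rightarrow>\<^sub>M subprob_algebra ?N" by (rule measurable_prob_algebraD[OF pi])
    qed (use hg hb pr in \<open>auto simp: prob_space.emeasure_space_1 not_empty\<close>)
    finally show ?thesis .
  qed
  have L: "(\<lambda>\<omega>. \<Prod>k\<in>J. f k (X (fst k) (snd k) \<omega>)) = (\<lambda>\<omega>. g (?T \<omega>))"
    unfolding g_def by (intro ext prod.cong) auto
  have iL: "integrable M (\<lambda>\<omega>. g (?T \<omega>))"
    using g1 measurable_compose[OF T g] by (intro integrable_const_bound[where B=1]) auto
  have c: "(\<lambda>\<omega>. \<integral>x. h (g x) \<partial>(\<Pi>\<^sub>M k\<in>J. p \<omega>)) \<in> borel_measurable M"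
    if h: "h \<in> borel_measurable borel" for h :: "complex \<Rightarrow> real"
    using measurable_compose[OF measurable_prob_algebraD[OF pi] integral_measurable_subprob_algebra[of "\<lambda>x. h (g x)" ?N]]
      measurable_compose[OF g h] by simp
  have Re: "(\<integral>x. Re (g x) \<partial>(\<Pi>\<^sub>M k\<in>J. p \<omega>)) = Re (\<integral>x. g x \<partial>(\<Pi>\<^sub>M k\<in>J. p \<omega>))"
    and Im: "(\<integral>x. Im (g x) \<partial>(\<Pi>\<^sub>M k\<in>J. p \<omega>)) = Im (\<integral>x. g x \<partial>(\<Pi>\<^sub>M k\<in>J. p \<omega>))" if "\<omega> \<in> space M" for \<omega>
    using gi[OF that] by (simp_all add: integral_Re integral_Im)
  have iR: "integrable M (\<lambda>\<omega>. \<integral>x. g x \<partial>(\<Pi>\<^sub>M k\<in>J. p \<omega>))"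
  proof (rule integrable_const_bound[where B=1])
    have "(\<lambda>\<omega>. Complex (\<integral>x. Re (g x) \<partial>(\<Pi>\<^sub>M k\<in>J. p \<omega>)) (\<integral>x. Im (g x) \<partial>(\<Pi>\<^sub>M k\<in>J. p \<omega>))) \<in> borel_measurable M"
      using c[of Re] c[of Im] unfolding Complex_eq by simp
    then show "(\<lambda>\<omega>. \<integral>x. g x \<partial>(\<Pi>\<^sub>M k\<in>J. p \<omega>)) \<in> borel_measurable M"
      by (rule measurable_cong[THEN iffD1, rotated]) (simp add: Re Im)
    have "cmod (\<integral>x. g x \<partial>(\<Pi>\<^sub>M k\<in>J. p \<omega>)) \<le> 1" if w: "\<omega> \<in> space M" for \<omega>
    proof -
      interpret P: prob_space "\<Pi>\<^sub>M k\<in>J. p \<omega>" by (rule pr[OF w])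
      have "cmod (\<integral>x. g x \<partial>(\<Pi>\<^sub>M k\<in>J. p \<omega>)) \<le> (\<integral>x. cmod (g x) \<partial>(\<Pi>\<^sub>M k\<in>J. p \<omega>))" by (rule integral_norm_bound)
      also have "\<dots> \<le> (\<integral>x. 1 \<partial>(\<Pi>\<^sub>M k\<in>J. p \<omega>))" using gi[OF w] g1 by (intro integral_mono) auto
      finally show ?thesis by (simp add: P.prob_space)
    qed
    then show "AE \<omega> in M. cmod (\<integral>x. g x \<partial>(\<Pi>\<^sub>M k\<in>J. p \<omega>)) \<le> 1" by auto
  qed
  have "expectation (\<lambda>\<omega>. g (?T \<omega>)) = expectation (\<lambda>\<omega>. \<integral>x. g x \<partial>(\<Pi>\<^sub>M k\<in>J. p \<omega>))"
  proof (rule complex_eqI)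
    have "Re (expectation (\<lambda>\<omega>. g (?T \<omega>))) = expectation (\<lambda>\<omega>. Re (g (?T \<omega>)))"
      by (rule integral_Re[OF iL, symmetric])
    also have "\<dots> = expectation (\<lambda>\<omega>. Re (\<integral>x. g x \<partial>(\<Pi>\<^sub>M k\<in>J. p \<omega>)))"
      by (subst real[of Re]) (auto simp: abs_Re_le_cmod Re intro!: Bochner_Integration.integral_cong)
    finally show "Re (expectation (\<lambda>\<omega>. g (?T \<omega>))) = Re (expectation (\<lambda>\<omega>. \<integral>x. g x \<partial>(\<Pi>\<^sub>M k\<in>J. p \<omega>)))"
      by (simp only: integral_Re[OF iR])
    have "Im (expectation (\<lambda>\<omega>. g (?T \<omega>))) = expectation (\<lambda>\<omega>. Im (g (?T \<omega>)))"
      by (rule integral_Im[OF iL, symmetric])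
    also have "\<dots> = expectation (\<lambda>\<omega>. Im (\<integral>x. g x \<partial>(\<Pi>\<^sub>M k\<in>J. p \<omega>)))"
      by (subst real[of Im]) (auto simp: abs_Im_le_cmod Im intro!: Bochner_Integration.integral_cong)
    finally show "Im (expectation (\<lambda>\<omega>. g (?T \<omega>))) = Im (expectation (\<lambda>\<omega>. \<integral>x. g x \<partial>(\<Pi>\<^sub>M k\<in>J. p \<omega>)))"
      by (simp only: integral_Im[OF iR])
  qed
  also have "\<dots> = expectation (\<lambda>\<omega>. \<Prod>k\<in>J. (\<integral>x. f k x \<partial>p \<omega>))"
    by (intro Bochner_Integration.integral_cong refl inner)
  finally show ?thesis unfolding L .
qed

end

text \<open>
  The conditional characteristic function of a centred row average when the directing measure
  is \<open>P\<close>.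
\<close>

definition centred_char :: "real measure \<Rightarrow> (nat \<Rightarrow> real) \<Rightarrow> (nat \<Rightarrow> real) \<Rightarrow> nat \<Rightarrow> real \<Rightarrow> complex" where
  "centred_char P a b n t = iexp (- (t * (a n / b n))) * char P (t / b n) ^ n"

text \<open>
  Given the directing measure, the entries are independent along rows and across rows, so the
  conditional characteristic function factorises over rows and, in each row, is a power.
\<close>

lemma (in prob_space) integral_row_law:
  assumes d: "directing_random_measure M X p" and X: "\<And>i j. X i j \<in> borel_measurable M"
  shows "(\<integral>s. exp (\<i> * complex_of_real (\<Sum>k<m. t k * s k)) \<partial>row_law M X a b n)
    = expectation (\<lambda>\<omega>. \<Prod>k<m. centred_char (p \<omega>) a b n (t k))"
proof -
  define c where "c = a n / b n"
  have X'[measurable]: "X i j \<in> borel_measurable M" for i j by (rule X)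
  have rm: "(\<lambda>\<omega> i. row_average X b i n \<omega> - c) \<in> M \<rightarrow>\<^sub>M borel"
    by (intro measurable_coordinatewise_then_product) (simp add: row_average_def)
  have em: "(\<lambda>s :: nat \<Rightarrow> real. exp (\<i> * complex_of_real (\<Sum>k<m. t k * s k))) \<in> borel_measurable borel"
    by (intro borel_measurable_continuous_onI continuous_intros continuous_on_product_coordinates)
  have iexp_sum: "iexp (x + (\<Sum>j<n. y j)) = iexp x * (\<Prod>j<n. iexp (y j))" for x and y :: "nat \<Rightarrow> real"
    by (simp add: exp_add distrib_left exp_sum sum_distrib_left)
  have "(\<integral>s. exp (\<i> * complex_of_real (\<Sum>k<m. t k * s k)) \<partial>row_law M X a b n)
      = expectation (\<lambda>\<omega>. exp (\<i> * complex_of_real (\<Sum>k<m. t k * (row_average X b k n \<omega> - c))))"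
    unfolding row_law_def c_def[symmetric] by (rule integral_distr[OF rm em])
  also have "\<dots> = expectation (\<lambda>\<omega>. (\<Prod>k<m. iexp (- (t k * c))) *
      (\<Prod>q\<in>{..<m}\<times>{..<n}. iexp (t (fst q) / b n * X (fst q) (snd q) \<omega>)))"
  proof (intro Bochner_Integration.integral_cong refl)
    fix \<omega>
    have "exp (\<i> * complex_of_real (\<Sum>k<m. t k * (row_average X b k n \<omega> - c)))
        = (\<Prod>k<m. iexp (t k * (row_average X b k n \<omega> - c)))"
      by (simp add: exp_sum[symmetric] sum_distrib_left)
    also have "\<dots> = (\<Prod>k<m. iexp (- (t k * c)) * (\<Prod>j<n. iexp (t k / b n * X k j \<omega>)))"
    proof (intro prod.cong refl)
      fix k
      have "iexp (t k * (row_average X b k n \<omega> - c)) = iexp (- (t k * c) + (\<Sum>j<n. t k / b n * X k j \<omega>))"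
      proof -
        have "t k * (row_average X b k n \<omega> - c) = - (t k * c) + (\<Sum>j<n. t k / b n * X k j \<omega>)"
          by (simp add: row_average_def sum_distrib_left algebra_simps)
        then show ?thesis by (rule arg_cong)
      qed
      also have "\<dots> = iexp (- (t k * c)) * (\<Prod>j<n. iexp (t k / b n * X k j \<omega>))"
        by (rule iexp_sum)
      finally show "iexp (t k * (row_average X b k n \<omega> - c)) = iexp (- (t k * c)) * (\<Prod>j<n. iexp (t k / b n * X k j \<omega>))" .
    qed
    also have "\<dots> = (\<Prod>k<m. iexp (- (t k * c))) * (\<Prod>k<m. \<Prod>j<n. iexp (t k / b n * X k j \<omega>))"
      by (rule prod.distrib)
    also have "(\<Prod>k<m. \<Prod>j<n. iexp (t k / b n * X k j \<omega>)) = (\<Prod>q\<in>{..<m}\<times>{..<n}. iexp (t (fst q) / b n * X (fst q) (snd q) \<omega>))"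
      by (subst prod.cartesian_product) (simp add: split_beta')
    finally show "exp (\<i> * complex_of_real (\<Sum>k<m. t k * (row_average X b k n \<omega> - c)))
      = (\<Prod>k<m. iexp (- (t k * c))) * (\<Prod>q\<in>{..<m}\<times>{..<n}. iexp (t (fst q) / b n * X (fst q) (snd q) \<omega>))" .
  qed
  also have "\<dots> = (\<Prod>k<m. iexp (- (t k * c))) *
      expectation (\<lambda>\<omega>. \<Prod>q\<in>{..<m}\<times>{..<n}. iexp (t (fst q) / b n * X (fst q) (snd q) \<omega>))"
    by (rule integral_mult_right_zero)
  also have "expectation (\<lambda>\<omega>. \<Prod>q\<in>{..<m}\<times>{..<n}. iexp (t (fst q) / b n * X (fst q) (snd q) \<omega>))
      = expectation (\<lambda>\<omega>. \<Prod>q\<in>{..<m}\<times>{..<n}. (\<integral>x. iexp (t (fst q) / b n * x) \<partial>p \<omega>))"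
    by (rule expectation_prod_of_directing[OF d X]) (auto simp del: of_real_mult of_real_divide)
  also have "\<dots> = expectation (\<lambda>\<omega>. \<Prod>k<m. char (p \<omega>) (t k / b n) ^ n)"
  proof (intro Bochner_Integration.integral_cong refl)
    fix \<omega>
    have "(\<Prod>q\<in>{..<m}\<times>{..<n}. (\<integral>x. iexp (t (fst q) / b n * x) \<partial>p \<omega>)) = (\<Prod>k<m. \<Prod>j<n. char (p \<omega>) (t k / b n))"
      unfolding char_def by (subst prod.cartesian_product) (simp add: split_beta')
    then show "(\<Prod>q\<in>{..<m}\<times>{..<n}. (\<integral>x. iexp (t (fst q) / b n * x) \<partial>p \<omega>)) = (\<Prod>k<m. char (p \<omega>) (t k / b n) ^ n)"
      by simp
  qed
  also have "(\<Prod>k<m. iexp (- (t k * c))) * expectation (\<lambda>\<omega>. \<Prod>k<m. char (p \<omega>) (t k / b n) ^ n)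
      = expectation (\<lambda>\<omega>. (\<Prod>k<m. iexp (- (t k * c))) * (\<Prod>k<m. char (p \<omega>) (t k / b n) ^ n))"
    by (rule integral_mult_right_zero[symmetric])
  finally show ?thesis
    unfolding centred_char_def c_def[symmetric] prod.distrib .
qed

section \<open>Laplace transforms of laws on the compact half-line\<close>

text \<open>
  The value 0 at infinity makes this function continuous on the compact half-line, so that weak
  convergence there can be tested with it.
\<close>

definition exp_neg :: "real \<Rightarrow> ennreal \<Rightarrow> real" where
  "exp_neg s v = (if v = \<infinity> then 0 else exp (- (s * enn2real v)))"

definition laplace :: "ennreal measure \<Rightarrow> real \<Rightarrow> real" where
  "laplace \<pi> s = (LINT v:{v. v < \<infinity>}|\<pi>. exp (- (s * enn2real v)))"

lemma exp_neg_ennreal: "0 \<le> x \<Longrightarrow> exp_neg s (ennreal x) = exp (- (s * x))"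
  by (simp add: exp_neg_def)

lemma exp_neg_01:
  assumes "0 \<le> s"
  shows "exp_neg s v \<in> {0..1}"
  using assms by (auto simp: exp_neg_def)

lemma exp_neg_power: "0 < k \<Longrightarrow> exp_neg s v ^ k = exp_neg (real k * s) v"
  by (auto simp: exp_neg_def exp_of_nat_mult[symmetric] mult_ac)

text \<open>
  At infinity, \<open>exp (- s v)\<close> falls below any \<open>e > 0\<close> on a neighbourhood.
\<close>

lemma continuous_exp_neg:
  assumes s: "s > 0"
  shows "continuous_on UNIV (exp_neg s)"
proof -
  have "(exp_neg s \<longlongrightarrow> exp_neg s v) (at v)" for v
  proof (cases "v = \<infinity>")
    case True
    show ?thesis
    proof (rule tendstoI)
      fix e :: real assume "e > 0"
      define r where "r = max 0 (- ln e / s) + 1"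
      have r: "0 \<le> r" "exp (- (s * r)) < e"
      proof -
        show "0 \<le> r" by (simp add: r_def)
        have "- ln e / s < r" by (simp add: r_def)
        then have "- (s * r) < ln e" using s by (simp add: field_simps)
        then have "exp (- (s * r)) < exp (ln e)" by simp
        then show "exp (- (s * r)) < e" using \<open>e > 0\<close> by simp
      qed
      have "\<forall>\<^sub>F x in at v. ennreal r < x"
        using True by (intro order_tendstoD(1)[OF tendsto_ident_at]) (simp add: ennreal_less_top)
      then show "\<forall>\<^sub>F x in at v. dist (exp_neg s x) (exp_neg s v) < e"
      proof (rule eventually_mono)
        fix x assume x: "ennreal r < x"
        show "dist (exp_neg s x) (exp_neg s v) < e"
        proof (cases x)
          case (real y)
          then have "r < y" using x r by (simp add: ennreal_less_iff)
          then have "exp (- (s * y)) \<le> exp (- (s * r))" using s by simp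
          from le_less_trans[OF this r(2)] show ?thesis using real True by (simp add: exp_neg_def)
        qed (use \<open>e > 0\<close> True in \<open>simp add: exp_neg_def\<close>)
      qed
    qed
  next
    case False
    then obtain y where y: "v = ennreal y" "0 \<le> y" by (cases v) auto
    have "((\<lambda>x. exp (- (s * enn2real x))) \<longlongrightarrow> exp (- (s * y))) (at v)"
      using y by (intro tendsto_intros tendsto_enn2real) auto
    moreover have "\<forall>\<^sub>F x in at v. exp_neg s x = exp (- (s * enn2real x))"
    proof -
      have "\<forall>\<^sub>F x in at v. x < \<infinity>"
        using False by (intro order_tendstoD(2)[OF tendsto_ident_at]) (simp add: less_top)
      then show ?thesis by (rule eventually_mono) (auto simp: exp_neg_def)
    qed
    ultimately have "(exp_neg s \<longlongrightarrow> exp (- (s * y))) (at v)" by (simp add: tendsto_cong)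
    then show ?thesis using y by (simp add: exp_neg_ennreal)
  qed
  then show ?thesis by (simp add: continuous_on_eq_continuous_at isCont_def)
qed

lemma borel_measurable_exp_neg [measurable]: "exp_neg s \<in> borel_measurable borel"
  unfolding exp_neg_def[abs_def] by measurable

text \<open>
  Inverse of \<open>exp_neg 1\<close>; together they identify the compact half-line with \<open>[0,1]\<close>.
\<close>

definition neg_ln :: "real \<Rightarrow> ennreal" where
  "neg_ln y = (if y \<le> 0 then \<infinity> else ennreal (- ln y))"

lemma neg_ln_exp_neg: "neg_ln (exp_neg 1 v) = v"
  by (cases v) (auto simp: neg_ln_def exp_neg_def)

lemma continuous_neg_ln: "continuous_on {0..1} neg_ln"
proof (unfold continuous_on_def, intro ballI)
  fix y :: real assume y: "y \<in> {0..1}"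
  show "(neg_ln \<longlongrightarrow> neg_ln y) (at y within {0..1})"
  proof (cases "y = 0")
    case True
    have "\<forall>\<^sub>F x in at y within {0..1}. l < neg_ln x" if l: "l < \<infinity>" for l
    proof -
      obtain r where r: "l = ennreal r" "0 \<le> r" using l unfolding infinity_ennreal_def less_top_ennreal by blast
      have "\<forall>\<^sub>F x in at y within {0..1}. x < exp (- r)"
        using True by (intro order_tendstoD(2)[OF tendsto_ident_at]) simp
      then show ?thesis
      proof (rule eventually_mono)
        fix x assume x: "x < exp (- r)"
        show "l < neg_ln x"
        proof (cases "x \<le> 0")
          case False
          then have "ln x < - r" using x by (metis ln_exp ln_less_cancel_iff not_le exp_gt_zero)
          then show ?thesis using r False by (simp add: neg_ln_def ennreal_less_iff)
        qed (use l in \<open>simp add: neg_ln_def\<close>)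
      qed
    qed
    then have "(neg_ln \<longlongrightarrow> \<infinity>) (at y within {0..1})"
      by (intro order_tendstoI) auto
    then show ?thesis using True by (simp add: neg_ln_def)
  next
    case False
    then have y0: "0 < y" using y by simp
    have "((\<lambda>x. ennreal (- ln x)) \<longlongrightarrow> ennreal (- ln y)) (at y within {0..1})"
      using y0 by (intro tendsto_intros) auto
    moreover have "\<forall>\<^sub>F x in at y within {0..1}. neg_ln x = ennreal (- ln x)"
    proof -
      have "\<forall>\<^sub>F x in at y within {0..1}. 0 < x"
        using y0 by (intro order_tendstoD(1)[OF tendsto_ident_at])
      then show ?thesis by (rule eventually_mono) (auto simp: neg_ln_def)
    qed
    ultimately have "(neg_ln \<longlongrightarrow> ennreal (- ln y)) (at y within {0..1})" by (simp add: tendsto_cong)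
    then show ?thesis using y0 by (simp add: neg_ln_def)
  qed
qed

locale variance_law = N: prob_space \<pi> for \<pi> :: "ennreal measure" +
  assumes sets_eq [simp, measurable_cong]: "sets \<pi> = sets borel"
begin

lemma space_eq [simp]: "space \<pi> = UNIV"
  using sets_eq_imp_space_eq[OF sets_eq] by simp

lemma integrable_exp_neg: "0 \<le> s \<Longrightarrow> integrable \<pi> (exp_neg s)"
  using exp_neg_01[of s] by (intro N.integrable_const_bound[where B=1]) auto

lemma laplace_eq: "laplace \<pi> s = (\<integral>v. exp_neg s v \<partial>\<pi>)"
  unfolding laplace_def set_lebesgue_integral_def
  by (intro Bochner_Integration.integral_cong) (auto simp: exp_neg_def less_top indicator_def)

lemma laplace_0: "laplace \<pi> 0 = measure \<pi> {v. v < \<infinity>}"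
  unfolding laplace_def set_lebesgue_integral_def by simp

text \<open>
  The exponents add up: the mixture depends on the frequencies only through their sum and
  their sum of squares.
\<close>

lemma mixture_eq_laplace:
  fixes m :: nat and t :: "nat \<Rightarrow> real"
  shows
  "(LINT v:{v. v < \<infinity>}|\<pi>. (\<Prod>k<m. exp (\<i> * complex_of_real (t k * \<gamma>) - complex_of_real ((t k)\<^sup>2 * enn2real v / 2))))
    = iexp (\<gamma> * (\<Sum>k<m. t k)) * complex_of_real (laplace \<pi> ((\<Sum>k<m. (t k)\<^sup>2) / 2))"
proof -
  have "(\<Prod>k<m. exp (\<i> * complex_of_real (t k * \<gamma>) - complex_of_real ((t k)\<^sup>2 * enn2real v / 2)))
      = iexp (\<gamma> * (\<Sum>k<m. t k)) * complex_of_real (exp (- ((\<Sum>k<m. (t k)\<^sup>2) / 2 * enn2real v)))" for v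
  proof -
    have "(\<Prod>k<m. exp (\<i> * complex_of_real (t k * \<gamma>) - complex_of_real ((t k)\<^sup>2 * enn2real v / 2)))
        = exp (\<Sum>k<m. \<i> * complex_of_real (t k * \<gamma>) - complex_of_real ((t k)\<^sup>2 * enn2real v / 2))"
      by (rule exp_sum[symmetric]) simp
    also have "(\<Sum>k<m. \<i> * complex_of_real (t k * \<gamma>) - complex_of_real ((t k)\<^sup>2 * enn2real v / 2))
        = \<i> * complex_of_real (\<gamma> * (\<Sum>k<m. t k)) + complex_of_real (- ((\<Sum>k<m. (t k)\<^sup>2) / 2 * enn2real v))"
      by (simp add: sum_subtractf sum_distrib_left sum_distrib_right sum_divide_distrib mult_ac)
    finally show ?thesis by (simp only: exp_add exp_of_real)
  qed
  then show ?thesis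
    unfolding laplace_def set_lebesgue_integral_def
    by (simp add: scaleR_conv_of_real mult.left_commute[of "complex_of_real (indicator _ _)"]
      del: of_real_mult flip: of_real_mult integral_complex_of_real)
qed

text \<open>
  Continuity of the Laplace transform at 0, by dominated convergence.  This fails if there is mass at
  infinity.
\<close>

lemma laplace_tendsto_0:
  assumes f: "measure \<pi> {v. v < \<infinity>} = 1" and "e > 0"
  obtains s where "s > 0" "1 - e < laplace \<pi> s"
proof -
  have "(\<lambda>n. \<integral>v. exp_neg (1 / real (Suc n)) v \<partial>\<pi>) \<longlonglongrightarrow> (\<integral>v. indicator {v. v < \<infinity>} v \<partial>\<pi>)"
  proof (rule integral_dominated_convergence[where w="\<lambda>_. 1"])
    show "AE v in \<pi>. (\<lambda>n. exp_neg (1 / real (Suc n)) v) \<longlonglongrightarrow> indicator {v. v < \<infinity>} v"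
    proof (rule AE_I2)
      fix v
      have lim: "(\<lambda>n. exp (- (1 / real (Suc n) * enn2real v))) \<longlonglongrightarrow> exp (- (0 * enn2real v))"
        by (intro tendsto_intros LIMSEQ_Suc lim_1_over_n)
      show "(\<lambda>n. exp_neg (1 / real (Suc n)) v) \<longlonglongrightarrow> indicator {v. v < \<infinity>} v"
      proof (cases "v = \<infinity>")
        case True
        then have "exp_neg r v = 0" for r by (simp add: exp_neg_def)
        then show ?thesis using True by simp
      next
        case False
        then have "exp_neg r v = exp (- (r * enn2real v))" for r by (simp add: exp_neg_def)
        moreover have "indicator {v. v < \<infinity>} v = (1 :: real)" using False by (simp add: less_top)
        ultimately show ?thesis using lim by simp
      qed
    qed
    show "AE v in \<pi>. norm (exp_neg (1 / real (Suc n)) v) \<le> 1" for n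
      using exp_neg_01[of "1 / real (Suc n)"] by auto
  qed auto
  then have "(\<lambda>n. laplace \<pi> (1 / real (Suc n))) \<longlonglongrightarrow> 1"
    using f by (simp add: laplace_eq)
  from order_tendstoD(1)[OF this, of "1 - e"] \<open>e > 0\<close>
  obtain n where "1 - e < laplace \<pi> (1 / real (Suc n))" by (auto simp: eventually_sequentially)
  then show ?thesis by (intro that[of "1 / real (Suc n)"]) auto
qed

lemma return_0_iff: "\<pi> = return borel 0 \<longleftrightarrow> (AE v in \<pi>. v = 0)"
proof
  assume e: "\<pi> = return borel 0"
  show "AE v in \<pi>. v = 0" by (subst e, subst AE_return) auto
next
  assume ae: "AE v in \<pi>. v = 0"
  show "\<pi> = return borel 0"
  proof (rule measure_eqI)
    fix A assume "A \<in> sets \<pi>"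
    then have A: "A \<in> sets borel" by simp
    have "emeasure \<pi> A = (\<integral>\<^sup>+ v. indicator A v \<partial>\<pi>)" using A by simp
    also have "\<dots> = (\<integral>\<^sup>+ v. indicator A 0 \<partial>\<pi>)"
      using ae by (intro nn_integral_cong_AE) auto
    also have "\<dots> = indicator A 0" using N.emeasure_space_1 by (simp add: mult.commute)
    finally show "emeasure \<pi> A = emeasure (return borel 0) A" using A by simp
  qed simp
qed

text \<open>
  Equality at two points would force \<open>exp (- s v) = exp (- s' v)\<close>, hence \<open>v = 0\<close>, almost surely.
\<close>

lemma laplace_strict_antimono:
  assumes nz: "\<pi> \<noteq> return borel 0" and f: "measure \<pi> {v. v < \<infinity>} = 1" and s: "0 \<le> s" "s < s'"
  shows "laplace \<pi> s' < laplace \<pi> s"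
proof (rule ccontr)
  assume "\<not> laplace \<pi> s' < laplace \<pi> s"
  moreover have le: "exp_neg s' v \<le> exp_neg s v" for v
    using s by (auto simp: exp_neg_def intro!: mult_right_mono)
  ultimately have "(\<integral>v. exp_neg s v - exp_neg s' v \<partial>\<pi>) \<le> 0"
    using integrable_exp_neg[of s] integrable_exp_neg[of s'] s by (simp add: laplace_eq)
  moreover have "0 \<le> (\<integral>v. exp_neg s v - exp_neg s' v \<partial>\<pi>)" using le by (intro Bochner_Integration.integral_nonneg) simp
  ultimately have "(\<integral>v. exp_neg s v - exp_neg s' v \<partial>\<pi>) = 0" by simp
  then have "AE v in \<pi>. exp_neg s v - exp_neg s' v = 0"
    using integrable_exp_neg[of s] integrable_exp_neg[of s'] s le
    by (subst (asm) integral_nonneg_eq_0_iff_AE) auto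
  moreover have "AE v in \<pi>. v < \<infinity>"
    using N.AE_prob_1[OF f] by simp
  ultimately have "AE v in \<pi>. v = 0"
  proof eventually_elim
    case (elim v)
    then obtain x where "v = ennreal x" "0 \<le> x" by (cases v) auto
    then show ?case using elim s by (simp add: exp_neg_ennreal)
  qed
  then show False using nz return_0_iff by simp
qed

end

text \<open>
  The integrand may depend on the parameter: integrate it over the image of the kernel under
  \<open>y \<mapsto> (x, y)\<close>.
\<close>

lemma integral_measurable_kernel:
  fixes f :: "'x \<Rightarrow> 'y \<Rightarrow> 'c::{banach, second_countable_topology}"
  assumes f[measurable]: "(\<lambda>(x, y). f x y) \<in> borel_measurable (A \<Otimes>\<^sub>M B)"
    and L[measurable]: "L \<in> A \<rightarrow>\<^sub>M subprob_algebra B"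
  shows "(\<lambda>x. \<integral>y. f x y \<partial>L x) \<in> borel_measurable A"
proof -
  note measurable_distr2[measurable] integral_measurable_subprob_algebra[measurable]
  have "(\<lambda>x. integral\<^sup>L (distr (L x) (A \<Otimes>\<^sub>M B) (\<lambda>y. (x, y))) (\<lambda>(x, y). f x y)) \<in> borel_measurable A"
    by measurable
  then show ?thesis
    by (rule measurable_cong[THEN iffD1, rotated]) (simp add: integral_distr)
qed

section \<open>A random measure seen at the scale of the normalisation\<close>

text \<open>
  The setting without the array: only the random measure and the normalisation enter, since the
  joint law of the row sums is determined by the law of the random measure.
\<close>

locale scaled_random_measure = prob_space M for M :: "'a measure" +
  fixes p :: "'a \<Rightarrow> real measure" and b :: "nat \<Rightarrow> real"
  assumes p_meas: "p \<in> M \<rightarrow>\<^sub>M prob_algebra borel"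
    and b_pos: "\<And>n. n \<ge> 1 \<Longrightarrow> b n > 0"
    and b_top: "filterlim b at_top sequentially"
begin

text \<open>
  The squared modulus of the conditional characteristic function of a row sum.  The modulus does
  not depend on the centring constants.
\<close>

definition sq_char :: "nat \<Rightarrow> real \<Rightarrow> 'a \<Rightarrow> real" where
  "sq_char n t \<omega> = cmod (char (p \<omega>) (t / b n)) ^ (2 * n)"

abbreviation tvar :: "real \<Rightarrow> nat \<Rightarrow> 'a \<Rightarrow> real" where
  "tvar \<tau> n \<omega> \<equiv> trunc_var (p \<omega>) b \<tau> n"

abbreviation tmean :: "real \<Rightarrow> nat \<Rightarrow> 'a \<Rightarrow> real" where
  "tmean \<tau> n \<omega> \<equiv> trunc_mean (p \<omega>) b \<tau> n"

lemma p_real_distribution: "\<omega> \<in> space M \<Longrightarrow> real_distribution (p \<omega>)"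
proof -
  assume "\<omega> \<in> space M"
  then have p: "prob_space (p \<omega>)" "sets (p \<omega>) = sets borel"
    using measurable_space[OF p_meas] by (auto simp: space_prob_algebra)
  then show ?thesis
    unfolding real_distribution_def real_distribution_axioms_def by simp
qed

lemma p_sub [measurable]: "p \<in> M \<rightarrow>\<^sub>M subprob_algebra borel"
  by (rule measurable_prob_algebraD[OF p_meas])

lemma measurable_integral_p:
  fixes f :: "real \<Rightarrow> 'c::{banach, second_countable_topology}"
  assumes "f \<in> borel_measurable borel"
  shows "(\<lambda>\<omega>. \<integral>x. f x \<partial>p \<omega>) \<in> borel_measurable M"
  using measurable_compose[OF p_sub integral_measurable_subprob_algebra[OF assms]] .

lemma measurable_measure_p:
  assumes "B \<in> sets borel"
  shows "(\<lambda>\<omega>. measure (p \<omega>) B) \<in> borel_measurable M"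
  using measurable_compose[OF p_sub measurable_measure_subprob_algebra[OF assms]] .

lemma measurable_tmean [measurable]: "tmean \<tau> n \<in> borel_measurable M"
  unfolding trunc_mean_def set_lebesgue_integral_def
  by (intro borel_measurable_times borel_measurable_const measurable_integral_p) measurable

lemma measurable_tvar [measurable]: "tvar \<tau> n \<in> borel_measurable M"
  unfolding trunc_var_def set_lebesgue_integral_def
  by (intro borel_measurable_times borel_measurable_const borel_measurable_diff borel_measurable_power
      measurable_integral_p) measurable

lemma measurable_exceedance_p [measurable]: "(\<lambda>\<omega>. exceedance (p \<omega>) b \<epsilon> n) \<in> borel_measurable M"
  unfolding exceedance_def
  by (intro borel_measurable_times borel_measurable_const measurable_measure_p) measurable

lemma measurable_levy_jump [measurable]:
  "(\<lambda>\<omega>. levy_fun (p \<omega>) b n (- \<epsilon>) - levy_fun (p \<omega>) b n \<epsilon>) \<in> borel_measurable M"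
  unfolding levy_fun_def cdf_def
  by (intro borel_measurable_diff borel_measurable_times borel_measurable_const measurable_measure_p) measurable

lemma measurable_char [measurable]: "(\<lambda>\<omega>. char (p \<omega>) t) \<in> borel_measurable M"
  unfolding char_def by (intro measurable_integral_p) measurable

text \<open>
  Joint measurability in frequency and sample point, for Fubini's theorem over frequencies.
\<close>

lemma measurable_char_pair:
  "(\<lambda>z. char (p (snd z)) (fst z * r)) \<in> borel_measurable (borel \<Otimes>\<^sub>M M)"
  unfolding char_def
  by (rule integral_measurable_kernel[where B=borel and f="\<lambda>z x. iexp (fst z * r * x)"]) measurable

lemma measurable_sq_char [measurable]: "sq_char n t \<in> borel_measurable M"
  unfolding sq_char_def[abs_def] by measurable

lemma measurable_centred_char [measurable]: "(\<lambda>\<omega>. centred_char (p \<omega>) a b n t) \<in> borel_measurable M"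
  unfolding centred_char_def by measurable

lemma sq_char_01: "\<omega> \<in> space M \<Longrightarrow> sq_char n t \<omega> \<in> {0..1}"
  using real_distribution.cmod_char_le_1[OF p_real_distribution, of \<omega> "t / b n"]
  by (auto simp: sq_char_def power_le_one)

lemma norm_centred_char_le: "\<omega> \<in> space M \<Longrightarrow> cmod (centred_char (p \<omega>) a b n t) \<le> 1"
  using real_distribution.cmod_char_le_1[OF p_real_distribution, of \<omega> "t / b n"]
  by (auto simp: centred_char_def norm_mult norm_power power_le_one)

text \<open>
  Frequencies \<open>t\<close> and \<open>- t\<close> in two different rows turn a product of characteristic functions into
  a squared modulus.
\<close>

lemma centred_char_mult_minus:
  assumes "\<omega> \<in> space M"
  shows "centred_char (p \<omega>) a b n t * centred_char (p \<omega>) a b n (- t) = complex_of_real (sq_char n t \<omega>)"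
proof -
  have c: "char (p \<omega>) (- u) = cnj (char (p \<omega>) u)" for u
  proof -
    have "cnj (char (p \<omega>) u) = (CLINT x|p \<omega>. cnj (iexp (u * x)))"
      unfolding char_def by (rule Bochner_Integration.integral_cnj[symmetric])
    then show ?thesis by (simp add: char_def exp_cnj)
  qed
  have "centred_char (p \<omega>) a b n t * centred_char (p \<omega>) a b n (- t)
      = (iexp (- (t * (a n / b n))) * iexp (t * (a n / b n))) * (char (p \<omega>) (t / b n) * char (p \<omega>) (- (t / b n))) ^ n"
    by (simp add: centred_char_def power_mult_distrib mult_ac)
  also have "\<dots> = (char (p \<omega>) (t / b n) * cnj (char (p \<omega>) (t / b n))) ^ n"
    unfolding c by (simp add: exp_add[symmetric])
  also have "\<dots> = complex_of_real (sq_char n t \<omega>)"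
    by (simp add: complex_norm_square[symmetric] sq_char_def power_mult)
  finally show ?thesis .
qed

lemma eventually_b_pos: "\<forall>\<^sub>F n in sequentially. 1 \<le> n \<and> 0 < b n"
  using eventually_ge_at_top[of 1] by eventually_elim (simp add: b_pos)

text \<open>
  Convergence in law to a constant is convergence in probability, and the Levy jumps at \<open>\<epsilon>\<close> are
  squeezed between the exceedances at neighbouring levels.
\<close>

lemma tails_iff:
  "(\<forall>\<epsilon>>0. weakly_converges (tail_law M p b \<epsilon>) (return borel 0)) \<longleftrightarrow>
   (\<forall>\<epsilon>>0. vanishes_in_prob M (\<lambda>n \<omega>. exceedance (p \<omega>) b \<epsilon> n))"
proof -
  define J where "J \<epsilon> n \<omega> = levy_fun (p \<omega>) b n (- \<epsilon>) - levy_fun (p \<omega>) b n \<epsilon>" for \<epsilon> n \<omega>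
  have Jm[measurable]: "J \<epsilon> n \<in> borel_measurable M" for \<epsilon> n unfolding J_def by measurable
  have J0: "0 \<le> J \<epsilon> n \<omega>" if "\<epsilon> > 0" "\<omega> \<in> space M" for \<epsilon> n \<omega>
    unfolding J_def by (rule real_distribution.levy_jump_nonneg[OF p_real_distribution[OF that(2)] that(1)])
  have Jconv: "weakly_converges (tail_law M p b \<epsilon>) (return borel 0) \<longleftrightarrow>
      (\<forall>f :: real \<Rightarrow> real. continuous_on UNIV f \<longrightarrow> bounded (range f) \<longrightarrow> (\<lambda>n. expectation (\<lambda>\<omega>. f (J \<epsilon> n \<omega>))) \<longlonglongrightarrow> f 0)"
    for \<epsilon>
  proof -
    have e1: "(\<integral>x. f x \<partial>tail_law M p b \<epsilon> n) = expectation (\<lambda>\<omega>. f (J \<epsilon> n \<omega>))"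
      if "continuous_on UNIV f" for f :: "real \<Rightarrow> real" and n
      unfolding tail_law_def J_def[symmetric]
      by (rule integral_distr[OF Jm borel_measurable_continuous_onI[OF that]])
    have e2: "(\<integral>x. f x \<partial>return borel 0) = f 0" if "continuous_on UNIV f" for f :: "real \<Rightarrow> real"
      by (rule integral_return) (use borel_measurable_continuous_onI[OF that] in auto)
    show ?thesis unfolding weakly_converges_def by (simp add: e1 e2 cong: imp_cong)
  qed
  show ?thesis
  proof (intro iffI allI impI)
    fix \<epsilon> :: real assume L: "\<forall>\<epsilon>>0. weakly_converges (tail_law M p b \<epsilon>) (return borel 0)" and "\<epsilon> > 0"
    let ?f = "\<lambda>x. min \<bar>x\<bar> 1 :: real"
    have bf: "bounded (range ?f)" by (intro boundedI[where B=1]) auto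
    have cf: "continuous_on UNIV ?f" by (intro continuous_intros)
    have half: "\<epsilon> / 2 > 0" using \<open>\<epsilon> > 0\<close> by simp
    have "(\<lambda>n. expectation (\<lambda>\<omega>. ?f (J (\<epsilon>/2) n \<omega>))) \<longlonglongrightarrow> ?f 0"
      using iffD1[OF Jconv L[rule_format, OF half], rule_format, OF cf bf] .
    then have "(\<lambda>n. expectation (\<lambda>\<omega>. ?f (J (\<epsilon>/2) n \<omega>))) \<longlonglongrightarrow> 0" by simp
    then have v: "vanishes_in_prob M (\<lambda>n \<omega>. ?f (J (\<epsilon>/2) n \<omega>))"
      by (intro vanishes_in_prob_of_expectation integrable_const_bound[where B=1]) auto
    show "vanishes_in_prob M (\<lambda>n \<omega>. exceedance (p \<omega>) b \<epsilon> n)"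
      unfolding vanishes_in_prob_def
    proof (intro allI impI)
      fix \<kappa> \<eta> :: real assume k: "\<kappa> > 0" "\<eta> > 0"
      have "holds_up_to M \<eta> (\<lambda>n \<omega>. \<bar>?f (J (\<epsilon>/2) n \<omega>)\<bar> \<le> min \<kappa> (1/2))"
        using k by (intro vanishes_in_probD[OF v]) auto
      then show "holds_up_to M \<eta> (\<lambda>n \<omega>. \<bar>exceedance (p \<omega>) b \<epsilon> n\<bar> \<le> \<kappa>)"
      proof (rule holds_up_to_mono)
        show "\<forall>\<^sub>F n in sequentially. \<forall>\<omega>\<in>space M. \<bar>?f (J (\<epsilon>/2) n \<omega>)\<bar> \<le> min \<kappa> (1/2) \<longrightarrow> \<bar>exceedance (p \<omega>) b \<epsilon> n\<bar> \<le> \<kappa>"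
          using eventually_b_pos
        proof (rule eventually_mono, intro ballI impI)
          fix n \<omega> assume n: "1 \<le> n \<and> 0 < b n" and w: "\<omega> \<in> space M" and le: "\<bar>?f (J (\<epsilon>/2) n \<omega>)\<bar> \<le> min \<kappa> (1/2)"
          interpret P: real_distribution "p \<omega>" by (rule p_real_distribution[OF w])
          have "exceedance (p \<omega>) b \<epsilon> n \<le> J (\<epsilon>/2) n \<omega>"
            unfolding J_def using \<open>\<epsilon> > 0\<close> n by (intro P.exceedance_le_levy_jump) auto
          moreover have "J (\<epsilon>/2) n \<omega> \<le> \<kappa>" using le J0[of "\<epsilon>/2" \<omega> n] \<open>\<epsilon> > 0\<close> w by (auto simp: min_def split: if_splits)
          ultimately show "\<bar>exceedance (p \<omega>) b \<epsilon> n\<bar> \<le> \<kappa>" using exceedance_nonneg[of "p \<omega>" b \<epsilon> n] by linarith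
        qed
      qed
    qed
  next
    fix \<epsilon> :: real assume V: "\<forall>\<epsilon>>0. vanishes_in_prob M (\<lambda>n \<omega>. exceedance (p \<omega>) b \<epsilon> n)" and e: "\<epsilon> > 0"
    have v: "vanishes_in_prob M (J \<epsilon>)"
    proof (rule vanishes_in_prob_le[OF V[rule_format, OF e]])
      show "\<forall>\<^sub>F n in sequentially. \<forall>\<omega>\<in>space M. \<bar>J \<epsilon> n \<omega>\<bar> \<le> \<bar>exceedance (p \<omega>) b \<epsilon> n\<bar>"
        using eventually_b_pos
      proof (rule eventually_mono, intro ballI)
        fix n \<omega> assume n: "1 \<le> n \<and> 0 < b n" and w: "\<omega> \<in> space M"
        interpret P: real_distribution "p \<omega>" by (rule p_real_distribution[OF w])
        show "\<bar>J \<epsilon> n \<omega>\<bar> \<le> \<bar>exceedance (p \<omega>) b \<epsilon> n\<bar>"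
          using P.levy_jump_le_exceedance[of \<epsilon> b n] e n J0[OF e w, of n] by (simp add: J_def)
      qed
    qed
    show "weakly_converges (tail_law M p b \<epsilon>) (return borel 0)"
      unfolding Jconv
    proof (intro allI impI)
      fix f :: "real \<Rightarrow> real" assume f: "continuous_on UNIV f" "bounded (range f)"
      note [measurable] = borel_measurable_continuous_onI[OF f(1)]
      obtain B where B: "\<And>x. \<bar>f x\<bar> \<le> B" using f(2) unfolding bounded_iff by auto
      have "(\<lambda>n. expectation (\<lambda>\<omega>. f (J \<epsilon> n \<omega>) - f 0)) \<longlonglongrightarrow> 0"
      proof (rule expectation_tendsto_zero[where B="2 * B"])
        show "norm (f (J \<epsilon> n \<omega>) - f 0) \<le> 2 * B" for n \<omega>
          using B[of "J \<epsilon> n \<omega>"] B[of 0] unfolding real_norm_def by linarith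
        show "vanishes_in_prob M (\<lambda>n \<omega>. norm (f (J \<epsilon> n \<omega>) - f 0))"
          unfolding vanishes_in_prob_def
        proof (intro allI impI)
          fix \<kappa> \<eta> :: real assume k: "\<kappa> > 0" "\<eta> > 0"
          have "isCont f 0" using f(1) by (simp add: continuous_on_eq_continuous_at)
          then obtain d where d: "d > 0" "\<And>x. \<bar>x\<bar> < d \<Longrightarrow> \<bar>f x - f 0\<bar> < \<kappa>"
            using k(1) unfolding continuous_at_eps_delta dist_real_def by auto
          have "holds_up_to M \<eta> (\<lambda>n \<omega>. \<bar>J \<epsilon> n \<omega>\<bar> \<le> d / 2)"
            using d k by (intro vanishes_in_probD[OF v]) auto
          then show "holds_up_to M \<eta> (\<lambda>n \<omega>. \<bar>norm (f (J \<epsilon> n \<omega>) - f 0)\<bar> \<le> \<kappa>)"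
          proof (rule holds_up_to_mono, intro always_eventually allI ballI impI)
            fix n \<omega> assume "\<bar>J \<epsilon> n \<omega>\<bar> \<le> d / 2"
            then have "\<bar>J \<epsilon> n \<omega>\<bar> < d" using d(1) by linarith
            from d(2)[OF this] show "\<bar>norm (f (J \<epsilon> n \<omega>) - f 0)\<bar> \<le> \<kappa>" by simp
          qed
        qed
      qed measurable
      moreover have "expectation (\<lambda>\<omega>. f (J \<epsilon> n \<omega>) - f 0) = expectation (\<lambda>\<omega>. f (J \<epsilon> n \<omega>)) - f 0" for n
        using B by (subst Bochner_Integration.integral_diff)
          (auto simp: prob_space intro!: integrable_const_bound[where B=B])
      ultimately have "(\<lambda>n. expectation (\<lambda>\<omega>. f (J \<epsilon> n \<omega>)) - f 0) \<longlonglongrightarrow> 0" by simp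
      then show "(\<lambda>n. expectation (\<lambda>\<omega>. f (J \<epsilon> n \<omega>))) \<longlonglongrightarrow> f 0" by (simp add: LIM_zero_iff)
    qed
  qed
qed

text \<open>
  In \<open>char_power_normal_approx\<close>, first bound the variance by a constant \<open>K\<close> with large probability,
  then choose \<open>\<epsilon>\<close> to make the term \<open>2 \<epsilon> K\<close> small, and only then let the exceedances at this \<open>\<epsilon>\<close>
  and \<open>1 / n\<close> tend to 0.
\<close>

lemma uniform_normal_approx:
  assumes tails: "\<And>\<epsilon>. \<epsilon> > 0 \<Longrightarrow> vanishes_in_prob M (\<lambda>n \<omega>. exceedance (p \<omega>) b \<epsilon> n)"
    and tight: "bounded_in_prob M (tvar \<tau>)" and "\<tau> > 0" "T \<ge> 0" "\<kappa> > 0" "\<eta> > 0"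
  shows "holds_up_to M \<eta> (\<lambda>n \<omega>. \<forall>t. \<bar>t\<bar> \<le> T \<longrightarrow>
    cmod (char (p \<omega>) (t / b n) ^ n - iexp (t * tmean \<tau> n \<omega>) * exp (- (t\<^sup>2 * tvar \<tau> n \<omega> / 2))) \<le> \<kappa>)"
proof -
  from tight \<open>\<eta> > 0\<close> obtain K where K: "K > 0" "holds_up_to M (\<eta> / 2) (\<lambda>n \<omega>. \<bar>tvar \<tau> n \<omega>\<bar> \<le> K)"
    unfolding bounded_in_prob_def by (meson half_gt_zero)
  \<comment> \<open>chosen so that the third-moment term with variance at most \<open>K\<close> contributes at most \<open>\<kappa> / 6\<close>\<close>
  define \<epsilon> where "\<epsilon> = min \<tau> (\<kappa> / (2 * (T ^ 3 * K + 1)))"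
  have TK: "0 \<le> T ^ 3 * K" using \<open>T \<ge> 0\<close> K by simp
  have \<epsilon>: "0 < \<epsilon>" "\<epsilon> \<le> \<tau>" using \<open>\<tau> > 0\<close> \<open>\<kappa> > 0\<close> TK by (auto simp: \<epsilon>_def intro!: divide_pos_pos add_nonneg_pos)
  have eps: "T ^ 3 / 6 * (2 * \<epsilon> * K) \<le> \<kappa> / 6"
  proof -
    have "\<epsilon> * (2 * (T ^ 3 * K + 1)) \<le> \<kappa> / (2 * (T ^ 3 * K + 1)) * (2 * (T ^ 3 * K + 1))"
      using TK by (intro mult_right_mono) (auto simp: \<epsilon>_def)
    then have "\<epsilon> * (2 * (T ^ 3 * K + 1)) \<le> \<kappa>" using TK by simp
    then have "2 * (\<epsilon> * (T ^ 3 * K)) \<le> \<kappa>" using \<epsilon> by (simp add: algebra_simps)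
    then show ?thesis by (simp add: algebra_simps)
  qed
  \<comment> \<open>the coefficient of the exceedance \<open>q\<close> in the bound\<close>
  define C where "C = 2 + T ^ 3 / 6 * (\<tau> * K + 8 * \<tau> ^ 3)"
  have C: "C > 0" using \<open>T \<ge> 0\<close> \<open>\<tau> > 0\<close> K unfolding C_def by (intro add_pos_nonneg mult_nonneg_nonneg add_nonneg_nonneg) auto
  define \<delta> where "\<delta> = \<kappa> / (2 * C)"
  have \<delta>: "\<delta> > 0" "C * \<delta> = \<kappa> / 2" using C \<open>\<kappa> > 0\<close> by (auto simp: \<delta>_def)
  have "holds_up_to M (\<eta> / 2) (\<lambda>n \<omega>. \<bar>exceedance (p \<omega>) b \<epsilon> n\<bar> \<le> \<delta>)"
    using \<delta> \<open>\<eta> > 0\<close> by (intro vanishes_in_probD[OF tails[OF \<epsilon>(1)]]) auto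
  from holds_up_to_conj[OF K(2) this]
  have "holds_up_to M \<eta> (\<lambda>n \<omega>. \<bar>tvar \<tau> n \<omega>\<bar> \<le> K \<and> \<bar>exceedance (p \<omega>) b \<epsilon> n\<bar> \<le> \<delta>)" by simp
  then show ?thesis
  proof (rule holds_up_to_mono)
    have "(\<lambda>n. T ^ 4 * K\<^sup>2 / (8 * real n)) \<longlonglongrightarrow> 0" by (rule real_tendsto_divide_at_top) (auto intro!: filterlim_tendsto_pos_mult_at_top[OF tendsto_const] filterlim_real_sequentially)
    then have "\<forall>\<^sub>F n in sequentially. T ^ 4 * K\<^sup>2 / (8 * real n) < \<kappa> / 6"
      using \<open>\<kappa> > 0\<close> by (intro order_tendstoD(2)) auto
    with eventually_b_pos
    show "\<forall>\<^sub>F n in sequentially. \<forall>\<omega>\<in>space M. \<bar>tvar \<tau> n \<omega>\<bar> \<le> K \<and> \<bar>exceedance (p \<omega>) b \<epsilon> n\<bar> \<le> \<delta> \<longrightarrow>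
      (\<forall>t. \<bar>t\<bar> \<le> T \<longrightarrow> cmod (char (p \<omega>) (t / b n) ^ n - iexp (t * tmean \<tau> n \<omega>) * exp (- (t\<^sup>2 * tvar \<tau> n \<omega> / 2))) \<le> \<kappa>)"
    proof (rule eventually_elim2, intro ballI allI impI)
      fix n \<omega> t
      assume n: "1 \<le> n \<and> 0 < b n" and n2: "T ^ 4 * K\<^sup>2 / (8 * real n) < \<kappa> / 6" and w: "\<omega> \<in> space M"
        and le: "\<bar>tvar \<tau> n \<omega>\<bar> \<le> K \<and> \<bar>exceedance (p \<omega>) b \<epsilon> n\<bar> \<le> \<delta>" and t: "\<bar>t\<bar> \<le> T"
      interpret P: real_distribution "p \<omega>" by (rule p_real_distribution[OF w])
      define q where "q = exceedance (p \<omega>) b \<epsilon> n"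
      define s where "s = tvar \<tau> n \<omega>"
      have q: "0 \<le> q" "q \<le> \<delta>" using le exceedance_nonneg[of "p \<omega>" b \<epsilon> n] by (auto simp: q_def)
      have s: "0 \<le> s" "s \<le> K" using le P.trunc_var_nonneg[of b n \<tau>] n \<open>\<tau> > 0\<close> by (auto simp: s_def)
      have "cmod (char (p \<omega>) (t / b n) ^ n - iexp (t * tmean \<tau> n \<omega>) * exp (- (t\<^sup>2 * tvar \<tau> n \<omega> / 2)))
        \<le> 2 * q + \<bar>t\<bar> ^ 3 / 6 * ((2 * \<epsilon> + \<tau> * q) * s + 8 * \<tau> ^ 3 * q) + t ^ 4 * s\<^sup>2 / (8 * real n)"
        unfolding q_def s_def using n \<epsilon> by (intro P.char_power_normal_approx) auto
      also have "\<dots> \<le> 2 * \<delta> + T ^ 3 / 6 * ((2 * \<epsilon> + \<tau> * \<delta>) * K + 8 * \<tau> ^ 3 * \<delta>) + T ^ 4 * K\<^sup>2 / (8 * real n)"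
      proof -
        have t4: "t ^ 4 \<le> T ^ 4" using power_mono[OF t, of 4] by simp
        have t3: "\<bar>t\<bar> ^ 3 \<le> T ^ 3" using t by (intro power_mono) auto
        have s2: "s\<^sup>2 \<le> K\<^sup>2" using s by (intro power_mono) auto
        have tq: "\<tau> * q \<le> \<tau> * \<delta>" "8 * \<tau> ^ 3 * q \<le> 8 * \<tau> ^ 3 * \<delta>" "0 \<le> \<tau> * q" "0 \<le> 8 * \<tau> ^ 3 * q"
          using q \<open>\<tau> > 0\<close> by (auto intro!: mult_left_mono)
        have h1: "(2 * \<epsilon> + \<tau> * q) * s \<le> (2 * \<epsilon> + \<tau> * \<delta>) * K"
          using tq(1,3) s \<epsilon>(1) by (intro mult_mono) linarith+
        have h2: "0 \<le> (2 * \<epsilon> + \<tau> * q) * s"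
          using tq(3) s \<epsilon>(1) by (intro mult_nonneg_nonneg) linarith+
        have h3: "\<bar>t\<bar> ^ 3 / 6 * ((2 * \<epsilon> + \<tau> * q) * s + 8 * \<tau> ^ 3 * q)
            \<le> T ^ 3 / 6 * ((2 * \<epsilon> + \<tau> * \<delta>) * K + 8 * \<tau> ^ 3 * \<delta>)"
        proof (rule mult_mono)
          show "\<bar>t\<bar> ^ 3 / 6 \<le> T ^ 3 / 6" using t3 by simp
          show "0 \<le> T ^ 3 / 6" using \<open>T \<ge> 0\<close> by simp
        qed (use h1 h2 tq in linarith)+
        have h4: "t ^ 4 * s\<^sup>2 / (8 * real n) \<le> T ^ 4 * K\<^sup>2 / (8 * real n)"
          using t4 s2 by (intro divide_right_mono mult_mono) auto
        show ?thesis using h3 h4 q(2) by linarith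
      qed
      also have "\<dots> = C * \<delta> + T ^ 3 / 6 * (2 * \<epsilon> * K) + T ^ 4 * K\<^sup>2 / (8 * real n)"
        by (simp add: C_def algebra_simps)
      also have "\<dots> \<le> \<kappa>" using \<delta>(2) eps n2 \<open>\<kappa> > 0\<close> by linarith
      finally show "cmod (char (p \<omega>) (t / b n) ^ n - iexp (t * tmean \<tau> n \<omega>) * exp (- (t\<^sup>2 * tvar \<tau> n \<omega> / 2))) \<le> \<kappa>" .
    qed
  qed
qed

end

section \<open>From tails, means and variances to characteristic functions\<close>

lemma norm_iexp_diff_le: "cmod (iexp x - iexp y) \<le> \<bar>x - y\<bar>"
proof -
  have "iexp x - iexp y = iexp y * (iexp (x - y) - 1)"
    by (simp add: algebra_simps exp_add[symmetric])
  then have "cmod (iexp x - iexp y) = cmod (iexp (x - y) - 1)" by (simp add: norm_mult)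
  also have "\<dots> \<le> \<bar>x - y\<bar>" using iexp_approx1[of "x - y" 0] by simp
  finally show ?thesis .
qed

context scaled_random_measure
begin

lemma tvar_nonneg:
  assumes "\<tau> > 0" "\<omega> \<in> space M"
  shows "0 \<le> tvar \<tau> n \<omega>"
proof (cases "n = 0")
  case False
  interpret P: real_distribution "p \<omega>" by (rule p_real_distribution[OF assms(2)])
  show ?thesis using False assms(1) by (intro P.trunc_var_nonneg b_pos) auto
qed (simp add: trunc_var_def)

lemma exp_tvar_01:
  assumes "\<tau> > 0" "\<omega> \<in> space M" "0 \<le> s"
  shows "exp (- (s * tvar \<tau> n \<omega>)) \<in> {0..1}"
  using tvar_nonneg[OF assms(1,2), of n] assms(3) by auto

lemma integrable_exp_tvar:
  assumes "\<tau> > 0" "0 \<le> s"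
  shows "integrable M (\<lambda>\<omega>. exp (- (s * tvar \<tau> n \<omega>)))"
  using exp_tvar_01[OF assms(1) _ assms(2)] by (intro integrable_const_bound[where B=1]) auto

lemma laplace_of_var_law:
  assumes "variance_law \<pi>" and w: "weakly_converges (var_law M p b \<tau>) \<pi>" and \<tau>: "\<tau> > 0" and s: "s > 0"
  shows "(\<lambda>n. expectation (\<lambda>\<omega>. exp (- (s * tvar \<tau> n \<omega>)))) \<longlonglongrightarrow> laplace \<pi> s"
proof -
  interpret V: variance_law \<pi> by fact
  have "bounded (range (exp_neg s))"
    using exp_neg_01[of s] s by (intro boundedI[where B=1]) auto
  with w continuous_exp_neg[OF s] have
    "(\<lambda>n. \<integral>v. exp_neg s v \<partial>var_law M p b \<tau> n) \<longlonglongrightarrow> (\<integral>v. exp_neg s v \<partial>\<pi>)"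
    unfolding weakly_converges_def by blast
  moreover have "(\<integral>v. exp_neg s v \<partial>var_law M p b \<tau> n) = expectation (\<lambda>\<omega>. exp (- (s * tvar \<tau> n \<omega>)))" for n
  proof -
    have "(\<integral>v. exp_neg s v \<partial>var_law M p b \<tau> n) = expectation (\<lambda>\<omega>. exp_neg s (ennreal (tvar \<tau> n \<omega>)))"
      unfolding var_law_def by (rule integral_distr) measurable
    also have "\<dots> = expectation (\<lambda>\<omega>. exp (- (s * tvar \<tau> n \<omega>)))"
      by (intro Bochner_Integration.integral_cong refl exp_neg_ennreal tvar_nonneg \<tau>)
    finally show ?thesis .
  qed
  ultimately show ?thesis by (simp add: V.laplace_eq)
qed

text \<open>
  Under \<open>v \<mapsto> exp (- v)\<close> the Laplace transforms at positive integers become the moments of a law on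
  \<open>[0,1]\<close>, which determine convergence by Weierstrass' theorem.
\<close>

lemma var_law_of_laplace:
  assumes "variance_law \<pi>" and \<tau>: "\<tau> > 0"
    and L: "\<And>s. s > 0 \<Longrightarrow> (\<lambda>n. expectation (\<lambda>\<omega>. exp (- (s * tvar \<tau> n \<omega>)))) \<longlonglongrightarrow> laplace \<pi> s"
  shows "weakly_converges (var_law M p b \<tau>) \<pi>"
  unfolding weakly_converges_def
proof (intro allI impI)
  interpret V: variance_law \<pi> by fact
  fix f :: "ennreal \<Rightarrow> real" assume f: "continuous_on UNIV f" "bounded (range f)"
  note fm [measurable] = borel_measurable_continuous_onI[OF f(1)]
  have g: "continuous_on {0..1} (\<lambda>y. f (neg_ln y))"
    by (rule continuous_on_compose2[OF f(1) continuous_neg_ln]) simp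
  have "(\<lambda>n. expectation (\<lambda>\<omega>. f (neg_ln (exp (- tvar \<tau> n \<omega>))))) \<longlonglongrightarrow> (\<integral>v. f (neg_ln (exp_neg 1 v)) \<partial>\<pi>)"
  proof (rule expectation_tendsto_of_moments[OF _ _ V.N.prob_space_axioms _ _ _ g])
    show "exp (- tvar \<tau> n \<omega>) \<in> {0..1}" if "\<omega> \<in> space M" for n \<omega>
      using exp_tvar_01[OF \<tau> that, of 1] by simp
    show "exp_neg 1 v \<in> {0..1}" for v by (rule exp_neg_01) simp
    fix k :: nat assume "k \<ge> 1"
    then show "(\<lambda>n. expectation (\<lambda>\<omega>. exp (- tvar \<tau> n \<omega>) ^ k)) \<longlonglongrightarrow> (\<integral>v. exp_neg 1 v ^ k \<partial>\<pi>)"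
      using L[of "real k"] by (simp add: exp_of_nat_mult[symmetric] exp_neg_power V.laplace_eq)
  qed measurable
  moreover have "(\<integral>v. f v \<partial>var_law M p b \<tau> n) = expectation (\<lambda>\<omega>. f (neg_ln (exp (- tvar \<tau> n \<omega>))))" for n
  proof -
    have "(\<integral>v. f v \<partial>var_law M p b \<tau> n) = expectation (\<lambda>\<omega>. f (ennreal (tvar \<tau> n \<omega>)))"
      unfolding var_law_def by (rule integral_distr) measurable
    then show ?thesis by (simp add: neg_ln_def)
  qed
  ultimately show "(\<lambda>n. \<integral>v. f v \<partial>var_law M p b \<tau> n) \<longlonglongrightarrow> (\<integral>v. f v \<partial>\<pi>)"
    by (simp add: neg_ln_exp_neg)
qed

text \<open>
  If the truncated variance exceeds \<open>1 / s\<close> then \<open>1 - exp (- s v)\<close> is at least \<open>1/2\<close>; its mean is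
  small for small \<open>s\<close> because the limit law has no mass at infinity.
\<close>

lemma tvar_bounded_in_prob:
  assumes "variance_law \<pi>" and \<tau>: "\<tau> > 0" and f: "measure \<pi> {v. v < \<infinity>} = 1"
    and L: "\<And>s. s > 0 \<Longrightarrow> (\<lambda>n. expectation (\<lambda>\<omega>. exp (- (s * tvar \<tau> n \<omega>)))) \<longlonglongrightarrow> laplace \<pi> s"
  shows "bounded_in_prob M (tvar \<tau>)"
  unfolding bounded_in_prob_def
proof (intro allI impI)
  interpret V: variance_law \<pi> by fact
  fix \<eta> :: real assume \<eta>: "\<eta> > 0"
  then obtain s where s: "s > 0" "1 - \<eta> / 2 < laplace \<pi> s"
    using V.laplace_tendsto_0[OF f, of "\<eta> / 2"] by auto
  have "\<forall>\<^sub>F n in sequentially. 1 - \<eta> / 2 < expectation (\<lambda>\<omega>. exp (- (s * tvar \<tau> n \<omega>)))"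
    by (rule order_tendstoD(1)[OF L[OF s(1)] s(2)])
  then have "\<forall>\<^sub>F n in sequentially. prob {\<omega> \<in> space M. \<not> \<bar>tvar \<tau> n \<omega>\<bar> \<le> 1 / s} \<le> \<eta>"
  proof (rule eventually_mono)
    fix n assume n: "1 - \<eta> / 2 < expectation (\<lambda>\<omega>. exp (- (s * tvar \<tau> n \<omega>)))"
    let ?u = "\<lambda>\<omega>. 1 - exp (- (s * tvar \<tau> n \<omega>))"
    have iu: "integrable M ?u" using integrable_exp_tvar[OF \<tau>, of s n] s(1) by auto
    have "prob {\<omega> \<in> space M. \<not> \<bar>tvar \<tau> n \<omega>\<bar> \<le> 1 / s} \<le> prob {\<omega> \<in> space M. 1 / 2 \<le> ?u \<omega>}"
    proof (rule finite_measure_mono)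
      show "{\<omega> \<in> space M. \<not> \<bar>tvar \<tau> n \<omega>\<bar> \<le> 1 / s} \<subseteq> {\<omega> \<in> space M. 1 / 2 \<le> ?u \<omega>}"
      proof clarify
        fix \<omega> assume w: "\<omega> \<in> space M" "\<not> \<bar>tvar \<tau> n \<omega>\<bar> \<le> 1 / s"
        then have "1 / s < tvar \<tau> n \<omega>" using tvar_nonneg[OF \<tau> w(1), of n] by simp
        then have "1 < s * tvar \<tau> n \<omega>" using s(1) by (simp add: field_simps)
        then have "2 \<le> exp (s * tvar \<tau> n \<omega>)" using exp_ge_add_one_self[of "s * tvar \<tau> n \<omega>"] by linarith
        then have "exp (- (s * tvar \<tau> n \<omega>)) \<le> 1 / 2" by (simp add: exp_minus field_simps)
        then show "1 / 2 \<le> ?u \<omega>" by simp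
      qed
    qed measurable
    also have "\<dots> \<le> expectation ?u / (1 / 2)"
      using iu exp_tvar_01[OF \<tau>, of _ s n] s(1) by (intro integral_Markov_inequality_measure[where A="space M"]) auto
    also have "expectation ?u = 1 - expectation (\<lambda>\<omega>. exp (- (s * tvar \<tau> n \<omega>)))"
      using integrable_exp_tvar[OF \<tau>, of s n] s(1) by (simp add: prob_space)
    finally show "prob {\<omega> \<in> space M. \<not> \<bar>tvar \<tau> n \<omega>\<bar> \<le> 1 / s} \<le> \<eta>" using n by simp
  qed
  then have "holds_up_to M \<eta> (\<lambda>n \<omega>. \<bar>tvar \<tau> n \<omega>\<bar> \<le> 1 / s)"
    by (intro holds_up_to_of_prob) measurable
  then show "\<exists>K>0. holds_up_to M \<eta> (\<lambda>n \<omega>. \<bar>tvar \<tau> n \<omega>\<bar> \<le> K)"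
    using s(1) by (intro exI[of _ "1 / s"]) auto
qed

lemma centred_char_approx:
  assumes tails: "\<And>\<epsilon>. \<epsilon> > 0 \<Longrightarrow> vanishes_in_prob M (\<lambda>n \<omega>. exceedance (p \<omega>) b \<epsilon> n)"
    and tight: "bounded_in_prob M (tvar \<tau>)" and \<tau>: "\<tau> > 0"
  shows "vanishes_in_prob M (\<lambda>n \<omega>. cmod (centred_char (p \<omega>) a b n t
    - iexp (t * (tmean \<tau> n \<omega> - a n / b n)) * exp (- (t\<^sup>2 * tvar \<tau> n \<omega> / 2))))"
  unfolding vanishes_in_prob_def
proof (intro allI impI)
  fix \<kappa> \<eta> :: real assume "\<kappa> > 0" "\<eta> > 0"
  from uniform_normal_approx[OF tails tight \<tau> abs_ge_zero[of t] this]
  have "holds_up_to M \<eta> (\<lambda>n \<omega>. \<forall>s. \<bar>s\<bar> \<le> \<bar>t\<bar> \<longrightarrow>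
    cmod (char (p \<omega>) (s / b n) ^ n - iexp (s * tmean \<tau> n \<omega>) * exp (- (s\<^sup>2 * tvar \<tau> n \<omega> / 2))) \<le> \<kappa>)" .
  then show "holds_up_to M \<eta> (\<lambda>n \<omega>. \<bar>cmod (centred_char (p \<omega>) a b n t
    - iexp (t * (tmean \<tau> n \<omega> - a n / b n)) * exp (- (t\<^sup>2 * tvar \<tau> n \<omega> / 2)))\<bar> \<le> \<kappa>)"
  proof (rule holds_up_to_mono, intro always_eventually allI ballI impI)
    fix n \<omega> assume *: "\<forall>s. \<bar>s\<bar> \<le> \<bar>t\<bar> \<longrightarrow>
      cmod (char (p \<omega>) (s / b n) ^ n - iexp (s * tmean \<tau> n \<omega>) * exp (- (s\<^sup>2 * tvar \<tau> n \<omega> / 2))) \<le> \<kappa>"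
    have "centred_char (p \<omega>) a b n t - iexp (t * (tmean \<tau> n \<omega> - a n / b n)) * exp (- (t\<^sup>2 * tvar \<tau> n \<omega> / 2))
      = iexp (- (t * (a n / b n))) *
        (char (p \<omega>) (t / b n) ^ n - iexp (t * tmean \<tau> n \<omega>) * exp (- (t\<^sup>2 * tvar \<tau> n \<omega> / 2)))"
    proof -
      have "iexp (t * (tmean \<tau> n \<omega> - a n / b n)) = iexp (- (t * (a n / b n))) * iexp (t * tmean \<tau> n \<omega>)"
        unfolding exp_add[symmetric] by (rule arg_cong[where f=exp]) (simp add: algebra_simps)
      then show ?thesis by (simp only: centred_char_def right_diff_distrib mult.assoc)
    qed
    then show "\<bar>cmod (centred_char (p \<omega>) a b n t
      - iexp (t * (tmean \<tau> n \<omega> - a n / b n)) * exp (- (t\<^sup>2 * tvar \<tau> n \<omega> / 2)))\<bar> \<le> \<kappa>"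
      using *[rule_format, of t] by (simp add: norm_mult)
  qed
qed

text \<open>
  Replace each factor by its normal approximation with mean \<open>\<gamma>\<close>.  All factors lie in the unit
  disk, so products differ by at most the sum of the differences, and errors in probability become
  errors in expectation.  What remains is the Laplace transform of the truncated variance.
\<close>

lemma joint_char_limit:
  fixes t :: "nat \<Rightarrow> real"
  assumes "variance_law \<pi>" and \<tau>: "\<tau> > 0" and f: "measure \<pi> {v. v < \<infinity>} = 1"
    and tails: "\<And>\<epsilon>. \<epsilon> > 0 \<Longrightarrow> vanishes_in_prob M (\<lambda>n \<omega>. exceedance (p \<omega>) b \<epsilon> n)"
    and L: "\<And>s. s > 0 \<Longrightarrow> (\<lambda>n. expectation (\<lambda>\<omega>. exp (- (s * tvar \<tau> n \<omega>)))) \<longlonglongrightarrow> laplace \<pi> s"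
    and mean: "vanishes_in_prob M (\<lambda>n \<omega>. tmean \<tau> n \<omega> - a n / b n - \<gamma>)"
  shows "(\<lambda>n. expectation (\<lambda>\<omega>. \<Prod>k<m. centred_char (p \<omega>) a b n (t k)))
    \<longlonglongrightarrow> iexp (\<gamma> * (\<Sum>k<m. t k)) * complex_of_real (laplace \<pi> ((\<Sum>k<m. (t k)\<^sup>2) / 2))"
proof -
  interpret V: variance_law \<pi> by fact
  note tight = tvar_bounded_in_prob[OF assms(1) \<tau> f L]
  define S where "S = (\<Sum>k<m. (t k)\<^sup>2) / 2"
  have S0: "0 \<le> S" by (simp add: S_def sum_nonneg)
  define w where "w k n \<omega> = iexp (t k * \<gamma>) * exp (- ((t k)\<^sup>2 * tvar \<tau> n \<omega> / 2))" for k n \<omega>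
  have [measurable]: "w k n \<in> borel_measurable M" for k n unfolding w_def by measurable
  have w1: "cmod (w k n \<omega>) \<le> 1" if "\<omega> \<in> space M" for k n \<omega>
    using tvar_nonneg[OF \<tau> that, of n] by (simp add: w_def norm_mult)
  have one: "vanishes_in_prob M (\<lambda>n \<omega>. cmod (centred_char (p \<omega>) a b n (t k) - w k n \<omega>))" for k
  proof -
    have tm: "vanishes_in_prob M (\<lambda>n \<omega>. \<bar>t k\<bar> * (tmean \<tau> n \<omega> - a n / b n - \<gamma>))"
    proof (cases "t k = 0")
      case False
      show ?thesis unfolding vanishes_in_prob_def
      proof (intro allI impI)
        fix \<kappa> \<eta> :: real assume "\<kappa> > 0" "\<eta> > 0"
        then have "holds_up_to M \<eta> (\<lambda>n \<omega>. \<bar>tmean \<tau> n \<omega> - a n / b n - \<gamma>\<bar> \<le> \<kappa> / \<bar>t k\<bar>)"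
          using False by (intro vanishes_in_probD[OF mean]) auto
        then show "holds_up_to M \<eta> (\<lambda>n \<omega>. \<bar>\<bar>t k\<bar> * (tmean \<tau> n \<omega> - a n / b n - \<gamma>)\<bar> \<le> \<kappa>)"
        proof (rule holds_up_to_mono, intro always_eventually allI ballI impI)
          fix n \<omega> assume "\<bar>tmean \<tau> n \<omega> - a n / b n - \<gamma>\<bar> \<le> \<kappa> / \<bar>t k\<bar>"
          then have "\<bar>t k\<bar> * \<bar>tmean \<tau> n \<omega> - a n / b n - \<gamma>\<bar> \<le> \<bar>t k\<bar> * (\<kappa> / \<bar>t k\<bar>)"
            by (intro mult_left_mono) auto
          also have "\<dots> = \<kappa>" using False by simp
          finally show "\<bar>\<bar>t k\<bar> * (tmean \<tau> n \<omega> - a n / b n - \<gamma>)\<bar> \<le> \<kappa>"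
            by (simp only: abs_mult abs_idempotent)
        qed
      qed
    qed (use vanishes_in_prob_le[OF mean] in auto)
    show ?thesis
    proof (rule vanishes_in_prob_le[OF vanishes_in_prob_add[OF centred_char_approx[OF tails tight \<tau>, of a "t k"]]])
      show "vanishes_in_prob M (\<lambda>n \<omega>. \<bar>t k\<bar> * \<bar>tmean \<tau> n \<omega> - a n / b n - \<gamma>\<bar>)"
        by (rule vanishes_in_prob_le[OF tm]) (simp add: abs_mult)
      show "\<forall>\<^sub>F n in sequentially. \<forall>\<omega>\<in>space M. \<bar>cmod (centred_char (p \<omega>) a b n (t k) - w k n \<omega>)\<bar>
        \<le> \<bar>cmod (centred_char (p \<omega>) a b n (t k) - iexp (t k * (tmean \<tau> n \<omega> - a n / b n)) * exp (- ((t k)\<^sup>2 * tvar \<tau> n \<omega> / 2)))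
          + \<bar>t k\<bar> * \<bar>tmean \<tau> n \<omega> - a n / b n - \<gamma>\<bar>\<bar>"
      proof (intro always_eventually allI ballI)
        fix n \<omega> assume o: "\<omega> \<in> space M"
        let ?D = "tmean \<tau> n \<omega> - a n / b n"
        let ?e = "complex_of_real (exp (- ((t k)\<^sup>2 * tvar \<tau> n \<omega> / 2)))"
        have "cmod (iexp (t k * ?D) * ?e - w k n \<omega>) = cmod (iexp (t k * ?D) - iexp (t k * \<gamma>)) * cmod ?e"
          unfolding w_def by (simp only: left_diff_distrib[symmetric] norm_mult)
        also have "\<dots> \<le> cmod (iexp (t k * ?D) - iexp (t k * \<gamma>)) * 1"
          using tvar_nonneg[OF \<tau> o, of n] by (intro mult_left_mono) auto
        also have "\<dots> \<le> \<bar>t k * ?D - t k * \<gamma>\<bar>"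
          unfolding mult_1_right by (rule norm_iexp_diff_le)
        also have "\<dots> = \<bar>t k\<bar> * \<bar>?D - \<gamma>\<bar>" by (simp add: abs_mult right_diff_distrib[symmetric])
        finally have 1: "cmod (iexp (t k * ?D) * ?e - w k n \<omega>) \<le> \<bar>t k\<bar> * \<bar>?D - \<gamma>\<bar>" .
        have "cmod (centred_char (p \<omega>) a b n (t k) - w k n \<omega>)
          \<le> cmod (centred_char (p \<omega>) a b n (t k) - iexp (t k * ?D) * ?e) + cmod (iexp (t k * ?D) * ?e - w k n \<omega>)"
          using dist_triangle[of "centred_char (p \<omega>) a b n (t k)" "w k n \<omega>" "iexp (t k * ?D) * ?e"]
          by (simp only: dist_norm)
        moreover have "\<bar>x\<bar> \<le> \<bar>A + C\<bar>" if "x \<le> A + B" "B \<le> C" "0 \<le> x" for x A B C :: real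
          using that by linarith
        ultimately show "\<bar>cmod (centred_char (p \<omega>) a b n (t k) - w k n \<omega>)\<bar>
          \<le> \<bar>cmod (centred_char (p \<omega>) a b n (t k) - iexp (t k * ?D) * ?e) + \<bar>t k\<bar> * \<bar>?D - \<gamma>\<bar>\<bar>"
          using 1 norm_ge_zero by blast
      qed
    qed
  qed
  have p1: "cmod (\<Prod>k<m. centred_char (p \<omega>) a b n (t k)) \<le> 1" "cmod (\<Prod>k<m. w k n \<omega>) \<le> 1" if "\<omega> \<in> space M" for n \<omega>
      unfolding prod_norm[symmetric] using norm_centred_char_le[OF that] w1[OF that] by (auto intro!: prod_le_1)
  have "(\<lambda>n. expectation (\<lambda>\<omega>. (\<Prod>k<m. centred_char (p \<omega>) a b n (t k)) - (\<Prod>k<m. w k n \<omega>))) \<longlonglongrightarrow> 0"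
  proof (rule expectation_tendsto_zero[where B=2])
    show "cmod ((\<Prod>k<m. centred_char (p \<omega>) a b n (t k)) - (\<Prod>k<m. w k n \<omega>)) \<le> 2" if "\<omega> \<in> space M" for n \<omega>
      using p1[OF that, of n] norm_triangle_ineq4[of "\<Prod>k<m. centred_char (p \<omega>) a b n (t k)" "\<Prod>k<m. w k n \<omega>"] by linarith
    show "vanishes_in_prob M (\<lambda>n \<omega>. cmod ((\<Prod>k<m. centred_char (p \<omega>) a b n (t k)) - (\<Prod>k<m. w k n \<omega>)))"
    proof (rule vanishes_in_prob_le[OF vanishes_in_prob_sum[OF finite_lessThan one]])
      show "\<forall>\<^sub>F n in sequentially. \<forall>\<omega>\<in>space M. \<bar>cmod ((\<Prod>k<m. centred_char (p \<omega>) a b n (t k)) - (\<Prod>k<m. w k n \<omega>))\<bar>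
        \<le> \<bar>\<Sum>k<m. cmod (centred_char (p \<omega>) a b n (t k) - w k n \<omega>)\<bar>"
      proof (intro always_eventually allI ballI)
        fix n \<omega> assume o: "\<omega> \<in> space M"
        have "cmod ((\<Prod>k<m. centred_char (p \<omega>) a b n (t k)) - (\<Prod>k<m. w k n \<omega>))
          \<le> (\<Sum>k<m. cmod (centred_char (p \<omega>) a b n (t k) - w k n \<omega>))"
          using norm_centred_char_le[OF o] w1[OF o] by (intro norm_prod_diff) auto
        then show "\<bar>cmod ((\<Prod>k<m. centred_char (p \<omega>) a b n (t k)) - (\<Prod>k<m. w k n \<omega>))\<bar>
          \<le> \<bar>\<Sum>k<m. cmod (centred_char (p \<omega>) a b n (t k) - w k n \<omega>)\<bar>" by simp
      qed
    qed
  qed measurable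
  moreover have "(\<lambda>n. expectation (\<lambda>\<omega>. \<Prod>k<m. w k n \<omega>)) \<longlonglongrightarrow> iexp (\<gamma> * (\<Sum>k<m. t k)) * complex_of_real (laplace \<pi> S)"
  proof -
    have "(\<Prod>k<m. w k n \<omega>) = iexp (\<gamma> * (\<Sum>k<m. t k)) * complex_of_real (exp (- (S * tvar \<tau> n \<omega>)))" for n \<omega>
    proof -
      have "(\<Prod>k<m. w k n \<omega>) = (\<Prod>k<m. iexp (t k * \<gamma>)) * complex_of_real (\<Prod>k<m. exp (- ((t k)\<^sup>2 * tvar \<tau> n \<omega> / 2)))"
        by (simp add: w_def prod.distrib)
      also have "(\<Prod>k<m. iexp (t k * \<gamma>)) = iexp (\<gamma> * (\<Sum>k<m. t k))"
        by (simp add: exp_sum[symmetric] sum_distrib_left mult_ac)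
      also have "(\<Prod>k<m. exp (- ((t k)\<^sup>2 * tvar \<tau> n \<omega> / 2))) = exp (- (S * tvar \<tau> n \<omega>))"
        by (simp add: exp_sum[symmetric] S_def sum_negf sum_distrib_right sum_divide_distrib)
      finally show ?thesis .
    qed
    then have e: "expectation (\<lambda>\<omega>. \<Prod>k<m. w k n \<omega>)
      = iexp (\<gamma> * (\<Sum>k<m. t k)) * complex_of_real (expectation (\<lambda>\<omega>. exp (- (S * tvar \<tau> n \<omega>))))" for n
      by (simp only: integral_mult_right_zero integral_complex_of_real)
    have "(\<lambda>n. expectation (\<lambda>\<omega>. exp (- (S * tvar \<tau> n \<omega>)))) \<longlonglongrightarrow> laplace \<pi> S"
    proof (cases "S = 0")
      case True
      then show ?thesis using f by (simp add: V.laplace_0 prob_space)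
    qed (use S0 L in auto)
    then show ?thesis unfolding e by (intro tendsto_mult tendsto_const tendsto_of_real)
  qed
  ultimately have "(\<lambda>n. expectation (\<lambda>\<omega>. (\<Prod>k<m. centred_char (p \<omega>) a b n (t k)) - (\<Prod>k<m. w k n \<omega>))
      + expectation (\<lambda>\<omega>. \<Prod>k<m. w k n \<omega>)) \<longlonglongrightarrow> 0 + iexp (\<gamma> * (\<Sum>k<m. t k)) * complex_of_real (laplace \<pi> S)"
    by (rule tendsto_add)
  moreover have "expectation (\<lambda>\<omega>. (\<Prod>k<m. centred_char (p \<omega>) a b n (t k)) - (\<Prod>k<m. w k n \<omega>))
      + expectation (\<lambda>\<omega>. \<Prod>k<m. w k n \<omega>) = expectation (\<lambda>\<omega>. \<Prod>k<m. centred_char (p \<omega>) a b n (t k))" for n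
  proof (subst Bochner_Integration.integral_diff)
    show "integrable M (\<lambda>\<omega>. \<Prod>k<m. centred_char (p \<omega>) a b n (t k))"
      by (rule integrable_const_bound[where B=1], rule AE_I2, erule p1(1)) measurable
    show "integrable M (\<lambda>\<omega>. \<Prod>k<m. w k n \<omega>)"
      by (rule integrable_const_bound[where B=1], rule AE_I2, erule p1(2)) measurable
  qed simp
  ultimately show ?thesis by (simp add: S_def)
qed

text \<open>
  The normal approximation is uniform in \<open>|t| \<le> \<rho>\<close>, and the Gaussian value is smallest at
  \<open>|t| = \<rho>\<close>.  The uniformity allows the frequency to depend on \<open>n\<close>.
\<close>

lemma eventually_char_power_ge:
  assumes "variance_law \<pi>" and \<tau>: "\<tau> > 0" and f: "measure \<pi> {v. v < \<infinity>} = 1"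
    and tails: "\<And>\<epsilon>. \<epsilon> > 0 \<Longrightarrow> vanishes_in_prob M (\<lambda>n \<omega>. exceedance (p \<omega>) b \<epsilon> n)"
    and L: "\<And>s. s > 0 \<Longrightarrow> (\<lambda>n. expectation (\<lambda>\<omega>. exp (- (s * tvar \<tau> n \<omega>)))) \<longlonglongrightarrow> laplace \<pi> s"
    and "\<rho> > 0" "m \<ge> 1" "e > 0"
  shows "\<forall>\<^sub>F n in sequentially. \<forall>t. \<bar>t\<bar> \<le> \<rho> \<longrightarrow>
    laplace \<pi> (real m * \<rho>\<^sup>2) - e < expectation (\<lambda>\<omega>. sq_char n t \<omega> ^ m)"
proof -
  note tight = tvar_bounded_in_prob[OF assms(1) \<tau> f L]
  define \<kappa> where "\<kappa> = e / (8 * real m)"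
  have \<kappa>: "\<kappa> > 0" "2 * real m * \<kappa> = e / 4" using assms by (auto simp: \<kappa>_def)
  have \<eta>: "e / 4 > 0" using assms by simp
  define s where "s = real m * \<rho>\<^sup>2"
  have s: "s > 0" using assms by (simp add: s_def)
  have "\<rho> \<ge> 0" using assms by simp
  from uniform_normal_approx[OF tails tight \<tau> this \<kappa>(1) \<eta>]
  have A: "\<forall>\<^sub>F n in sequentially. \<exists>G\<in>sets M. measure M (space M - G) \<le> e / 4 \<and> (\<forall>\<omega>\<in>G. \<forall>t. \<bar>t\<bar> \<le> \<rho> \<longrightarrow>
    cmod (char (p \<omega>) (t / b n) ^ n - iexp (t * tmean \<tau> n \<omega>) * exp (- (t\<^sup>2 * tvar \<tau> n \<omega> / 2))) \<le> \<kappa>)"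
    unfolding holds_up_to_def .
  have B: "\<forall>\<^sub>F n in sequentially. laplace \<pi> s - e / 4 < expectation (\<lambda>\<omega>. exp (- (s * tvar \<tau> n \<omega>)))"
    using \<eta> by (intro order_tendstoD(1)[OF L[OF s]]) auto
  show ?thesis
    using A B
  proof (rule eventually_elim2, intro allI impI)
    fix n t
    assume "\<exists>G\<in>sets M. measure M (space M - G) \<le> e / 4 \<and> (\<forall>\<omega>\<in>G. \<forall>t. \<bar>t\<bar> \<le> \<rho> \<longrightarrow>
        cmod (char (p \<omega>) (t / b n) ^ n - iexp (t * tmean \<tau> n \<omega>) * exp (- (t\<^sup>2 * tvar \<tau> n \<omega> / 2))) \<le> \<kappa>)"
      and n: "laplace \<pi> s - e / 4 < expectation (\<lambda>\<omega>. exp (- (s * tvar \<tau> n \<omega>)))" and t: "\<bar>t\<bar> \<le> \<rho>"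
    then obtain G where G: "G \<in> sets M" "measure M (space M - G) \<le> e / 4"
      "\<And>\<omega>. \<omega> \<in> G \<Longrightarrow> cmod (char (p \<omega>) (t / b n) ^ n - iexp (t * tmean \<tau> n \<omega>) * exp (- (t\<^sup>2 * tvar \<tau> n \<omega> / 2))) \<le> \<kappa>"
      by blast
    have pt: "exp (- (s * tvar \<tau> n \<omega>)) \<le> sq_char n t \<omega> ^ m + (e / 4 + indicator (space M - G) \<omega>)" if o: "\<omega> \<in> space M" for \<omega>
    proof (cases "\<omega> \<in> G")
      case True
      interpret P: real_distribution "p \<omega>" by (rule p_real_distribution[OF o])
      let ?x = "cmod (char (p \<omega>) (t / b n) ^ n)" and ?y = "exp (- (t\<^sup>2 * tvar \<tau> n \<omega> / 2))"
      have x: "0 \<le> ?x" "?x \<le> 1" using P.cmod_char_le_1[of "t / b n"] by (auto simp: norm_power power_le_one)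
      have y: "0 \<le> ?y" "?y \<le> 1" using tvar_nonneg[OF \<tau> o, of n] by auto
      have "\<bar>?x - ?y\<bar> \<le> cmod (char (p \<omega>) (t / b n) ^ n - iexp (t * tmean \<tau> n \<omega>) * ?y)"
        using norm_triangle_ineq3[of "char (p \<omega>) (t / b n) ^ n" "iexp (t * tmean \<tau> n \<omega>) * ?y"] by (simp add: norm_mult)
      then have xy: "\<bar>?x - ?y\<bar> \<le> \<kappa>" using G(3)[OF True] by linarith
      have "\<bar>?x ^ (2 * m) - ?y ^ (2 * m)\<bar> \<le> real (2 * m) * \<bar>?x - ?y\<bar>"
        using norm_power_diff[of ?x ?y "2 * m"] x y by simp
      also have "\<dots> \<le> real (2 * m) * \<kappa>" using xy by (intro mult_left_mono) auto
      finally have "\<bar>?x ^ (2 * m) - ?y ^ (2 * m)\<bar> \<le> e / 4" using \<kappa>(2) by simp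
      moreover have "?x ^ (2 * m) = sq_char n t \<omega> ^ m"
        by (simp add: sq_char_def norm_power power_mult[symmetric] mult_ac)
      moreover have "?y ^ (2 * m) = exp (- (real m * t\<^sup>2 * tvar \<tau> n \<omega>))"
        by (simp add: exp_of_nat_mult[symmetric])
      moreover have "exp (- (s * tvar \<tau> n \<omega>)) \<le> exp (- (real m * t\<^sup>2 * tvar \<tau> n \<omega>))"
      proof -
        have "t\<^sup>2 \<le> \<rho>\<^sup>2" using power_mono[OF t, of 2] by simp
        then have "real m * t\<^sup>2 * tvar \<tau> n \<omega> \<le> s * tvar \<tau> n \<omega>"
          unfolding s_def using tvar_nonneg[OF \<tau> o, of n] by (intro mult_right_mono mult_left_mono) auto
        then show ?thesis by simp
      qed
      ultimately have "exp (- (s * tvar \<tau> n \<omega>)) \<le> sq_char n t \<omega> ^ m + e / 4" by linarith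
      then show ?thesis using True by simp
    next
      case False
      have "exp (- (s * tvar \<tau> n \<omega>)) \<le> 1" using exp_tvar_01[OF \<tau> o, of s n] s by simp
      moreover have "0 \<le> sq_char n t \<omega> ^ m" using sq_char_01[OF o, of n t] by simp
      moreover have "indicator (space M - G) \<omega> = (1 :: real)" using False o by simp
      ultimately show ?thesis using \<eta> by linarith
    qed
    have ir: "integrable M (\<lambda>\<omega>. sq_char n t \<omega> ^ m)"
      using sq_char_01 by (intro integrable_const_bound[where B=1]) (auto simp: power_le_one)
    have iG: "integrable M (\<lambda>\<omega>. e / 4 + indicator (space M - G) \<omega>)"
      using G(1) by (intro Bochner_Integration.integrable_add) (auto simp: integrable_indicator_iff less_top[symmetric])
    have "expectation (\<lambda>\<omega>. exp (- (s * tvar \<tau> n \<omega>))) \<le> expectation (\<lambda>\<omega>. sq_char n t \<omega> ^ m + (e / 4 + indicator (space M - G) \<omega>))"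
      using pt s by (intro integral_mono integrable_exp_tvar \<tau> Bochner_Integration.integrable_add ir iG) auto
    also have "\<dots> = expectation (\<lambda>\<omega>. sq_char n t \<omega> ^ m) + (e / 4 + prob (space M - G))"
      using ir iG G(1) by (subst Bochner_Integration.integral_add, simp, simp)
        (subst Bochner_Integration.integral_add, auto simp: prob_space integrable_indicator_iff less_top[symmetric])
    finally show "laplace \<pi> (real m * \<rho>\<^sup>2) - e < expectation (\<lambda>\<omega>. sq_char n t \<omega> ^ m)"
      using n G(2) \<eta> by (simp add: s_def)
  qed
qed

end

section \<open>From characteristic functions to tails, variances and means\<close>

text \<open>
  The frequencies \<open>t\<^sub>0, - t\<^sub>0, t\<^sub>1, - t\<^sub>1, \<dots>\<close>.
\<close>

lemma prod_lessThan_double: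
  "(\<Prod>k<2 * K. F (if even k then t (k div 2) else - t (k div 2))) = (\<Prod>j<K. F (t j) * F (- t j))"
  for F :: "real \<Rightarrow> complex" and t :: "nat \<Rightarrow> real"
  by (induction K) (auto simp: mult_ac)

lemma sum_lessThan_double:
  "(\<Sum>k<2 * K. F (if even k then t (k div 2) else - t (k div 2))) = (\<Sum>j<K. F (t j) + F (- t j))"
  for F :: "real \<Rightarrow> real" and t :: "nat \<Rightarrow> real"
  by (induction K) (auto simp: add_ac)

context scaled_random_measure
begin

text \<open>
  Fubini's theorem and dominated convergence.  Convergence in probability is known for each
  frequency only, so the integrand is capped at 1 to supply an integrable bound.
\<close>

lemma vanishes_in_prob_unit_average:
  fixes Y :: "nat \<Rightarrow> real \<Rightarrow> 'a \<Rightarrow> real"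
  assumes Ym: "\<And>n. (\<lambda>z. Y n (fst z) (snd z)) \<in> borel_measurable (borel \<Otimes>\<^sub>M M)"
    and Y0: "\<And>n t \<omega>. \<omega> \<in> space M \<Longrightarrow> 0 \<le> Y n t \<omega>"
    and v: "\<And>t. vanishes_in_prob M (\<lambda>n \<omega>. Y n t \<omega>)"
  shows "vanishes_in_prob M (\<lambda>n \<omega>. LINT t|unit_uniform. min (Y n t \<omega>) 1)"
proof -
  interpret U: prob_space unit_uniform by (rule prob_space_unit_uniform)
  interpret UM: pair_prob_space unit_uniform M ..
  have sU: "space unit_uniform = UNIV" by (simp add: unit_uniform_def)
  have Zm [measurable]: "(\<lambda>z. min (Y n (fst z) (snd z)) 1) \<in> borel_measurable (unit_uniform \<Otimes>\<^sub>M M)" for n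
    using borel_measurable_min[OF borel_measurable_const[of 1] Ym[of n]]
    by (subst measurable_cong_sets[OF sets_pair_measure_cong[OF sets_unit_uniform refl] refl])
  have Zi: "integrable (unit_uniform \<Otimes>\<^sub>M M) (\<lambda>(t, \<omega>). min (Y n t \<omega>) 1)" for n
    using Zm[of n] Y0
    by (intro UM.P.integrable_const_bound[where B=1]) (auto simp: split_beta' space_pair_measure)
  have Yt [measurable]: "Y n t \<in> borel_measurable M" for n t
    using measurable_compose[OF measurable_Pair1' Ym[of n], of t] by simp
  have lim: "(\<lambda>n. expectation (\<lambda>\<omega>. min (Y n t \<omega>) 1)) \<longlonglongrightarrow> 0" for t
  proof (rule expectation_tendsto_zero[where B=1])
    show "norm (min (Y n t \<omega>) 1) \<le> 1" if "\<omega> \<in> space M" for n \<omega> using Y0[OF that, of n t] by simp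
    show "vanishes_in_prob M (\<lambda>n \<omega>. norm (min (Y n t \<omega>) 1))"
      by (rule vanishes_in_prob_le[OF v[of t]]) (use Y0 in \<open>auto intro!: always_eventually\<close>)
  qed measurable
  have e01: "\<bar>expectation (\<lambda>\<omega>. min (Y n t \<omega>) 1)\<bar> \<le> 1" for n t
  proof -
    have "\<bar>expectation (\<lambda>\<omega>. min (Y n t \<omega>) 1)\<bar> \<le> expectation (\<lambda>\<omega>. \<bar>min (Y n t \<omega>) 1\<bar>)" by (rule integral_abs_bound)
    also have "\<dots> \<le> expectation (\<lambda>\<omega>. 1)"
      using Y0 by (intro integral_mono integrable_abs integrable_const_bound[where B=1]) auto
    finally show ?thesis by (simp add: prob_space)
  qed
  have "(\<lambda>n. LINT t|unit_uniform. expectation (\<lambda>\<omega>. min (Y n t \<omega>) 1)) \<longlonglongrightarrow> (LINT t|unit_uniform. 0)"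
  proof (rule integral_dominated_convergence[where w="\<lambda>_. 1"])
    show "(\<lambda>t. expectation (\<lambda>\<omega>. min (Y n t \<omega>) 1)) \<in> borel_measurable unit_uniform" for n
      using borel_measurable_lebesgue_integral[of "\<lambda>t \<omega>. min (Y n t \<omega>) 1" unit_uniform] Zm[of n]
      by (simp add: split_beta')
  qed (use lim e01 in auto)
  moreover have "(LINT t|unit_uniform. expectation (\<lambda>\<omega>. min (Y n t \<omega>) 1))
      = expectation (\<lambda>\<omega>. LINT t|unit_uniform. min (Y n t \<omega>) 1)" for n
    by (rule UM.Fubini_integral[OF Zi, symmetric])
  ultimately have "(\<lambda>n. expectation (\<lambda>\<omega>. LINT t|unit_uniform. min (Y n t \<omega>) 1)) \<longlonglongrightarrow> 0" by simp
  then show ?thesis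
  proof (rule vanishes_in_prob_of_expectation[rotated 2])
    show "integrable M (\<lambda>\<omega>. LINT t|unit_uniform. min (Y n t \<omega>) 1)" for n
      using UM.integrable_snd[OF Zi] .
    show "0 \<le> (LINT t|unit_uniform. min (Y n t \<omega>) 1)" if "\<omega> \<in> space M" for n \<omega>
      using Y0[OF that] by (intro Bochner_Integration.integral_nonneg) auto
  qed
qed

context
  fixes \<pi> :: "ennreal measure" and a :: "nat \<Rightarrow> real" and \<gamma> :: real
  assumes var: "variance_law \<pi>" and finite_var: "measure \<pi> {v. v < \<infinity>} = 1"
    and cf: "\<And>(m :: nat) (t :: nat \<Rightarrow> real). m \<ge> 1 \<Longrightarrow> (\<lambda>n. expectation (\<lambda>\<omega>. \<Prod>k<m. centred_char (p \<omega>) a b n (t k)))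
      \<longlonglongrightarrow> iexp (\<gamma> * (\<Sum>k<m. t k)) * complex_of_real (laplace \<pi> ((\<Sum>k<m. (t k)\<^sup>2) / 2))"
begin

interpretation V: variance_law \<pi> by (rule var)

text \<open>
  Every mixed moment of the squared moduli is a value of the characteristic function of
  finitely many rows: each squared modulus uses two rows, with opposite frequencies.
\<close>

lemma sq_char_prod_limit:
  fixes t :: "nat \<Rightarrow> real"
  assumes "K \<ge> 1"
  shows "(\<lambda>n. expectation (\<lambda>\<omega>. \<Prod>j<K. sq_char n (t j) \<omega>)) \<longlonglongrightarrow> laplace \<pi> (\<Sum>j<K. (t j)\<^sup>2)"
proof -
  let ?t = "\<lambda>k. if even k then t (k div 2) else - t (k div 2)"
  have "(\<lambda>n. expectation (\<lambda>\<omega>. \<Prod>k<2 * K. centred_char (p \<omega>) a b n (?t k)))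
      \<longlonglongrightarrow> iexp (\<gamma> * (\<Sum>k<2 * K. ?t k)) * complex_of_real (laplace \<pi> ((\<Sum>k<2 * K. (?t k)\<^sup>2) / 2))"
    using assms by (intro cf) auto
  moreover have "(\<Sum>k<2 * K. ?t k) = 0"
    using sum_lessThan_double[of "\<lambda>x. x" t K] by simp
  moreover have "(\<Sum>k<2 * K. (?t k)\<^sup>2) / 2 = (\<Sum>j<K. (t j)\<^sup>2)"
    using sum_lessThan_double[of "\<lambda>x. x\<^sup>2" t K] by (simp add: sum_distrib_left[symmetric])
  moreover have "expectation (\<lambda>\<omega>. \<Prod>k<2 * K. centred_char (p \<omega>) a b n (?t k))
      = complex_of_real (expectation (\<lambda>\<omega>. \<Prod>j<K. sq_char n (t j) \<omega>))" for n
  proof -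
    have "expectation (\<lambda>\<omega>. \<Prod>k<2 * K. centred_char (p \<omega>) a b n (?t k))
        = expectation (\<lambda>\<omega>. complex_of_real (\<Prod>j<K. sq_char n (t j) \<omega>))"
    proof (intro Bochner_Integration.integral_cong refl)
      fix \<omega> assume o: "\<omega> \<in> space M"
      show "(\<Prod>k<2 * K. centred_char (p \<omega>) a b n (?t k)) = complex_of_real (\<Prod>j<K. sq_char n (t j) \<omega>)"
        unfolding prod_lessThan_double by (simp add: centred_char_mult_minus[OF o])
    qed
    then show ?thesis by (simp only: integral_complex_of_real)
  qed
  ultimately have "(\<lambda>n. complex_of_real (expectation (\<lambda>\<omega>. \<Prod>j<K. sq_char n (t j) \<omega>)))
      \<longlonglongrightarrow> complex_of_real (laplace \<pi> (\<Sum>j<K. (t j)\<^sup>2))" by simp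
  then show ?thesis by (simp only: tendsto_of_real_iff)
qed

lemma sq_char_power_limit:
  assumes "k \<ge> 1"
  shows "(\<lambda>n. expectation (\<lambda>\<omega>. sq_char n t \<omega> ^ k)) \<longlonglongrightarrow> laplace \<pi> (real k * t\<^sup>2)"
  using sq_char_prod_limit[OF assms, of "\<lambda>_. t"] by simp

lemma integrable_sq_char_prod:
  "integrable M (\<lambda>\<omega>. sq_char n s \<omega> ^ i * sq_char n t \<omega> ^ j)"
  using sq_char_01 by (intro integrable_const_bound[where B=1])
    (auto simp: abs_mult power_abs intro!: mult_le_one power_le_one)

text \<open>
  Expanding the square, the three second moments involve the frequencies \<open>(2t, 2t)\<close>, \<open>(2t, t, t, t, t)\<close>
  and eight times \<open>t\<close>.  All have sum of squares \<open>8 t\<^sup>2\<close>, hence the same limit, and the limits cancel.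
\<close>

lemma sq_char_doubling: "vanishes_in_prob M (\<lambda>n \<omega>. sq_char n (2 * t) \<omega> - sq_char n t \<omega> ^ 4)"
proof -
  let ?u = "\<lambda>n \<omega>. sq_char n t \<omega>" and ?v = "\<lambda>n \<omega>. sq_char n (2 * t) \<omega>"
  have 1: "(\<lambda>n. expectation (\<lambda>\<omega>. ?v n \<omega> ^ 2)) \<longlonglongrightarrow> laplace \<pi> (8 * t\<^sup>2)"
    using sq_char_power_limit[of 2 "2 * t"] by (simp add: power_mult_distrib)
  have 2: "(\<lambda>n. expectation (\<lambda>\<omega>. ?u n \<omega> ^ 8)) \<longlonglongrightarrow> laplace \<pi> (8 * t\<^sup>2)"
    using sq_char_power_limit[of 8 t] by simp
  have 3: "(\<lambda>n. expectation (\<lambda>\<omega>. ?v n \<omega> ^ 1 * ?u n \<omega> ^ 4)) \<longlonglongrightarrow> laplace \<pi> (8 * t\<^sup>2)"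
    using sq_char_prod_limit[of 5 "\<lambda>k. if k = 0 then 2 * t else t"]
    by (simp add: numeral_eq_Suc power_mult_distrib algebra_simps lessThan_Suc)
  have "(\<lambda>n. expectation (\<lambda>\<omega>. ?v n \<omega> ^ 2) + expectation (\<lambda>\<omega>. ?u n \<omega> ^ 8)
      - 2 * expectation (\<lambda>\<omega>. ?v n \<omega> ^ 1 * ?u n \<omega> ^ 4)) \<longlonglongrightarrow>
      laplace \<pi> (8 * t\<^sup>2) + laplace \<pi> (8 * t\<^sup>2) - 2 * laplace \<pi> (8 * t\<^sup>2)"
    by (intro tendsto_intros 1 2 3)
  moreover have "expectation (\<lambda>\<omega>. ?v n \<omega> ^ 2) + expectation (\<lambda>\<omega>. ?u n \<omega> ^ 8)
      - 2 * expectation (\<lambda>\<omega>. ?v n \<omega> ^ 1 * ?u n \<omega> ^ 4) = expectation (\<lambda>\<omega>. (?v n \<omega> - ?u n \<omega> ^ 4)\<^sup>2)" for n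
  proof -
    have i: "integrable M (\<lambda>\<omega>. ?v n \<omega> ^ 2)" "integrable M (\<lambda>\<omega>. ?u n \<omega> ^ 8)" "integrable M (\<lambda>\<omega>. 2 * (?v n \<omega> ^ 1 * ?u n \<omega> ^ 4))"
      using integrable_sq_char_prod[of n "2 * t" 2 t 0] integrable_sq_char_prod[of n "2 * t" 0 t 8]
        integrable_mult_right[OF integrable_sq_char_prod[of n "2 * t" 1 t 4], of 2] by simp_all
    have "(?v n \<omega> - ?u n \<omega> ^ 4)\<^sup>2 = ?v n \<omega> ^ 2 + ?u n \<omega> ^ 8 - 2 * (?v n \<omega> ^ 1 * ?u n \<omega> ^ 4)" for \<omega>
      by (simp add: power2_diff power_mult[symmetric])
    then have "expectation (\<lambda>\<omega>. (?v n \<omega> - ?u n \<omega> ^ 4)\<^sup>2)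
      = expectation (\<lambda>\<omega>. ?v n \<omega> ^ 2 + ?u n \<omega> ^ 8 - 2 * (?v n \<omega> ^ 1 * ?u n \<omega> ^ 4))" by simp
    also have "\<dots> = expectation (\<lambda>\<omega>. ?v n \<omega> ^ 2) + expectation (\<lambda>\<omega>. ?u n \<omega> ^ 8) - expectation (\<lambda>\<omega>. 2 * (?v n \<omega> ^ 1 * ?u n \<omega> ^ 4))"
      by (simp only: Bochner_Integration.integral_diff[OF Bochner_Integration.integrable_add[OF i(1,2)] i(3)]
        Bochner_Integration.integral_add[OF i(1,2)])
    finally show ?thesis by simp
  qed
  ultimately have lim: "(\<lambda>n. expectation (\<lambda>\<omega>. (?v n \<omega> - ?u n \<omega> ^ 4)\<^sup>2)) \<longlonglongrightarrow> 0" by simp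
  have sq: "vanishes_in_prob M (\<lambda>n \<omega>. (?v n \<omega> - ?u n \<omega> ^ 4)\<^sup>2)"
  proof (rule vanishes_in_prob_of_expectation[OF _ _ lim])
    show "integrable M (\<lambda>\<omega>. (?v n \<omega> - ?u n \<omega> ^ 4)\<^sup>2)" for n
    proof (rule integrable_const_bound[where B=1])
      have "(?v n \<omega> - ?u n \<omega> ^ 4)\<^sup>2 \<le> 1" if o: "\<omega> \<in> space M" for \<omega>
      proof -
        have "0 \<le> ?u n \<omega> ^ 4 \<and> ?u n \<omega> ^ 4 \<le> 1"
          using sq_char_01[OF o, of n t] by (simp add: power_le_one)
        moreover have "0 \<le> ?v n \<omega> \<and> ?v n \<omega> \<le> 1" using sq_char_01[OF o, of n "2 * t"] by simp
        ultimately have "\<bar>?v n \<omega> - ?u n \<omega> ^ 4\<bar> \<le> 1" by linarith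
        then show ?thesis using abs_square_le_1 by blast
      qed
      then show "AE \<omega> in M. norm ((?v n \<omega> - ?u n \<omega> ^ 4)\<^sup>2) \<le> 1" by auto
    qed measurable
  qed auto
  show ?thesis
    unfolding vanishes_in_prob_def
  proof (intro allI impI)
    fix \<kappa> \<eta> :: real assume k: "\<kappa> > 0" "\<eta> > 0"
    then have "holds_up_to M \<eta> (\<lambda>n \<omega>. \<bar>(?v n \<omega> - ?u n \<omega> ^ 4)\<^sup>2\<bar> \<le> \<kappa>\<^sup>2)"
      by (intro vanishes_in_probD[OF sq]) auto
    then show "holds_up_to M \<eta> (\<lambda>n \<omega>. \<bar>?v n \<omega> - ?u n \<omega> ^ 4\<bar> \<le> \<kappa>)"
    proof (rule holds_up_to_mono, intro always_eventually allI ballI impI)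
      fix n \<omega> assume "\<bar>(?v n \<omega> - ?u n \<omega> ^ 4)\<^sup>2\<bar> \<le> \<kappa>\<^sup>2"
      then have "\<bar>?v n \<omega> - ?u n \<omega> ^ 4\<bar>\<^sup>2 \<le> \<kappa>\<^sup>2" by simp
      then show "\<bar>?v n \<omega> - ?u n \<omega> ^ 4\<bar> \<le> \<kappa>" using k(1) by (meson less_imp_le power2_le_imp_le)
    qed
  qed
qed

text \<open>
  In the limit the squared modulus is \<open>exp (- t\<^sup>2 v)\<close>, which is positive because the variance is
  almost surely finite.  The tent functions \<open>g j\<close> shrink to the indicator of 0.
\<close>

lemma sq_char_bounded_below:
  assumes t: "t \<noteq> 0" and \<eta>: "\<eta> > 0"
  shows "\<exists>\<delta>>0. holds_up_to M \<eta> (\<lambda>n \<omega>. \<delta> \<le> sq_char n t \<omega>)"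
proof -
  let ?V = "exp_neg (t\<^sup>2)"
  define g where "g j x = max 0 (1 - real (Suc j) * x)" for j and x :: real
  have g01: "g j x \<in> {0..1}" if "0 \<le> x" for j x using that by (auto simp: g_def)
  have V01: "?V v \<in> {0..1}" for v by (rule exp_neg_01) simp
  have gm[measurable]: "g j \<in> borel_measurable borel" for j unfolding g_def[abs_def] by measurable
  have "(\<lambda>j. \<integral>v. g j (?V v) \<partial>\<pi>) \<longlonglongrightarrow> (\<integral>v. 0 \<partial>\<pi>)"
  proof (rule integral_dominated_convergence[where w="\<lambda>_. 1"])
    have "AE v in \<pi>. v < \<infinity>" using V.N.AE_prob_1[OF finite_var] by simp
    then show "AE v in \<pi>. (\<lambda>j. g j (?V v)) \<longlonglongrightarrow> 0"
    proof eventually_elim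
      case (elim v)
      then have pos: "0 < ?V v" by (auto simp: exp_neg_def)
      obtain N where N: "1 / ?V v < real N" using reals_Archimedean2 by blast
      have "\<forall>\<^sub>F j in sequentially. g j (?V v) = 0"
        using eventually_ge_at_top[of N]
      proof (rule eventually_mono)
        fix j assume "N \<le> j"
        then have "1 / ?V v \<le> real (Suc j)" using N by linarith
        then have "1 \<le> real (Suc j) * ?V v" using pos by (simp add: field_simps)
        then show "g j (?V v) = 0" by (simp add: g_def)
      qed
      then show ?case by (rule tendsto_eventually)
    qed
    show "AE v in \<pi>. norm (g j (?V v)) \<le> 1" for j using g01 V01 by auto
  qed auto
  then have "(\<lambda>j. \<integral>v. g j (?V v) \<partial>\<pi>) \<longlonglongrightarrow> 0" by simp
  then have "\<forall>\<^sub>F j in sequentially. (\<integral>v. g j (?V v) \<partial>\<pi>) < \<eta> / 2"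
    using \<eta> by (intro order_tendstoD(2)) auto
  then obtain j where j: "(\<integral>v. g j (?V v) \<partial>\<pi>) < \<eta> / 2" by (auto simp: eventually_sequentially)
  define \<delta> where "\<delta> = 1 / (2 * real (Suc j))"
  have \<delta>: "\<delta> > 0" by (simp add: \<delta>_def)
  have "(\<lambda>n. expectation (\<lambda>\<omega>. g j (sq_char n t \<omega>))) \<longlonglongrightarrow> (\<integral>v. g j (?V v) \<partial>\<pi>)"
  proof (rule expectation_tendsto_of_moments[OF _ sq_char_01 V.N.prob_space_axioms _ V01])
    show "continuous_on {0..1} (g j)" unfolding g_def by (intro continuous_intros)
    fix k :: nat assume k: "k \<ge> 1"
    show "(\<lambda>n. expectation (\<lambda>\<omega>. sq_char n t \<omega> ^ k)) \<longlonglongrightarrow> (\<integral>v. ?V v ^ k \<partial>\<pi>)"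
      using sq_char_power_limit[OF k, of t] k by (simp add: exp_neg_power V.laplace_eq)
  qed measurable
  from order_tendstoD(2)[OF this j]
  have "\<forall>\<^sub>F n in sequentially. prob {\<omega> \<in> space M. \<not> \<delta> \<le> sq_char n t \<omega>} \<le> \<eta>"
  proof (rule eventually_mono)
    fix n assume n: "expectation (\<lambda>\<omega>. g j (sq_char n t \<omega>)) < \<eta> / 2"
    have ig: "integrable M (\<lambda>\<omega>. g j (sq_char n t \<omega>))"
      using g01 sq_char_01 by (intro integrable_const_bound[where B=1]) auto
    have "prob {\<omega> \<in> space M. \<not> \<delta> \<le> sq_char n t \<omega>} \<le> prob {\<omega> \<in> space M. 1 / 2 \<le> g j (sq_char n t \<omega>)}"
    proof (rule finite_measure_mono)
      show "{\<omega> \<in> space M. \<not> \<delta> \<le> sq_char n t \<omega>} \<subseteq> {\<omega> \<in> space M. 1 / 2 \<le> g j (sq_char n t \<omega>)}"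
      proof clarify
        fix \<omega> assume "\<not> \<delta> \<le> sq_char n t \<omega>"
        then have "real (Suc j) * sq_char n t \<omega> \<le> real (Suc j) * \<delta>" by (intro mult_left_mono) auto
        also have "\<dots> = 1 / 2" by (simp add: \<delta>_def)
        finally show "1 / 2 \<le> g j (sq_char n t \<omega>)" unfolding g_def by linarith
      qed
    qed measurable
    also have "\<dots> \<le> expectation (\<lambda>\<omega>. g j (sq_char n t \<omega>)) / (1 / 2)"
      using ig g01 sq_char_01 by (intro integral_Markov_inequality_measure[where A="space M"]) auto
    finally show "prob {\<omega> \<in> space M. \<not> \<delta> \<le> sq_char n t \<omega>} \<le> \<eta>" using n by simp
  qed
  then have "holds_up_to M \<eta> (\<lambda>n \<omega>. \<delta> \<le> sq_char n t \<omega>)" by (intro holds_up_to_of_prob) measurable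
  then show ?thesis using \<delta> by blast
qed

lemma nongaussian_defect_vanishes:
  "vanishes_in_prob M (\<lambda>n \<omega>. nongaussian_defect (p \<omega>) b n t)"
proof (cases "t = 0")
  case True
  then show ?thesis
    by (auto simp: vanishes_in_prob_def holds_up_to_def nongaussian_defect_def intro!: always_eventually bexI[of _ "space M"])
next
  case False
  show ?thesis
    unfolding vanishes_in_prob_def
  proof (intro allI impI)
    fix \<kappa> \<eta> :: real assume k: "\<kappa> > 0" "\<eta> > 0"
    then obtain \<delta> where d: "\<delta> > 0" "holds_up_to M (\<eta> / 2) (\<lambda>n \<omega>. \<delta> \<le> sq_char n t \<omega>)"
      using sq_char_bounded_below[OF False, of "\<eta> / 2"] by auto
    have "holds_up_to M (\<eta> / 2) (\<lambda>n \<omega>. \<bar>sq_char n (2 * t) \<omega> - sq_char n t \<omega> ^ 4\<bar> \<le> \<kappa> * \<delta> ^ 4)"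
      using k d by (intro vanishes_in_probD[OF sq_char_doubling]) auto
    from holds_up_to_conj[OF d(2) this]
    have "holds_up_to M \<eta> (\<lambda>n \<omega>. \<delta> \<le> sq_char n t \<omega> \<and> \<bar>sq_char n (2 * t) \<omega> - sq_char n t \<omega> ^ 4\<bar> \<le> \<kappa> * \<delta> ^ 4)"
      by simp
    then show "holds_up_to M \<eta> (\<lambda>n \<omega>. \<bar>nongaussian_defect (p \<omega>) b n t\<bar> \<le> \<kappa>)"
    proof (rule holds_up_to_mono)
      have "(\<lambda>n. 6 / \<delta>\<^sup>2 * (1 / real n)) \<longlonglongrightarrow> 6 / \<delta>\<^sup>2 * 0" by (intro tendsto_intros lim_1_over_n)
      then have "\<forall>\<^sub>F n in sequentially. 6 / \<delta>\<^sup>2 * (1 / real n) < \<kappa>"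
        using k by (intro order_tendstoD(2)) auto
      with eventually_b_pos
      show "\<forall>\<^sub>F n in sequentially. \<forall>\<omega>\<in>space M.
        \<delta> \<le> sq_char n t \<omega> \<and> \<bar>sq_char n (2 * t) \<omega> - sq_char n t \<omega> ^ 4\<bar> \<le> \<kappa> * \<delta> ^ 4 \<longrightarrow> \<bar>nongaussian_defect (p \<omega>) b n t\<bar> \<le> \<kappa>"
      proof (rule eventually_elim2, intro ballI impI)
        fix n \<omega> assume n: "1 \<le> n \<and> 0 < b n" "6 / \<delta>\<^sup>2 * (1 / real n) < \<kappa>" and o: "\<omega> \<in> space M"
          and le: "\<delta> \<le> sq_char n t \<omega> \<and> \<bar>sq_char n (2 * t) \<omega> - sq_char n t \<omega> ^ 4\<bar> \<le> \<kappa> * \<delta> ^ 4"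
        interpret P: real_distribution "p \<omega>" by (rule p_real_distribution[OF o])
        have "2 * nongaussian_defect (p \<omega>) b n t
            \<le> \<bar>sq_char n (2 * t) \<omega> - sq_char n t \<omega> ^ 4\<bar> / \<delta> ^ 4 + 6 / (\<delta>\<^sup>2 * real n)"
          using P.nongaussian_defect_le[of n \<delta> t b] n d le unfolding sq_char_def by auto
        also have "\<dots> \<le> \<kappa> + \<kappa>"
          using le n d by (intro add_mono) (auto simp: field_simps)
        finally show "\<bar>nongaussian_defect (p \<omega>) b n t\<bar> \<le> \<kappa>"
          using P.nongaussian_defect_nonneg[of b n t] by simp
      qed
    qed
  qed
qed

text \<open>
  For each frequency the non-Gaussian defect vanishes in probability; averaged over frequencies
  it dominates the exceedance probability of the symmetrised law, and the latter dominates the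
  exceedance of the law itself because \<open>b\<^sub>n\<close> tends to infinity, so that most of the mass of a fixed measure
  lies near the origin at scale \<open>b\<^sub>n\<close>.
\<close>

lemma tails_vanish:
  assumes \<epsilon>: "\<epsilon> > 0"
  shows "vanishes_in_prob M (\<lambda>n \<omega>. exceedance (p \<omega>) b \<epsilon> n)"
proof -
  have e2: "\<epsilon> / 2 > 0" using \<epsilon> by simp
  obtain c where c: "c > 0" "\<And>y. \<epsilon> / 2 \<le> \<bar>y\<bar> \<Longrightarrow> c \<le> (LINT t|unit_uniform. (1 - cos (t * y))\<^sup>2)"
    using integral_one_minus_cos_ge[OF e2] by blast
  \<comment> \<open>the defect in a form that is jointly measurable in frequency and sample point\<close>
  define D where "D n t \<omega> = (4 * char_deficit (p \<omega>) b n t - char_deficit (p \<omega>) b n (2 * t)) / 2" for n t \<omega>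
  have Dm: "(\<lambda>z. D n (fst z) (snd z)) \<in> borel_measurable (borel \<Otimes>\<^sub>M M)" for n
  proof -
    have [measurable]: "(\<lambda>z. char (p (snd z)) (fst z / b n)) \<in> borel_measurable (borel \<Otimes>\<^sub>M M)"
      "(\<lambda>z. char (p (snd z)) (2 * fst z / b n)) \<in> borel_measurable (borel \<Otimes>\<^sub>M M)"
      using measurable_char_pair[of "1 / b n"] measurable_char_pair[of "2 / b n"] by (simp_all add: mult.commute)
    show ?thesis unfolding D_def char_deficit_def by measurable
  qed
  have D: "D n t \<omega> = nongaussian_defect (p \<omega>) b n t" if "\<omega> \<in> space M" for n t \<omega>
    using real_distribution.nongaussian_defect_eq[OF p_real_distribution[OF that], of b n t] by (simp add: D_def)
  have D0: "0 \<le> D n t \<omega>" if "\<omega> \<in> space M" for n t \<omega>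
    unfolding D[OF that] by (rule real_distribution.nongaussian_defect_nonneg[OF p_real_distribution[OF that]])
  have Dv: "vanishes_in_prob M (\<lambda>n \<omega>. D n t \<omega>)" for t
    by (rule vanishes_in_prob_le[OF nongaussian_defect_vanishes[of t]]) (auto intro!: always_eventually simp: D)
  note avg = vanishes_in_prob_unit_average[OF Dm D0 Dv]
  have small: "vanishes_in_prob M (\<lambda>n \<omega>. measure (p \<omega>) {x. \<epsilon> / 2 * b n \<le> \<bar>x\<bar>})"
  proof (rule vanishes_in_prob_of_expectation)
    have [measurable]: "(\<lambda>\<omega>. measure (p \<omega>) {x. \<epsilon> / 2 * b n \<le> \<bar>x\<bar>}) \<in> borel_measurable M" for n
      by (rule measurable_measure_p) measurable
    have le1: "measure (p \<omega>) B \<le> 1" if "\<omega> \<in> space M" for \<omega> B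
      using prob_space.prob_le_1[OF real_distribution.axioms(1)[OF p_real_distribution[OF that]]] .
    show "integrable M (\<lambda>\<omega>. measure (p \<omega>) {x. \<epsilon> / 2 * b n \<le> \<bar>x\<bar>})" for n
      using le1 by (intro integrable_const_bound[where B=1]) auto
    have "(\<lambda>n. expectation (\<lambda>\<omega>. measure (p \<omega>) {x. \<epsilon> / 2 * b n \<le> \<bar>x\<bar>})) \<longlonglongrightarrow> expectation (\<lambda>\<omega>. 0)"
    proof (rule integral_dominated_convergence[where w="\<lambda>_. 1"])
      show "AE \<omega> in M. (\<lambda>n. measure (p \<omega>) {x. \<epsilon> / 2 * b n \<le> \<bar>x\<bar>}) \<longlonglongrightarrow> 0"
      proof (rule AE_I2)
        fix \<omega> assume o: "\<omega> \<in> space M"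
        interpret P: real_distribution "p \<omega>" by (rule p_real_distribution[OF o])
        show "(\<lambda>n. measure (p \<omega>) {x. \<epsilon> / 2 * b n \<le> \<bar>x\<bar>}) \<longlonglongrightarrow> 0"
        proof (rule order_tendstoI)
          fix l :: real assume "l < 0"
          then show "\<forall>\<^sub>F n in sequentially. l < measure (p \<omega>) {x. \<epsilon> / 2 * b n \<le> \<bar>x\<bar>}"
            by (auto intro!: always_eventually intro: less_le_trans)
        next
          fix u :: real assume "0 < u"
          then obtain R where R: "R > 0" "measure (p \<omega>) {x. R < \<bar>x\<bar>} < u" using P.exists_tail_bound by blast
          have "\<forall>\<^sub>F n in sequentially. 2 * R / \<epsilon> < b n" using b_top by (auto simp: filterlim_at_top_dense)
          then show "\<forall>\<^sub>F n in sequentially. measure (p \<omega>) {x. \<epsilon> / 2 * b n \<le> \<bar>x\<bar>} < u"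
          proof (rule eventually_mono)
            fix n assume "2 * R / \<epsilon> < b n"
            then have "R < \<epsilon> / 2 * b n" using \<epsilon> by (simp add: field_simps)
            then have "measure (p \<omega>) {x. \<epsilon> / 2 * b n \<le> \<bar>x\<bar>} \<le> measure (p \<omega>) {x. R < \<bar>x\<bar>}"
              by (intro P.finite_measure_mono) auto
            then show "measure (p \<omega>) {x. \<epsilon> / 2 * b n \<le> \<bar>x\<bar>} < u" using R(2) by linarith
          qed
        qed
      qed
    qed (use le1 in auto)
    then show "(\<lambda>n. expectation (\<lambda>\<omega>. measure (p \<omega>) {x. \<epsilon> / 2 * b n \<le> \<bar>x\<bar>})) \<longlonglongrightarrow> 0" by simp
  qed auto
  show ?thesis
    unfolding vanishes_in_prob_def
  proof (intro allI impI)
    fix \<kappa> \<eta> :: real assume k: "\<kappa> > 0" "\<eta> > 0"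
    have 1: "holds_up_to M (\<eta> / 2) (\<lambda>n \<omega>. \<bar>LINT t|unit_uniform. min (D n t \<omega>) 1\<bar> \<le> c * min (\<kappa> / 2) (1 / 8))"
      using k c by (intro vanishes_in_probD[OF avg]) auto
    have 2: "holds_up_to M (\<eta> / 2) (\<lambda>n \<omega>. \<bar>measure (p \<omega>) {x. \<epsilon> / 2 * b n \<le> \<bar>x\<bar>}\<bar> \<le> 1 / 2)"
      using k by (intro vanishes_in_probD[OF small]) auto
    from holds_up_to_conj[OF 1 2]
    have "holds_up_to M \<eta> (\<lambda>n \<omega>. \<bar>LINT t|unit_uniform. min (D n t \<omega>) 1\<bar> \<le> c * min (\<kappa> / 2) (1 / 8) \<and>
      \<bar>measure (p \<omega>) {x. \<epsilon> / 2 * b n \<le> \<bar>x\<bar>}\<bar> \<le> 1 / 2)" by simp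
    then show "holds_up_to M \<eta> (\<lambda>n \<omega>. \<bar>exceedance (p \<omega>) b \<epsilon> n\<bar> \<le> \<kappa>)"
    proof (rule holds_up_to_mono, intro eventually_mono[OF eventually_b_pos] ballI impI)
      fix n \<omega> assume n: "1 \<le> n \<and> 0 < b n" and o: "\<omega> \<in> space M"
        and le: "\<bar>LINT t|unit_uniform. min (D n t \<omega>) 1\<bar> \<le> c * min (\<kappa> / 2) (1 / 8) \<and>
          \<bar>measure (p \<omega>) {x. \<epsilon> / 2 * b n \<le> \<bar>x\<bar>}\<bar> \<le> 1 / 2"
      interpret P: real_distribution "p \<omega>" by (rule p_real_distribution[OF o])
      interpret R: real_distribution "symmetrized (p \<omega>)" by (rule P.real_distribution_symmetrized)
      define q where "q = exceedance (symmetrized (p \<omega>)) b (\<epsilon> / 2) n"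
      have "min q (1/4) * c \<le> (LINT t|unit_uniform. min (D n t \<omega>) 1)"
        unfolding D[OF o] nongaussian_defect_def q_def using n e2 c(2) by (intro R.exceedance_le_integral) auto
      also have "\<dots> \<le> c * min (\<kappa> / 2) (1 / 8)" by (rule order_trans[OF abs_ge_self conjunct1[OF le]])
      also have "\<dots> = min (\<kappa> / 2) (1 / 8) * c" by (rule mult.commute)
      finally have "min q (1/4) \<le> min (\<kappa> / 2) (1 / 8)" using c(1) by (simp only: mult_le_cancel_right_pos)
      then have "q \<le> \<kappa> / 2" by (auto simp: min_def split: if_splits)
      moreover have "exceedance (p \<omega>) b \<epsilon> n \<le> 2 * q"
        unfolding q_def using le by (intro P.exceedance_le_symmetrized) auto
      ultimately show "\<bar>exceedance (p \<omega>) b \<epsilon> n\<bar> \<le> \<kappa>"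
        using exceedance_nonneg[of "p \<omega>" b \<epsilon> n] by linarith
    qed
  qed
qed

text \<open>
  With \<open>\<tau> = 1\<close> and \<open>t = 1/2\<close> the condition \<open>2 \<tau> t \<le> 1\<close> of \<open>trunc_var_le_char_deficit\<close> holds.
\<close>

lemma tvar_tight: "bounded_in_prob M (tvar 1)"
  unfolding bounded_in_prob_def
proof (intro allI impI)
  fix \<eta> :: real assume \<eta>: "\<eta> > 0"
  then obtain \<delta> where d: "\<delta> > 0" "holds_up_to M (\<eta> / 2) (\<lambda>n \<omega>. \<delta> \<le> sq_char n (1/2) \<omega>)"
    using sq_char_bounded_below[of "1/2" "\<eta> / 2"] by auto
  have "holds_up_to M (\<eta> / 2) (\<lambda>n \<omega>. \<bar>exceedance (p \<omega>) b 1 n\<bar> \<le> 1)"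
    using \<eta> by (intro vanishes_in_probD[OF tails_vanish]) auto
  from holds_up_to_conj[OF d(2) this]
  have "holds_up_to M \<eta> (\<lambda>n \<omega>. \<delta> \<le> sq_char n (1/2) \<omega> \<and> \<bar>exceedance (p \<omega>) b 1 n\<bar> \<le> 1)" by simp
  then have "holds_up_to M \<eta> (\<lambda>n \<omega>. \<bar>tvar 1 n \<omega>\<bar> \<le> 8 / \<delta> + 1)"
  proof (rule holds_up_to_mono, intro eventually_mono[OF eventually_b_pos] ballI impI)
    fix n \<omega> assume n: "1 \<le> n \<and> 0 < b n" and o: "\<omega> \<in> space M"
      and le: "\<delta> \<le> sq_char n (1/2) \<omega> \<and> \<bar>exceedance (p \<omega>) b 1 n\<bar> \<le> 1"
    interpret P: real_distribution "p \<omega>" by (rule p_real_distribution[OF o])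
    let ?X = "char_deficit (p \<omega>) b n (1/2)"
    have "?X * \<delta> \<le> ?X * sq_char n (1/2) \<omega>"
      using le P.char_deficit_nonneg[of b n "1/2"] by (intro mult_left_mono) auto
    also have "\<dots> \<le> 1" using P.char_deficit_le_inverse[of n b "1/2"] n by (simp add: sq_char_def)
    finally have X: "?X \<le> 1 / \<delta>" using d by (simp add: field_simps)
    have "tvar 1 n \<omega> \<le> 2 * ?X / (1/2)\<^sup>2 + 1\<^sup>2 * exceedance (p \<omega>) b 1 n"
      using n by (intro P.trunc_var_le_char_deficit) auto
    also have "\<dots> = 8 * ?X + exceedance (p \<omega>) b 1 n" by (simp add: power2_eq_square)
    also have "\<dots> \<le> 8 / \<delta> + 1" using mult_left_mono[OF X, of 8] abs_le_D1[OF conjunct2[OF le]] by simp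
    finally show "\<bar>tvar 1 n \<omega>\<bar> \<le> 8 / \<delta> + 1"
      using tvar_nonneg[OF _ o, of 1 n] by simp
  qed
  then show "\<exists>K>0. holds_up_to M \<eta> (\<lambda>n \<omega>. \<bar>tvar 1 n \<omega>\<bar> \<le> K)"
    using d by (intro exI[of _ "8 / \<delta> + 1"]) (auto intro: add_pos_pos)
qed

text \<open>
  The squared modulus at \<open>t = sqrt s\<close> is asymptotically \<open>exp (- s v)\<close>, and its expectation
  converges by assumption.
\<close>

lemma laplace_limit:
  assumes s: "s > 0"
  shows "(\<lambda>n. expectation (\<lambda>\<omega>. exp (- (s * tvar 1 n \<omega>)))) \<longlonglongrightarrow> laplace \<pi> s"
proof -
  define t where "t = sqrt s"
  have t2: "t\<^sup>2 = s" using s by (simp add: t_def)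
  let ?w = "\<lambda>n \<omega>. iexp (t * (tmean 1 n \<omega> - a n / b n)) * exp (- (t\<^sup>2 * tvar 1 n \<omega> / 2))"
  have w2: "(cmod (?w n \<omega>))\<^sup>2 = exp (- (s * tvar 1 n \<omega>))" for n \<omega>
    using t2 by (simp add: norm_mult power_mult_distrib exp_of_nat_mult[symmetric])
  have c2: "(cmod (centred_char (p \<omega>) a b n t))\<^sup>2 = sq_char n t \<omega>" for n \<omega>
    by (simp add: centred_char_def sq_char_def norm_mult norm_power power_mult[symmetric] mult.commute)
  have "(\<lambda>n. expectation (\<lambda>\<omega>. sq_char n t \<omega> - exp (- (s * tvar 1 n \<omega>)))) \<longlonglongrightarrow> 0"
  proof (rule expectation_tendsto_zero[where B=1])
    show "norm (sq_char n t \<omega> - exp (- (s * tvar 1 n \<omega>))) \<le> 1" if "\<omega> \<in> space M" for n \<omega>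
    proof -
      have "0 \<le> sq_char n t \<omega> \<and> sq_char n t \<omega> \<le> 1" using sq_char_01[OF that, of n t] by simp
      moreover have "0 \<le> exp (- (s * tvar 1 n \<omega>)) \<and> exp (- (s * tvar 1 n \<omega>)) \<le> 1"
        using exp_tvar_01[OF zero_less_one that less_imp_le[OF s], of n] by simp
      ultimately show ?thesis unfolding real_norm_def by linarith
    qed
    show "vanishes_in_prob M (\<lambda>n \<omega>. norm (sq_char n t \<omega> - exp (- (s * tvar 1 n \<omega>))))"
    proof (rule vanishes_in_prob_le[OF vanishes_in_prob_add])
      show "vanishes_in_prob M (\<lambda>n \<omega>. cmod (centred_char (p \<omega>) a b n t - ?w n \<omega>))"
        by (rule centred_char_approx[OF tails_vanish tvar_tight]) simp_all
      then show "vanishes_in_prob M (\<lambda>n \<omega>. cmod (centred_char (p \<omega>) a b n t - ?w n \<omega>))" .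
      show "\<forall>\<^sub>F n in sequentially. \<forall>\<omega>\<in>space M. \<bar>norm (sq_char n t \<omega> - exp (- (s * tvar 1 n \<omega>)))\<bar>
        \<le> \<bar>cmod (centred_char (p \<omega>) a b n t - ?w n \<omega>) + cmod (centred_char (p \<omega>) a b n t - ?w n \<omega>)\<bar>"
      proof (intro always_eventually allI ballI)
        fix n \<omega> assume o: "\<omega> \<in> space M"
        let ?x = "cmod (centred_char (p \<omega>) a b n t)" and ?y = "cmod (?w n \<omega>)"
        have x: "0 \<le> ?x" "?x \<le> 1" using norm_centred_char_le[OF o] by auto
        have y: "0 \<le> ?y" "?y \<le> 1" using tvar_nonneg[OF _ o, of 1 n] by (auto simp: norm_mult)
        have "\<bar>?x\<^sup>2 - ?y\<^sup>2\<bar> \<le> real 2 * \<bar>?x - ?y\<bar>"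
          using norm_power_diff[of ?x ?y 2] x y by simp
        also have "\<dots> \<le> 2 * cmod (centred_char (p \<omega>) a b n t - ?w n \<omega>)"
          using norm_triangle_ineq3[of "centred_char (p \<omega>) a b n t" "?w n \<omega>"] by simp
        finally show "\<bar>norm (sq_char n t \<omega> - exp (- (s * tvar 1 n \<omega>)))\<bar>
          \<le> \<bar>cmod (centred_char (p \<omega>) a b n t - ?w n \<omega>) + cmod (centred_char (p \<omega>) a b n t - ?w n \<omega>)\<bar>"
          unfolding w2 c2 by simp
      qed
    qed
  qed measurable
  moreover have "(\<lambda>n. expectation (\<lambda>\<omega>. sq_char n t \<omega>)) \<longlonglongrightarrow> laplace \<pi> s"
    using sq_char_power_limit[of 1 t] by (simp add: t2)
  ultimately have "(\<lambda>n. expectation (\<lambda>\<omega>. sq_char n t \<omega>)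
      - expectation (\<lambda>\<omega>. sq_char n t \<omega> - exp (- (s * tvar 1 n \<omega>)))) \<longlonglongrightarrow> laplace \<pi> s - 0"
    by (intro tendsto_diff)
  moreover have "integrable M (sq_char n t)" for n
    using integrable_sq_char_prod[of n t 1 t 0] by simp
  ultimately show ?thesis
    using integrable_exp_tvar[of 1 s] s by simp
qed

text \<open>
  After removing the phase \<open>exp (i t \<gamma>)\<close>, the products of two characteristic functions at
  frequencies \<open>t\<close> or \<open>- t\<close> all have the same limit in mean, so the second moment of the imaginary part tends to 0.  By the normal approximation the imaginary part is
  \<open>sin (t D) exp (- t\<^sup>2 v / 2)\<close> with \<open>D\<close> the deviation of the centred truncated mean from \<open>\<gamma>\<close>; as the
  variance is bounded in probability, \<open>sin (t D)\<close> vanishes for each \<open>t\<close>.  Averaging over \<open>t\<close> excludes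
  that \<open>D\<close> stays near nonzero multiples of \<open>\<pi> / t\<close>.
\<close>

lemma mean_limit: "vanishes_in_prob M (\<lambda>n \<omega>. tmean 1 n \<omega> - a n / b n - \<gamma>)"
proof -
  let ?D = "\<lambda>n \<omega>. tmean 1 n \<omega> - a n / b n - \<gamma>"
  let ?\<psi> = "\<lambda>n t \<omega>. iexp (- (t * \<gamma>)) * centred_char (p \<omega>) a b n t"
  have cnj: "cnj (?\<psi> n t \<omega>) = ?\<psi> n (- t) \<omega>" for n t \<omega>
  proof -
    have "cnj (char (p \<omega>) u) = char (p \<omega>) (- u)" for u
    proof -
      have "cnj (char (p \<omega>) u) = (CLINT x|p \<omega>. cnj (iexp (u * x)))"
        unfolding char_def by (rule Bochner_Integration.integral_cnj[symmetric])
      then show ?thesis by (simp add: char_def exp_cnj)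
    qed
    then show ?thesis by (simp add: centred_char_def exp_cnj)
  qed
  have im: "vanishes_in_prob M (\<lambda>n \<omega>. (Im (?\<psi> n t \<omega>))\<^sup>2)" for t
  proof -
    have pair: "(\<lambda>n. expectation (\<lambda>\<omega>. ?\<psi> n s \<omega> * ?\<psi> n r \<omega>)) \<longlonglongrightarrow> complex_of_real (laplace \<pi> (t\<^sup>2))"
      if sr: "s\<^sup>2 = t\<^sup>2" "r\<^sup>2 = t\<^sup>2" for s r
    proof -
      let ?t = "\<lambda>k :: nat. if k = 0 then s else r"
      have "(\<lambda>n. expectation (\<lambda>\<omega>. \<Prod>k<2. centred_char (p \<omega>) a b n (?t k)))
          \<longlonglongrightarrow> iexp (\<gamma> * (\<Sum>k<2. ?t k)) * complex_of_real (laplace \<pi> ((\<Sum>k<2. (?t k)\<^sup>2) / 2))"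
        by (rule cf) simp
      moreover have "(\<Prod>k<2. centred_char (p \<omega>) a b n (?t k)) = centred_char (p \<omega>) a b n s * centred_char (p \<omega>) a b n r" for n \<omega>
        by (simp add: numeral_2_eq_2)
      moreover have "(\<Sum>k<2. ?t k) = s + r" "(\<Sum>k<2. (?t k)\<^sup>2) / 2 = t\<^sup>2" using sr by (simp_all add: numeral_2_eq_2)
      ultimately have "(\<lambda>n. expectation (\<lambda>\<omega>. centred_char (p \<omega>) a b n s * centred_char (p \<omega>) a b n r))
          \<longlonglongrightarrow> iexp (\<gamma> * (s + r)) * complex_of_real (laplace \<pi> (t\<^sup>2))" by simp
      from tendsto_mult[OF tendsto_const[of "iexp (- (\<gamma> * (s + r)))"] this]
      have "(\<lambda>n. iexp (- (\<gamma> * (s + r))) * expectation (\<lambda>\<omega>. centred_char (p \<omega>) a b n s * centred_char (p \<omega>) a b n r))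
          \<longlonglongrightarrow> (iexp (- (\<gamma> * (s + r))) * iexp (\<gamma> * (s + r))) * complex_of_real (laplace \<pi> (t\<^sup>2))"
        by (simp only: mult.assoc)
      moreover have "iexp (- (\<gamma> * (s + r))) * iexp (\<gamma> * (s + r)) = 1" by (simp add: exp_add[symmetric])
      moreover have "iexp (- (\<gamma> * (s + r))) * expectation (\<lambda>\<omega>. centred_char (p \<omega>) a b n s * centred_char (p \<omega>) a b n r)
          = expectation (\<lambda>\<omega>. ?\<psi> n s \<omega> * ?\<psi> n r \<omega>)" for n
      proof -
        have i: "iexp (- (\<gamma> * (s + r))) = iexp (- (s * \<gamma>)) * iexp (- (r * \<gamma>))"
          unfolding exp_add[symmetric] by (rule arg_cong[where f=exp]) (simp add: algebra_simps)
        show ?thesis unfolding integral_mult_right_zero[symmetric] i by (simp only: mult_ac)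
      qed
      ultimately show ?thesis by (simp only: mult_1)
    qed
    have ipsi: "integrable M (\<lambda>\<omega>. ?\<psi> n s \<omega> * ?\<psi> n r \<omega>)" for n s r
      using norm_centred_char_le
      by (intro integrable_const_bound[where B=1]) (auto simp: norm_mult intro!: mult_le_one)
    have i2: "complex_of_real ((Im (?\<psi> n t \<omega>))\<^sup>2)
      = (1/2) * (?\<psi> n t \<omega> * ?\<psi> n (- t) \<omega>) - ((1/4) * (?\<psi> n t \<omega> * ?\<psi> n t \<omega>) + (1/4) * (?\<psi> n (- t) \<omega> * ?\<psi> n (- t) \<omega>))" for n \<omega>
    proof -
      have "complex_of_real ((Im z)\<^sup>2) = (1/2) * (z * cnj z) - ((1/4) * (z * z) + (1/4) * (cnj z * cnj z))" for z
        by (simp add: complex_eq_iff power2_eq_square field_simps)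
      from this[of "?\<psi> n t \<omega>"] show ?thesis unfolding cnj .
    qed
    have "(\<lambda>n. (1/2) * expectation (\<lambda>\<omega>. ?\<psi> n t \<omega> * ?\<psi> n (- t) \<omega>) - ((1/4) * expectation (\<lambda>\<omega>. ?\<psi> n t \<omega> * ?\<psi> n t \<omega>)
        + (1/4) * expectation (\<lambda>\<omega>. ?\<psi> n (- t) \<omega> * ?\<psi> n (- t) \<omega>))) \<longlonglongrightarrow>
        (1/2) * complex_of_real (laplace \<pi> (t\<^sup>2)) - ((1/4) * complex_of_real (laplace \<pi> (t\<^sup>2)) + (1/4) * complex_of_real (laplace \<pi> (t\<^sup>2)))"
      by (intro tendsto_intros pair) auto
    moreover have "(1/2) * expectation (\<lambda>\<omega>. ?\<psi> n t \<omega> * ?\<psi> n (- t) \<omega>) - ((1/4) * expectation (\<lambda>\<omega>. ?\<psi> n t \<omega> * ?\<psi> n t \<omega>)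
        + (1/4) * expectation (\<lambda>\<omega>. ?\<psi> n (- t) \<omega> * ?\<psi> n (- t) \<omega>)) = complex_of_real (expectation (\<lambda>\<omega>. (Im (?\<psi> n t \<omega>))\<^sup>2))" for n
      unfolding integral_complex_of_real[symmetric] i2
      by (simp only: integral_mult_right_zero Bochner_Integration.integral_diff Bochner_Integration.integral_add
        ipsi integrable_mult_right Bochner_Integration.integrable_add)
    ultimately have "(\<lambda>n. complex_of_real (expectation (\<lambda>\<omega>. (Im (?\<psi> n t \<omega>))\<^sup>2))) \<longlonglongrightarrow> complex_of_real 0"
      by (simp add: field_simps)
    then have lim: "(\<lambda>n. expectation (\<lambda>\<omega>. (Im (?\<psi> n t \<omega>))\<^sup>2)) \<longlonglongrightarrow> 0" by (simp only: tendsto_of_real_iff)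
    show ?thesis
    proof (rule vanishes_in_prob_of_expectation[OF _ _ lim])
      have "(Im (?\<psi> n t \<omega>))\<^sup>2 \<le> 1" if "\<omega> \<in> space M" for n \<omega>
      proof -
        have "cmod (?\<psi> n t \<omega>) \<le> 1" using norm_centred_char_le[OF that] by (simp add: norm_mult)
        then have "\<bar>Im (?\<psi> n t \<omega>)\<bar> \<le> 1" using abs_Im_le_cmod order_trans by blast
        then show ?thesis using abs_square_le_1 by blast
      qed
      then show "integrable M (\<lambda>\<omega>. (Im (?\<psi> n t \<omega>))\<^sup>2)" for n
        by (intro integrable_const_bound[where B=1]) auto
    qed auto
  qed
  have defect: "vanishes_in_prob M (\<lambda>n \<omega>. (1 - cos (t * (2 * ?D n \<omega>)))\<^sup>2)" for t
    unfolding vanishes_in_prob_def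
  proof (intro allI impI)
    fix \<kappa> \<eta> :: real assume k: "\<kappa> > 0" "\<eta> > 0"
    have "\<eta> / 3 > 0" using k by simp
    with tvar_tight obtain K where K: "K > 0" "holds_up_to M (\<eta> / 3) (\<lambda>n \<omega>. \<bar>tvar 1 n \<omega>\<bar> \<le> K)"
      unfolding bounded_in_prob_def by blast
    define L where "L = exp (- (t\<^sup>2 * K / 2))"
    have L: "L > 0" by (simp add: L_def)
    \<comment> \<open>ensures \<open>(2 \<beta>)\<^sup>2 \<le> \<beta>\<close> and \<open>4 \<beta> \<le> \<kappa>\<close>\<close>
    define \<beta> where "\<beta> = min 1 (\<kappa> / 4) / 4"
    have \<beta>: "0 < \<beta>" "4 * \<beta> \<le> 1" "16 * \<beta> \<le> \<kappa>" using k by (auto simp: \<beta>_def)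
    define d where "d = L * \<beta>"
    have d: "d > 0" using L \<beta> by (simp add: d_def)
    have h1: "holds_up_to M (\<eta> / 3) (\<lambda>n \<omega>. \<bar>(Im (?\<psi> n t \<omega>))\<^sup>2\<bar> \<le> d\<^sup>2)"
      using k d by (intro vanishes_in_probD[OF im]) auto
    have h2: "holds_up_to M (\<eta> / 3) (\<lambda>n \<omega>. \<bar>cmod (centred_char (p \<omega>) a b n t
        - iexp (t * (tmean 1 n \<omega> - a n / b n)) * exp (- (t\<^sup>2 * tvar 1 n \<omega> / 2)))\<bar> \<le> d)"
      using k d by (intro vanishes_in_probD[OF centred_char_approx[OF tails_vanish tvar_tight]]) auto
    from holds_up_to_conj[OF K(2) holds_up_to_conj[OF h1 h2]]
    have "holds_up_to M \<eta> (\<lambda>n \<omega>. \<bar>tvar 1 n \<omega>\<bar> \<le> K \<and> \<bar>(Im (?\<psi> n t \<omega>))\<^sup>2\<bar> \<le> d\<^sup>2 \<and> \<bar>cmod (centred_char (p \<omega>) a b n t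
        - iexp (t * (tmean 1 n \<omega> - a n / b n)) * exp (- (t\<^sup>2 * tvar 1 n \<omega> / 2)))\<bar> \<le> d)" by simp
    then show "holds_up_to M \<eta> (\<lambda>n \<omega>. \<bar>(1 - cos (t * (2 * ?D n \<omega>)))\<^sup>2\<bar> \<le> \<kappa>)"
    proof (rule holds_up_to_mono, intro always_eventually allI ballI impI)
      fix n \<omega> assume o: "\<omega> \<in> space M" and le: "\<bar>tvar 1 n \<omega>\<bar> \<le> K \<and> \<bar>(Im (?\<psi> n t \<omega>))\<^sup>2\<bar> \<le> d\<^sup>2 \<and> \<bar>cmod (centred_char (p \<omega>) a b n t
        - iexp (t * (tmean 1 n \<omega> - a n / b n)) * exp (- (t\<^sup>2 * tvar 1 n \<omega> / 2)))\<bar> \<le> d"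
      let ?e = "exp (- (t\<^sup>2 * tvar 1 n \<omega> / 2))"
      let ?w = "iexp (t * (tmean 1 n \<omega> - a n / b n)) * complex_of_real ?e"
      have eL: "L \<le> ?e"
      proof -
        have "t\<^sup>2 * tvar 1 n \<omega> \<le> t\<^sup>2 * K" using le by (intro mult_left_mono) auto
        then show ?thesis by (simp add: L_def)
      qed
      have w: "iexp (- (t * \<gamma>)) * ?w = iexp (t * ?D n \<omega>) * ?e"
      proof -
        have "iexp (- (t * \<gamma>)) * iexp (t * (tmean 1 n \<omega> - a n / b n)) = iexp (t * ?D n \<omega>)"
          unfolding exp_add[symmetric] by (rule arg_cong[where f=exp]) (simp add: algebra_simps)
        then show ?thesis by (simp only: mult.assoc[symmetric])
      qed
      have "\<bar>Im (?\<psi> n t \<omega> - iexp (- (t * \<gamma>)) * ?w)\<bar> \<le> cmod (?\<psi> n t \<omega> - iexp (- (t * \<gamma>)) * ?w)"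
        by (rule abs_Im_le_cmod)
      also have "\<dots> = cmod (centred_char (p \<omega>) a b n t - ?w)"
        by (simp only: right_diff_distrib[symmetric] norm_mult) simp
      also have "\<dots> \<le> d" using le by simp
      finally have i1: "\<bar>Im (?\<psi> n t \<omega>) - Im (iexp (t * ?D n \<omega>) * ?e)\<bar> \<le> d" unfolding w minus_complex.sel .
      have "\<bar>Im (?\<psi> n t \<omega>)\<bar>\<^sup>2 \<le> d\<^sup>2" using le by simp
      then have "\<bar>Im (?\<psi> n t \<omega>)\<bar> \<le> d" using d by (meson less_imp_le power2_le_imp_le)
      then have "\<bar>Im (iexp (t * ?D n \<omega>) * ?e)\<bar> \<le> 2 * d" using i1 by linarith
      moreover have "Im (iexp (t * ?D n \<omega>) * ?e) = sin (t * ?D n \<omega>) * ?e"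
        by (simp only: Im_complex_of_real Re_complex_of_real times_complex.sel Im_exp) (simp add: Im_exp)
      ultimately have "\<bar>sin (t * ?D n \<omega>)\<bar> * ?e \<le> 2 * d" by (simp add: abs_mult)
      moreover have "\<bar>sin (t * ?D n \<omega>)\<bar> * L \<le> \<bar>sin (t * ?D n \<omega>)\<bar> * ?e" using eL by (intro mult_left_mono) auto
      ultimately have "\<bar>sin (t * ?D n \<omega>)\<bar> * L \<le> 2 * d" by (rule order_trans[rotated])
      also have "\<dots> = (2 * \<beta>) * L" by (simp add: d_def)
      finally have "\<bar>sin (t * ?D n \<omega>)\<bar> * L \<le> (2 * \<beta>) * L" .
      then have sb: "\<bar>sin (t * ?D n \<omega>)\<bar> \<le> 2 * \<beta>" using L by (simp only: mult_le_cancel_right_pos)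
      have c: "1 - cos (t * (2 * ?D n \<omega>)) = 2 * (sin (t * ?D n \<omega>))\<^sup>2"
        using cos_double_sin[of "t * ?D n \<omega>"] by (simp add: mult.left_commute)
      have "(sin (t * ?D n \<omega>))\<^sup>2 \<le> (2 * \<beta>)\<^sup>2" using power_mono[OF sb, of 2] by simp
      also have "\<dots> \<le> \<beta>" using \<beta> mult_right_mono[of "4 * \<beta>" 1 \<beta>] by (simp add: power2_eq_square)
      finally have s2: "(sin (t * ?D n \<omega>))\<^sup>2 \<le> \<beta>" .
      have "(1 - cos (t * (2 * ?D n \<omega>)))\<^sup>2 = 4 * ((sin (t * ?D n \<omega>))\<^sup>2 * (sin (t * ?D n \<omega>))\<^sup>2)"
        unfolding c by (simp add: power2_eq_square)
      also have "\<dots> \<le> 4 * (\<beta> * 1)"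
        using s2 \<beta>(1) by (intro mult_left_mono mult_mono) (auto simp: abs_square_le_1)
      also have "\<dots> \<le> \<kappa>" using \<beta> by linarith
      finally show "\<bar>(1 - cos (t * (2 * ?D n \<omega>)))\<^sup>2\<bar> \<le> \<kappa>" by simp
    qed
  qed
  have Dm: "(\<lambda>z. (1 - cos (fst z * (2 * ?D n (snd z))))\<^sup>2) \<in> borel_measurable (borel \<Otimes>\<^sub>M M)" for n
    by measurable
  have avg: "vanishes_in_prob M (\<lambda>n \<omega>. LINT t|unit_uniform. min ((1 - cos (t * (2 * ?D n \<omega>)))\<^sup>2) 1)"
    by (rule vanishes_in_prob_unit_average[OF Dm _ defect]) simp
  show ?thesis
    unfolding vanishes_in_prob_def
  proof (intro allI impI)
    fix \<kappa> \<eta> :: real assume k: "\<kappa> > 0" "\<eta> > 0"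
    obtain c where c: "c > 0" "\<And>y. \<kappa> \<le> \<bar>y\<bar> \<Longrightarrow> c \<le> (LINT t|unit_uniform. (1 - cos (t * y))\<^sup>2)"
      using integral_one_minus_cos_ge[OF k(1)] by blast
    have "holds_up_to M \<eta> (\<lambda>n \<omega>. \<bar>LINT t|unit_uniform. min ((1 - cos (t * (2 * ?D n \<omega>)))\<^sup>2) 1\<bar> \<le> c / 8)"
      using k c by (intro vanishes_in_probD[OF avg]) auto
    then show "holds_up_to M \<eta> (\<lambda>n \<omega>. \<bar>?D n \<omega>\<bar> \<le> \<kappa>)"
    proof (rule holds_up_to_mono, intro always_eventually allI ballI impI)
      fix n \<omega> assume o: "\<omega> \<in> space M" and le: "\<bar>LINT t|unit_uniform. min ((1 - cos (t * (2 * ?D n \<omega>)))\<^sup>2) 1\<bar> \<le> c / 8"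
      interpret U: prob_space unit_uniform by (rule prob_space_unit_uniform)
      show "\<bar>?D n \<omega>\<bar> \<le> \<kappa>"
      proof (rule ccontr)
        assume "\<not> \<bar>?D n \<omega>\<bar> \<le> \<kappa>"
        then have "\<kappa> \<le> \<bar>2 * ?D n \<omega>\<bar>" using k(1) by (simp add: abs_mult)
        from c(2)[OF this] have "c \<le> (LINT t|unit_uniform. (1 - cos (t * (2 * ?D n \<omega>)))\<^sup>2)" .
        also have "\<dots> \<le> (LINT t|unit_uniform. 4 * min ((1 - cos (t * (2 * ?D n \<omega>)))\<^sup>2) 1)"
        proof (intro integral_mono integrable_mult_right)
          have f4: "(1 - cos x)\<^sup>2 \<le> 4" for x :: real
          proof -
            have "\<bar>1 - cos x\<bar> \<le> 2" using abs_cos_le_one[of x] by linarith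
            from power_mono[OF this, of 2] show ?thesis by simp
          qed
          have um: "(\<lambda>t. (1 - cos (t * y))\<^sup>2) \<in> borel_measurable unit_uniform" for y
            by (subst measurable_cong_sets[OF sets_unit_uniform refl]) measurable
          have "integrable unit_uniform (\<lambda>t. (1 - cos (t * y))\<^sup>2)" for y
            by (rule U.integrable_const_bound[where B=4, OF _ um]) (simp add: f4)
          then show "integrable unit_uniform (\<lambda>t. (1 - cos (t * (2 * ?D n \<omega>)))\<^sup>2)" .
          have "integrable unit_uniform (\<lambda>t. min ((1 - cos (t * y))\<^sup>2) 1)" for y
            by (rule U.integrable_const_bound[where B=1, OF _ borel_measurable_min[OF borel_measurable_const um]]) simp
          then show "integrable unit_uniform (\<lambda>t. min ((1 - cos (t * (2 * ?D n \<omega>)))\<^sup>2) 1)" .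
          show "(1 - cos (t * (2 * ?D n \<omega>)))\<^sup>2 \<le> 4 * min ((1 - cos (t * (2 * ?D n \<omega>)))\<^sup>2) 1" for t
            using f4[of "t * (2 * ?D n \<omega>)"] zero_le_power2[of "1 - cos (t * (2 * ?D n \<omega>))"] unfolding min_def by simp
        qed
        also have "\<dots> = 4 * (LINT t|unit_uniform. min ((1 - cos (t * (2 * ?D n \<omega>)))\<^sup>2) 1)" by simp
        also have "\<dots> \<le> c / 2" using le by linarith
        finally show False using c(1) by simp
      qed
    qed
  qed
qed

end

end

section \<open>The limit law and the normalising constants\<close>

lemma weakly_converges_imp_char:
  fixes \<mu> :: "nat \<Rightarrow> (nat \<Rightarrow> real) measure" and t :: "nat \<Rightarrow> real" and m :: nat
  assumes \<mu>: "\<And>n. prob_space (\<mu> n)" "\<And>n. sets (\<mu> n) = sets borel"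
    and \<nu>: "prob_space \<nu>" "sets \<nu> = sets borel" and w: "weakly_converges \<mu> \<nu>"
  shows "(\<lambda>n. \<integral>s. exp (\<i> * complex_of_real (\<Sum>k<m. t k * s k)) \<partial>\<mu> n)
    \<longlonglongrightarrow> (\<integral>s. exp (\<i> * complex_of_real (\<Sum>k<m. t k * s k)) \<partial>\<nu>)"
proof -
  let ?S = "\<lambda>s :: nat \<Rightarrow> real. \<Sum>k<m. t k * s k"
  have cS: "continuous_on UNIV ?S" by (intro continuous_intros continuous_on_product_coordinates)
  have cc: "continuous_on UNIV (\<lambda>s. cos (?S s))" "continuous_on UNIV (\<lambda>s. sin (?S s))"
    using cS by (auto intro: continuous_on_cos continuous_on_sin)
  have bb: "bounded (range (\<lambda>s. cos (?S s)))" "bounded (range (\<lambda>s. sin (?S s)))"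
    by (auto intro!: boundedI[where B=1])
  have Sm: "?S \<in> borel_measurable borel" by (rule borel_measurable_continuous_onI[OF cS])
  have RI: "Re (\<integral>s. exp (\<i> * complex_of_real (?S s)) \<partial>\<kappa>) = (\<integral>s. cos (?S s) \<partial>\<kappa>)"
      "Im (\<integral>s. exp (\<i> * complex_of_real (?S s)) \<partial>\<kappa>) = (\<integral>s. sin (?S s) \<partial>\<kappa>)"
    if "prob_space \<kappa>" "sets \<kappa> = sets borel" for \<kappa>
  proof -
    interpret K: prob_space \<kappa> by fact
    have "?S \<in> borel_measurable \<kappa>" using Sm by (simp add: measurable_cong_sets[OF that(2) refl])
    then have i: "integrable \<kappa> (\<lambda>s. exp (\<i> * complex_of_real (?S s)))"
      by (intro K.integrable_const_bound[where B=1]) (auto simp del: of_real_sum)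
    show "Re (\<integral>s. exp (\<i> * complex_of_real (?S s)) \<partial>\<kappa>) = (\<integral>s. cos (?S s) \<partial>\<kappa>)"
      by (subst integral_Re[OF i, symmetric]) (simp add: Re_exp del: of_real_sum)
    show "Im (\<integral>s. exp (\<i> * complex_of_real (?S s)) \<partial>\<kappa>) = (\<integral>s. sin (?S s) \<partial>\<kappa>)"
      by (subst integral_Im[OF i, symmetric]) (simp add: Im_exp del: of_real_sum)
  qed
  show ?thesis
    unfolding tendsto_complex_iff RI[OF \<mu>] RI[OF \<nu>]
    using w[unfolded weakly_converges_def, rule_format, OF cc(1) bb(1)]
      w[unfolded weakly_converges_def, rule_format, OF cc(2) bb(2)] by (rule conjI)
qed

context variance_law
begin

text \<open>
  The law of \<open>\<gamma> + sqrt v \<cdot> Z\<^sub>k\<close> with \<open>v\<close> of law \<open>\<pi>\<close> and independent standard normal \<open>Z\<^sub>k\<close>.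
\<close>

lemma mixture_exists:
  assumes f: "measure \<pi> {v. v < \<infinity>} = 1"
  obtains \<nu> :: "(nat \<Rightarrow> real) measure" where "prob_space \<nu>" "sets \<nu> = sets borel"
    "normal_variance_mixture \<gamma> \<pi> \<nu>"
proof -
  let ?N = "std_normal_distribution"
  interpret No: real_distribution ?N by (rule real_dist_normal_dist)
  interpret Q: product_prob_space "\<lambda>_ :: nat. ?N" UNIV by (rule product_prob_spaceI) (rule No.prob_space_axioms)
  define Q where "Q = PiM (UNIV :: nat set) (\<lambda>_. ?N)"
  interpret QP: prob_space Q unfolding Q_def by (rule prob_space_PiM) (rule No.prob_space_axioms)
  interpret P: pair_prob_space \<pi> Q ..
  have Qk[measurable]: "(\<lambda>z. z k) \<in> borel_measurable Q" for k
  proof -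
    have "(\<lambda>z. z k) \<in> Q \<rightarrow>\<^sub>M ?N" unfolding Q_def by (rule measurable_component_singleton) simp
    then show ?thesis by simp
  qed
  define T where "T = (\<lambda>(v, z) k :: nat. \<gamma> + sqrt (enn2real v) * (z k :: real))"
  have Tm: "T \<in> (\<pi> \<Otimes>\<^sub>M Q) \<rightarrow>\<^sub>M borel"
  proof (rule measurable_coordinatewise_then_product)
    have [measurable]: "(\<lambda>x. snd x k) \<in> borel_measurable (\<pi> \<Otimes>\<^sub>M Q)" for k
      by (rule measurable_compose[OF measurable_snd Qk])
    have [measurable]: "(\<lambda>x. enn2real (fst x)) \<in> borel_measurable (\<pi> \<Otimes>\<^sub>M Q)"
      by measurable
    show "(\<lambda>x. T x k) \<in> borel_measurable (\<pi> \<Otimes>\<^sub>M Q)" for k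
      unfolding T_def split_beta' by measurable
  qed
  define \<nu> where "\<nu> = distr (\<pi> \<Otimes>\<^sub>M Q) borel T"
  have inner: "(\<integral>z. exp (\<i> * complex_of_real (\<Sum>k<m. t k * T (v, z) k)) \<partial>Q)
      = (\<Prod>k<m. exp (\<i> * complex_of_real (t k * \<gamma>) - complex_of_real ((t k)\<^sup>2 * enn2real v / 2)))" for m t v
  proof -
    let ?r = "sqrt (enn2real v)"
    let ?g = "\<lambda>k x. iexp (t k * \<gamma>) * iexp (t k * ?r * x)"
    have "(\<integral>z. exp (\<i> * complex_of_real (\<Sum>k<m. t k * T (v, z) k)) \<partial>Q) = (\<integral>z. (\<Prod>k<m. ?g k (z k)) \<partial>Q)"
    proof (intro Bochner_Integration.integral_cong refl)
      fix z :: "nat \<Rightarrow> real"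
      have "exp (\<i> * complex_of_real (\<Sum>k<m. t k * T (v, z) k)) = (\<Prod>k<m. iexp (t k * T (v, z) k))"
        by (simp add: exp_sum[symmetric] sum_distrib_left)
      also have "\<dots> = (\<Prod>k<m. ?g k (z k))"
      proof (intro prod.cong refl)
        fix k
        show "iexp (t k * T (v, z) k) = ?g k (z k)"
          unfolding exp_add[symmetric] T_def by (rule arg_cong[where f=exp]) (simp add: algebra_simps)
      qed
      finally show "exp (\<i> * complex_of_real (\<Sum>k<m. t k * T (v, z) k)) = (\<Prod>k<m. ?g k (z k))" .
    qed
    also have "\<dots> = (\<integral>z. (\<Prod>k<m. ?g k (restrict z {..<m} k)) \<partial>Q)"
      by (intro Bochner_Integration.integral_cong refl prod.cong) auto
    also have "\<dots> = (\<integral>z. (\<Prod>k<m. ?g k (z k)) \<partial>distr Q (PiM {..<m} (\<lambda>_. ?N)) (\<lambda>z. restrict z {..<m}))"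
    proof (rule integral_distr[symmetric])
      show "(\<lambda>z. restrict z {..<m}) \<in> Q \<rightarrow>\<^sub>M PiM {..<m} (\<lambda>_. ?N)"
        unfolding Q_def by (rule measurable_restrict_subset) simp
      show "(\<lambda>z. \<Prod>k<m. ?g k (z k)) \<in> borel_measurable (PiM {..<m} (\<lambda>_. ?N))"
      proof (intro borel_measurable_prod)
        fix k assume k: "k \<in> {..<m}"
        have [measurable]: "(\<lambda>z. z k) \<in> borel_measurable (PiM {..<m} (\<lambda>_. ?N))"
          using measurable_component_singleton[OF k, of "\<lambda>_. ?N"] by simp
        show "(\<lambda>z. ?g k (z k)) \<in> borel_measurable (PiM {..<m} (\<lambda>_. ?N))" by measurable
      qed
    qed
    also have "distr Q (PiM {..<m} (\<lambda>_. ?N)) (\<lambda>z. restrict z {..<m}) = PiM {..<m} (\<lambda>_. ?N)"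
      unfolding Q_def by (rule Q.distr_PiM_restrict_finite) auto
    also have "(\<integral>z. (\<Prod>k<m. ?g k (z k)) \<partial>PiM {..<m} (\<lambda>_. ?N)) = (\<Prod>k<m. \<integral>x. ?g k x \<partial>?N)"
      by (intro Q.product_integral_prod No.integrable_const_bound[where B=1]) (auto simp: norm_mult)
    also have "\<dots> = (\<Prod>k<m. iexp (t k * \<gamma>) * char ?N (t k * ?r))"
      unfolding char_def by (simp only: integral_mult_right_zero)
    also have "\<dots> = (\<Prod>k<m. exp (\<i> * complex_of_real (t k * \<gamma>) - complex_of_real ((t k)\<^sup>2 * enn2real v / 2)))"
    proof (intro prod.cong refl)
      fix k
      have "char ?N (t k * ?r) = exp (complex_of_real (- ((t k)\<^sup>2 * enn2real v / 2)))"
        unfolding char_std_normal_distribution exp_of_real by (simp add: power_mult_distrib)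
      then show "iexp (t k * \<gamma>) * char ?N (t k * ?r) = exp (\<i> * complex_of_real (t k * \<gamma>) - complex_of_real ((t k)\<^sup>2 * enn2real v / 2))"
        by (simp only: exp_add[symmetric] of_real_minus add_uminus_conv_diff)
    qed
    finally show ?thesis .
  qed
  have "normal_variance_mixture \<gamma> \<pi> \<nu>"
    unfolding normal_variance_mixture_def
  proof (intro allI impI)
    fix m :: nat and t :: "nat \<Rightarrow> real"
    have em: "(\<lambda>s :: nat \<Rightarrow> real. exp (\<i> * complex_of_real (\<Sum>k<m. t k * s k))) \<in> borel_measurable borel"
      by (intro borel_measurable_continuous_onI continuous_intros continuous_on_product_coordinates)
    have "(\<integral>s. exp (\<i> * complex_of_real (\<Sum>k<m. t k * s k)) \<partial>\<nu>)
        = (\<integral>x. exp (\<i> * complex_of_real (\<Sum>k<m. t k * T x k)) \<partial>(\<pi> \<Otimes>\<^sub>M Q))"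
      unfolding \<nu>_def by (rule integral_distr[OF Tm em])
    also have "\<dots> = (\<integral>v. \<integral>z. exp (\<i> * complex_of_real (\<Sum>k<m. t k * T (v, z) k)) \<partial>Q \<partial>\<pi>)"
    proof (rule P.integral_fst'[symmetric], rule P.P.integrable_const_bound[where B=1])
      show "(\<lambda>x. exp (\<i> * complex_of_real (\<Sum>k<m. t k * T x k))) \<in> borel_measurable (\<pi> \<Otimes>\<^sub>M Q)"
        using measurable_compose[OF Tm em] .
    qed (simp del: of_real_sum)
    also have "\<dots> = (LINT v:{v. v < \<infinity>}|\<pi>. (\<Prod>k<m. exp (\<i> * complex_of_real (t k * \<gamma>) - complex_of_real ((t k)\<^sup>2 * enn2real v / 2))))"
      unfolding inner set_lebesgue_integral_def
    proof (rule integral_cong_AE)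
      have "AE v in \<pi>. v < \<infinity>" using N.AE_prob_1[OF f] by simp
      then show "AE v in \<pi>. (\<Prod>k<m. exp (\<i> * complex_of_real (t k * \<gamma>) - complex_of_real ((t k)\<^sup>2 * enn2real v / 2)))
        = indicator {v. v < \<infinity>} v *\<^sub>R (\<Prod>k<m. exp (\<i> * complex_of_real (t k * \<gamma>) - complex_of_real ((t k)\<^sup>2 * enn2real v / 2)))"
        by eventually_elim simp
    qed measurable
    finally show "(\<integral>s. exp (\<i> * complex_of_real (\<Sum>k<m. t k * s k)) \<partial>\<nu>) = \<dots>" .
  qed
  moreover have "prob_space \<nu>" unfolding \<nu>_def by (rule P.P.prob_space_distr[OF Tm])
  moreover have "sets \<nu> = sets borel" by (simp add: \<nu>_def)
  ultimately show ?thesis using that by blast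
qed

text \<open>
  A constant coordinate has a characteristic function of modulus 1, while \<open>L (1/2) < L 0 = 1\<close>
  unless \<open>\<pi>\<close> is the unit mass at 0.  Conversely \<open>L = 1\<close> gives the characteristic function of a
  point mass.
\<close>

lemma mixture_degenerate_iff:
  assumes f: "measure \<pi> {v. v < \<infinity>} = 1" and \<nu>: "prob_space \<nu>" "sets \<nu> = sets borel"
    and mix: "normal_variance_mixture \<gamma> \<pi> \<nu>"
  shows "(\<exists>c. AE s in \<nu>. s 0 = c) \<longleftrightarrow> \<pi> = return borel 0"
proof -
  interpret K: prob_space \<nu> by (rule \<nu>)
  have s0m: "(\<lambda>s :: nat \<Rightarrow> real. s 0) \<in> borel_measurable \<nu>"
    using measurable_coord_borel[of 0] by (simp add: measurable_cong_sets[OF \<nu>(2) refl])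
  define d where "d = distr \<nu> borel (\<lambda>s :: nat \<Rightarrow> real. s 0)"
  have dr: "real_distribution d" unfolding d_def by (rule K.real_distribution_distr[OF s0m])
  have ch: "char d t = iexp (\<gamma> * t) * complex_of_real (laplace \<pi> (t\<^sup>2 / 2))" for t
  proof -
    have "char d t = (\<integral>s. exp (\<i> * complex_of_real (\<Sum>k<1. t * s k)) \<partial>\<nu>)"
      unfolding char_def d_def using s0m by (subst integral_distr) auto
    also note mix[unfolded normal_variance_mixture_def, rule_format, OF order_refl, of "\<lambda>_. t"]
    also note mixture_eq_laplace[where m=1 and t="\<lambda>_. t" and \<gamma>=\<gamma>]
    finally show ?thesis by simp
  qed
  show ?thesis
  proof
    assume "\<exists>c. AE s in \<nu>. s 0 = c"
    then obtain c where c: "AE s in \<nu>. s 0 = c" by blast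
    have "char d 1 = (\<integral>s. iexp (1 * s 0) \<partial>\<nu>)"
      unfolding char_def d_def using s0m by (subst integral_distr) auto
    also have "\<dots> = (\<integral>s. iexp c \<partial>\<nu>)"
    proof (rule integral_cong_AE)
      show "AE s in \<nu>. iexp (1 * s 0) = iexp c" using c by eventually_elim simp
      show "(\<lambda>s. iexp (1 * s 0)) \<in> borel_measurable \<nu>" using s0m by measurable
    qed simp
    finally have "cmod (char d 1) = 1" by (simp add: K.prob_space)
    then have "\<bar>laplace \<pi> (1 / 2)\<bar> = 1" by (simp add: ch norm_mult)
    moreover have "0 \<le> laplace \<pi> (1 / 2)"
      unfolding laplace_eq using exp_neg_01[of "1 / 2"] by (intro Bochner_Integration.integral_nonneg) auto
    ultimately have "laplace \<pi> (1 / 2) = laplace \<pi> 0" using f by (simp add: laplace_0)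
    then show "\<pi> = return borel 0"
      using laplace_strict_antimono[OF _ f, of 0 "1 / 2"] by auto
  next
    assume e: "\<pi> = return borel 0"
    have L1: "laplace \<pi> s = 1" for s
      unfolding laplace_eq by (subst e, subst integral_return) (auto simp: exp_neg_def)
    have r: "real_distribution (return borel \<gamma>)"
      unfolding real_distribution_def real_distribution_axioms_def by (simp add: prob_space_return)
    have "char (return borel \<gamma>) = char d"
    proof
      fix t
      have "char (return borel \<gamma>) t = iexp (t * \<gamma>)"
        unfolding char_def by (rule integral_return) (auto simp del: of_real_mult)
      also have "\<dots> = char d t" unfolding ch L1 by (simp add: mult.commute)
      finally show "char (return borel \<gamma>) t = char d t" .
    qed
    from Levy_uniqueness[OF r dr this] have "d = return borel \<gamma>" by simp
    moreover have "AE x in return borel \<gamma>. x = \<gamma>" by (subst AE_return) auto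
    ultimately have "AE x in d. x = \<gamma>" by (simp only:)
    then have "AE s in \<nu>. s 0 = \<gamma>" unfolding d_def by (subst (asm) AE_distr_iff[OF s0m]) auto
    then show "\<exists>c. AE s in \<nu>. s 0 = c" by blast
  qed
qed

end

context scaled_random_measure
begin

text \<open>
  If \<open>b\<^sub>m\<^sub>n / b\<^sub>n \<le> \<rho> < sqrt m\<close>, the modulus at frequency 1 for \<open>m\<close> blocks at scale \<open>b\<^sub>n\<close>, whose mean tends to
  \<open>L m\<close>, is also the modulus at a frequency at most \<open>\<rho>\<close> for one block at scale \<open>b\<^sub>m\<^sub>n\<close>, whose mean is
  asymptotically at least \<open>L (\<rho>\<^sup>2) > L m\<close>.  The bound from above is symmetric, with the roles of the two
  scales exchanged.
\<close>

lemma scale_ratio_limit: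
  assumes var: "variance_law \<pi>" and fin: "measure \<pi> {v. v < \<infinity>} = 1" and nz: "\<pi> \<noteq> return borel 0"
    and tails: "\<And>\<epsilon>. \<epsilon> > 0 \<Longrightarrow> vanishes_in_prob M (\<lambda>n \<omega>. exceedance (p \<omega>) b \<epsilon> n)"
    and L: "\<And>s. s > 0 \<Longrightarrow> (\<lambda>n. expectation (\<lambda>\<omega>. exp (- (s * tvar 1 n \<omega>)))) \<longlonglongrightarrow> laplace \<pi> s"
    and rot: "\<And>k t. k \<ge> 1 \<Longrightarrow> (\<lambda>n. expectation (\<lambda>\<omega>. sq_char n t \<omega> ^ k)) \<longlonglongrightarrow> laplace \<pi> (real k * t\<^sup>2)"
    and m: "m \<ge> 1"
  shows "(\<lambda>n. b (m * n) / b n) \<longlonglongrightarrow> sqrt (real m)"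
proof -
  interpret V: variance_law \<pi> by (rule var)
  have sub: "filterlim (\<lambda>n. m * n) at_top sequentially"
    using m by (intro filterlim_subseq) (auto simp: strict_mono_def)
  have bm: "0 < b (m * n)" "0 < b n" if "n \<ge> 1" for n
    using that m by (auto intro!: b_pos simp: Suc_le_eq)
  have lower: "\<forall>\<^sub>F n in sequentially. \<forall>t. \<bar>t\<bar> \<le> \<rho> \<longrightarrow>
      laplace \<pi> (real k * \<rho>\<^sup>2) - e < expectation (\<lambda>\<omega>. sq_char n t \<omega> ^ k)"
    if "\<rho> > 0" "k \<ge> 1" "e > 0" for \<rho> k e
    by (rule eventually_char_power_ge[OF var zero_less_one fin _ _ that]) (fact tails L)+
  show ?thesis
  proof (rule order_tendstoI)
    fix \<rho> assume \<rho>: "\<rho> < sqrt (real m)"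
    show "\<forall>\<^sub>F n in sequentially. \<rho> < b (m * n) / b n"
    proof (cases "\<rho> > 0")
      case False
      show ?thesis
        using eventually_ge_at_top[of 1]
      proof (rule eventually_mono)
        fix n :: nat assume "1 \<le> n"
        then have "0 < b (m * n) / b n" using bm by simp
        then show "\<rho> < b (m * n) / b n" using False by linarith
      qed
    next
      case True
      have r2: "\<rho>\<^sup>2 < real m" using power_strict_mono[OF \<rho>, of 2] True by simp
      define e where "e = (laplace \<pi> (\<rho>\<^sup>2) - laplace \<pi> (real m)) / 2"
      have e: "e > 0" using V.laplace_strict_antimono[OF nz fin _ r2] by (simp add: e_def)
      have "\<forall>\<^sub>F n in sequentially. expectation (\<lambda>\<omega>. sq_char n 1 \<omega> ^ m) < laplace \<pi> (real m) + e"
        using rot[OF m, of 1] e by (intro order_tendstoD(2)) auto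
      moreover have "\<forall>\<^sub>F n in sequentially. \<forall>t. \<bar>t\<bar> \<le> \<rho> \<longrightarrow>
          laplace \<pi> (real 1 * \<rho>\<^sup>2) - e < expectation (\<lambda>\<omega>. sq_char (m * n) t \<omega> ^ 1)"
        by (rule eventually_compose_filterlim[OF lower[OF True order_refl e] sub])
      ultimately show ?thesis
        using eventually_ge_at_top[of 1]
      proof eventually_elim
        case (elim n)
        note pos = bm[OF elim(3)]
        show ?case
        proof (rule ccontr)
          assume "\<not> \<rho> < b (m * n) / b n"
          then have "\<bar>b (m * n) / b n\<bar> \<le> \<rho>" using pos by simp
          with elim(2) have "laplace \<pi> (\<rho>\<^sup>2) - e < expectation (\<lambda>\<omega>. sq_char (m * n) (b (m * n) / b n) \<omega> ^ 1)" by simp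
          moreover have "(\<lambda>\<omega>. sq_char (m * n) (b (m * n) / b n) \<omega> ^ 1) = (\<lambda>\<omega>. sq_char n 1 \<omega> ^ m)"
            using pos by (intro ext) (simp add: sq_char_def power_mult[symmetric] mult_ac)
          moreover have "laplace \<pi> (\<rho>\<^sup>2) - e = laplace \<pi> (real m) + e" by (simp add: e_def field_simps)
          ultimately show False using elim(1) by simp
        qed
      qed
    qed
  next
    fix \<rho> assume \<rho>: "sqrt (real m) < \<rho>"
    have \<rho>0: "0 < \<rho>" by (rule le_less_trans[OF _ \<rho>]) simp
    then have ir: "0 < 1 / \<rho>" by simp
    have r2: "real m * (1 / \<rho>)\<^sup>2 < 1"
    proof -
      have "real m < \<rho>\<^sup>2" using power_strict_mono[OF \<rho>, of 2] by simp
      then show ?thesis using \<rho>0 by (simp add: power_divide)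
    qed
    define e where "e = (laplace \<pi> (real m * (1 / \<rho>)\<^sup>2) - laplace \<pi> 1) / 2"
    have e: "e > 0" using V.laplace_strict_antimono[OF nz fin _ r2] by (simp add: e_def)
    have "\<forall>\<^sub>F n in sequentially. expectation (\<lambda>\<omega>. sq_char n 1 \<omega> ^ 1) < laplace \<pi> 1 + e"
      using rot[of 1 1] e by (intro order_tendstoD(2)) auto
    then have "\<forall>\<^sub>F n in sequentially. expectation (\<lambda>\<omega>. sq_char (m * n) 1 \<omega> ^ 1) < laplace \<pi> 1 + e"
      by (rule eventually_compose_filterlim[OF _ sub])
    moreover note lower[OF ir m e]
    ultimately show "\<forall>\<^sub>F n in sequentially. b (m * n) / b n < \<rho>"
      using eventually_ge_at_top[of 1]
    proof eventually_elim
      case (elim n)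
      note pos = bm[OF elim(3)]
      show ?case
      proof (rule ccontr)
        assume "\<not> b (m * n) / b n < \<rho>"
        then have "\<bar>b n / b (m * n)\<bar> \<le> 1 / \<rho>" using pos \<rho>0 by (simp add: field_simps)
        with elim(2) have "laplace \<pi> (real m * (1 / \<rho>)\<^sup>2) - e < expectation (\<lambda>\<omega>. sq_char n (b n / b (m * n)) \<omega> ^ m)" by simp
        moreover have "(\<lambda>\<omega>. sq_char n (b n / b (m * n)) \<omega> ^ m) = (\<lambda>\<omega>. sq_char (m * n) 1 \<omega> ^ 1)"
          using pos by (intro ext) (simp add: sq_char_def power_mult[symmetric] mult_ac)
        moreover have "laplace \<pi> (real m * (1 / \<rho>)\<^sup>2) - e = laplace \<pi> 1 + e" by (simp add: e_def field_simps)
        ultimately show False using elim(1) by simp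
      qed
    qed
  qed
qed

lemma slowly_varying_normalisation:
  assumes "\<And>m. m \<ge> 1 \<Longrightarrow> (\<lambda>n. b (m * n) / b n) \<longlonglongrightarrow> sqrt (real m)"
  shows "\<exists>h. slowly_varying_nat h \<and> (\<forall>n\<ge>1. b n = real n powr (1/2) * h n)"
proof (intro exI conjI allI impI)
  define h where "h n = b n / real n powr (1/2)" for n
  show "b n = real n powr (1/2) * h n" if "n \<ge> 1" for n using that by (simp add: h_def)
  show "slowly_varying_nat h"
    unfolding slowly_varying_nat_def
  proof (intro conjI allI impI)
    show "0 < h n" if "1 \<le> n" for n using that b_pos[OF that] by (simp add: h_def)
    fix m :: nat assume m: "1 \<le> m"
    have "(\<lambda>n. b (m * n) / b n / sqrt (real m)) \<longlonglongrightarrow> sqrt (real m) / sqrt (real m)"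
      using m by (intro tendsto_divide assms tendsto_const) auto
    moreover have "\<forall>\<^sub>F n in sequentially. b (m * n) / b n / sqrt (real m) = h (m * n) / h n"
      using eventually_ge_at_top[of 1]
    proof (rule eventually_mono)
      fix n :: nat assume n: "1 \<le> n"
      have "h (m * n) = b (m * n) / (sqrt (real m) * sqrt (real n))"
        by (simp add: h_def powr_half_sqrt real_sqrt_mult)
      moreover have "h n = b n / sqrt (real n)" by (simp add: h_def powr_half_sqrt)
      moreover have "sqrt (real n) > 0" using n by simp
      ultimately show "b (m * n) / b n / sqrt (real m) = h (m * n) / h n" by (simp add: field_simps)
    qed
    ultimately show "(\<lambda>n. h (m * n) / h n) \<longlonglongrightarrow> 1"
      using m by (simp add: tendsto_cong)
  qed
qed

end

section \<open>The limit theorem\<close>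

theorem theorem4:
  fixes M :: "'a measure"
    and X :: "nat \<Rightarrow> nat \<Rightarrow> 'a \<Rightarrow> real"
    and pstar :: "'a \<Rightarrow> real measure"
    and a b :: "nat \<Rightarrow> real"
    and \<gamma> :: real
    and \<pi> :: "ennreal measure"
  assumes "prob_space M"
    and "exchangeable_array M X"
    and "directing_random_measure M X pstar"
    and "\<forall>n\<ge>1. b n > 0"
    and "filterlim b at_top sequentially"
    and "prob_space \<pi>" and "sets \<pi> = sets borel"
  defines "convergence \<equiv>
      (\<exists>\<nu> :: (nat \<Rightarrow> real) measure.
         prob_space \<nu> \<and> sets \<nu> = sets borel \<and>
         weakly_converges (row_law M X a b) \<nu> \<and>
         \<not> (\<exists>c. AE s in \<nu>. s 0 = c) \<and>
         normal_variance_mixture \<gamma> \<pi> \<nu>)"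
    and "conditions \<equiv>
      (\<exists>\<tau>>0.
         converges_in_prob M (\<lambda>n \<omega>. trunc_mean (pstar \<omega>) b \<tau> n - a n / b n) \<gamma> \<and>
         weakly_converges (var_law M pstar b \<tau>) \<pi>) \<and>
      \<pi> \<noteq> return borel 0 \<and> measure \<pi> {v. v < \<infinity>} = 1 \<and>
      (\<forall>\<epsilon>>0. weakly_converges (tail_law M pstar b \<epsilon>) (return borel 0))"
  shows "(convergence \<longleftrightarrow> conditions) \<and>
    (convergence \<longrightarrow>
      (\<exists>h. slowly_varying_nat h \<and> (\<forall>n\<ge>1. b n = real n powr (1/2) * h n)))"
proof -
  interpret prob_space M by (rule assms(1))
  have X: "X i j \<in> borel_measurable M" for i j
    using assms(2) by (simp add: exchangeable_array_def)
  have p: "pstar \<in> M \<rightarrow>\<^sub>M prob_algebra borel"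
    using assms(3) by (simp add: directing_random_measure_def)
  interpret S: scaled_random_measure M pstar b
    using assms(4,5) p by unfold_locales auto
  have vl: "variance_law \<pi>"
    unfolding variance_law_def variance_law_axioms_def using assms(6,7) by simp
  interpret V: variance_law \<pi> by (rule vl)
  have row: "prob_space (row_law M X a b n)" "sets (row_law M X a b n) = sets borel" for n
  proof -
    have "(\<lambda>\<omega> i. row_average X b i n \<omega> - a n / b n) \<in> M \<rightarrow>\<^sub>M borel"
      using X by (intro measurable_coordinatewise_then_product) (simp add: row_average_def)
    then show "prob_space (row_law M X a b n)" unfolding row_law_def by (rule prob_space_distr)
  qed (simp add: row_law_def)
  have mean_iff: "converges_in_prob M (\<lambda>n \<omega>. trunc_mean (pstar \<omega>) b \<tau> n - a n / b n) \<gamma>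
      \<longleftrightarrow> vanishes_in_prob M (\<lambda>n \<omega>. trunc_mean (pstar \<omega>) b \<tau> n - a n / b n - \<gamma>)" for \<tau>
    by (subst vanishes_in_prob_iff) (simp_all add: converges_in_prob_def)
  have mix_eq: "(\<integral>s. exp (\<i> * complex_of_real (\<Sum>k<m. t k * s k)) \<partial>\<nu>)
      = iexp (\<gamma> * (\<Sum>k<m. t k)) * complex_of_real (laplace \<pi> ((\<Sum>k<m. (t k)\<^sup>2) / 2))"
    if "normal_variance_mixture \<gamma> \<pi> \<nu>" "m \<ge> 1" for \<nu> and m :: nat and t :: "nat \<Rightarrow> real"
    using that unfolding normal_variance_mixture_def V.mixture_eq_laplace by blast
  have necessary: "conditions \<and> (\<exists>h. slowly_varying_nat h \<and> (\<forall>n\<ge>1. b n = real n powr (1/2) * h n))"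
    if convergence
  proof -
    from that obtain \<nu> where \<nu>: "prob_space \<nu>" "sets \<nu> = sets borel"
      and wc: "weakly_converges (row_law M X a b) \<nu>" and nd: "\<not> (\<exists>c. AE s in \<nu>. s 0 = c)"
      and mix: "normal_variance_mixture \<gamma> \<pi> \<nu>"
      unfolding convergence_def by blast
    \<comment> \<open>the characteristic function at frequency 0 shows that no mass sits at infinity\<close>
    have fin: "measure \<pi> {v. v < \<infinity>} = 1"
    proof -
      interpret K: prob_space \<nu> by (rule \<nu>)
      have "complex_of_real (laplace \<pi> 0) = 1"
        using mix_eq[OF mix order_refl, of "\<lambda>_. 0"] by (simp add: K.prob_space)
      then show ?thesis by (simp add: V.laplace_0)
    qed
    have cf: "(\<lambda>n. expectation (\<lambda>\<omega>. \<Prod>k<m. centred_char (pstar \<omega>) a b n (t k)))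
      \<longlonglongrightarrow> iexp (\<gamma> * (\<Sum>k<m. t k)) * complex_of_real (laplace \<pi> ((\<Sum>k<m. (t k)\<^sup>2) / 2))"
      if "m \<ge> 1" for m and t :: "nat \<Rightarrow> real"
      using weakly_converges_imp_char[OF row \<nu> wc, where m=m and t=t]
      unfolding integral_row_law[OF assms(3) X] mix_eq[OF mix that] .
    have nz: "\<pi> \<noteq> return borel 0"
      using V.mixture_degenerate_iff[OF fin \<nu> mix] nd by blast
    note tails = S.tails_vanish[OF vl fin cf]
    note lap = S.laplace_limit[OF vl fin cf]
    note rot = S.sq_char_power_limit[OF vl fin cf]
    have "conditions"
      unfolding conditions_def mean_iff
    proof (intro conjI exI[of _ "1 :: real"])
      show "vanishes_in_prob M (\<lambda>n \<omega>. trunc_mean (pstar \<omega>) b 1 n - a n / b n - \<gamma>)"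
        by (rule S.mean_limit[OF vl fin cf])
      show "weakly_converges (var_law M pstar b 1) \<pi>"
        by (rule S.var_law_of_laplace[OF vl zero_less_one lap])
      show "\<forall>\<epsilon>>0. weakly_converges (tail_law M pstar b \<epsilon>) (return borel 0)"
        unfolding S.tails_iff using tails by blast
    qed (use nz fin in simp_all)
    moreover have "(\<lambda>n. b (m * n) / b n) \<longlonglongrightarrow> sqrt (real m)" if "m \<ge> 1" for m
      by (rule S.scale_ratio_limit[OF vl fin nz tails lap rot that])
    ultimately show ?thesis using S.slowly_varying_normalisation by blast
  qed
  have sufficient: convergence if conditions
  proof -
    from that obtain \<tau> where \<tau>: "\<tau> > 0"
      and mean: "vanishes_in_prob M (\<lambda>n \<omega>. trunc_mean (pstar \<omega>) b \<tau> n - a n / b n - \<gamma>)"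
      and vlaw: "weakly_converges (var_law M pstar b \<tau>) \<pi>"
      and nz: "\<pi> \<noteq> return borel 0" and fin: "measure \<pi> {v. v < \<infinity>} = 1"
      and tails: "\<forall>\<epsilon>>0. vanishes_in_prob M (\<lambda>n \<omega>. exceedance (pstar \<omega>) b \<epsilon> n)"
      unfolding conditions_def mean_iff S.tails_iff by blast
    obtain \<nu> :: "(nat \<Rightarrow> real) measure" where \<nu>: "prob_space \<nu>" "sets \<nu> = sets borel"
      and mix: "normal_variance_mixture \<gamma> \<pi> \<nu>"
      using V.mixture_exists[OF fin] by blast
    have "weakly_converges (row_law M X a b) \<nu>"
    proof (rule weak_convergence_of_characteristic_functions[OF row \<nu>])
      fix m :: nat and t :: "nat \<Rightarrow> real" assume m: "m \<ge> 1"
      show "(\<lambda>n. \<integral>s. exp (\<i> * complex_of_real (\<Sum>k<m. t k * s k)) \<partial>row_law M X a b n)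
        \<longlonglongrightarrow> (\<integral>s. exp (\<i> * complex_of_real (\<Sum>k<m. t k * s k)) \<partial>\<nu>)"
        unfolding integral_row_law[OF assms(3) X] mix_eq[OF mix m]
        by (rule S.joint_char_limit[OF vl \<tau> fin tails[rule_format] S.laplace_of_var_law[OF vl vlaw \<tau>] mean])
    qed
    moreover have "\<not> (\<exists>c. AE s in \<nu>. s 0 = c)"
      using V.mixture_degenerate_iff[OF fin \<nu> mix] nz by blast
    ultimately show ?thesis
      unfolding convergence_def using \<nu> mix by blast
  qed
  show ?thesis using necessary sufficient by blast
qed

end
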